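(* For the Weierstrass spectral curve, for $2g-2+n\ge0$ (with $g,n\ge0$) and $\mathbf z=\{z_1,\dots,z_n\}$, $$B_{g,n+1}(\mathbf z)=-\left(\frac{W_{g,n+1}(-z_0,\mathbf z)}{dz_0}\right)_{z_0=0}+\sum_{i=1}^nd_{z_i}\left(\frac{P_1(z_i;\tau)}{\wp'(z_i;\tau)}\,\frac{W_{g,n}(-z_i,\mathbf z\setminus\{z_i\})}{dx(z_i)}\right).$$
   Context: Basic objects. Let $\operatorname{Im}\tau>0$, $\Lambda=\mathbb Z+\mathbb Z\tau$, $\Sigma=\mathbb C/\Lambda$, and let $\wp(z;\tau)$, $\zeta(z;\tau)$ be the Weierstrass functions of $\Lambda$ (so $\zeta'=-\wp$). Put $G_2(\tau)=\sum_{m\ne0}m^{-2}+\sum_{n\ne0}\sum_{m\in\mathbb Z}(m+n\tau)^{-2}$, $P_2(z;\tau)=\wp(z;\tau)+G_2(\tau)$, $P_1(z;\tau)=-\zeta(z;\tau)+G_2(\tau)z$ (so $P_1'=P_2$). The Weierstrass spectral curve is $(\Sigma,x,y)$ with $x=\wp(z;\tau)$, $y=\wp'(z;\tau)$; $dx(z)=\wp'(z;\tau)dz$. Let $w_1=\frac12$, $w_2=\frac\tau2$, $w_3=-\frac{1+\tau}2$ and $R=\{w_1,w_2,w_3,0\}$. $d_{z_i}$ is the exterior derivative in $z_i$. Correlation functions. $W_{0,1}(z)=\wp'(z;\tau)^2dz$, $W_{0,2}(z_1,z_2)=P_2(z_1-z_2;\tau)dz_1dz_2$, $W_{g,n}=0$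 for $g<0$. A differential evaluated at $-z$ means its pullback under $z\mapsto-z$ in that variable (so $dz\mapsto-dz$). For $\mathbf z=\{z_1,\dots,z_n\}$ and $g,n\ge0$ with $2g-2+n\ge0$, symmetric meromorphic differentials $W_{g,n+1}$ are defined recursively by $$W_{g,n+1}(z_0,\mathbf z)=\sum_{a\in R}\operatorname*{Res}_{z=a}\frac{(P_1(z_0-\alpha;\tau)-P_1(z_0-z;\tau))dz_0}{2\wp'(z;\tau)^2dz}\,\mathcal R^{(2)}W_{g,n+1}(z,-z;\mathbf z),$$ $$\mathcal R^{(2)}W_{g,n+1}(z,-z;\mathbf z)=W_{g-1,n+2}(z,-z,\mathbf z)+\sum_{g_1+g_2=g}\ \sum_{I\sqcup J=\mathbf z}{}^{'}\,W_{g_1,|I|+1}(z,I)W_{g_2,|J|+1}(-z,J),$$ where $\alpha$ is a generic base point (the result does not depend on it) and the prime excludes $(g_1,|I|)=(0,0)$ and $(g_2,|J|)=(0,0)$. $A$-cycle integrals. For $2g-2+n\ge0$, $$B_{g,n+1}(\mathbf z)=\oint_A\frac{\mathcal R^{(2)}W_{g,n+1}(z,-z;\mathbf z)}{2\wp'(z;\tau)^2dz},$$ where the $A$-cycle is $z\in[0,1)$, shifted by $i\epsilon$ to avoid poles on the contour.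
   Formalization: On the right-hand side W(-z_0,..)/dz_0 and W(-z_i,..)/dx(z_i) are coefficients evaluated at -z_0, -z_i without the pullback sign (with it the formula is false, e.g. B_{1,1}); the A-cycle shift satisfies |Im z_i| < ε < Im τ/2, since otherwise P_1(z_i) is on the wrong branch. *)

theory Defs
  imports "HOL-Complex_Analysis.Complex_Analysis"
begin

definition lattice :: "complex \<Rightarrow> complex set" where
  "lattice \<tau> = {of_int m + of_int n * \<tau> | m n. True}"

definition wp :: "complex \<Rightarrow> complex \<Rightarrow> complex" where
  "wp \<tau> z = 1 / z\<^sup>2 + (\<Sum>\<^sub>\<infinity>\<omega>\<in>lattice \<tau> - {0}. 1 / (z - \<omega>)\<^sup>2 - 1 / \<omega>\<^sup>2)"

definition wzeta :: "complex \<Rightarrow> complex \<Rightarrow> complex" where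
  "wzeta \<tau> z = 1 / z + (\<Sum>\<^sub>\<infinity>\<omega>\<in>lattice \<tau> - {0}. 1 / (z - \<omega>) + 1 / \<omega> + z / \<omega>\<^sup>2)"

abbreviation wp' :: "complex \<Rightarrow> complex \<Rightarrow> complex" where
  "wp' \<tau> \<equiv> deriv (wp \<tau>)"

text \<open>The double series for \<open>G\<^sub>2\<close> is only conditionally convergent, so the order of the two
  summations matters; each of the iterated sums converges absolutely.\<close>

definition G2 :: "complex \<Rightarrow> complex" where
  "G2 \<tau> = (\<Sum>\<^sub>\<infinity>m\<in>- {0::int}. 1 / (of_int m)\<^sup>2)
         + (\<Sum>\<^sub>\<infinity>n\<in>- {0::int}. \<Sum>\<^sub>\<infinity>m\<in>(UNIV :: int set). 1 / (of_int m + of_int n * \<tau>)\<^sup>2)"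

definition P2 :: "complex \<Rightarrow> complex \<Rightarrow> complex" where
  "P2 \<tau> z = wp \<tau> z + G2 \<tau>"

definition P1 :: "complex \<Rightarrow> complex \<Rightarrow> complex" where
  "P1 \<tau> z = - wzeta \<tau> z + G2 \<tau> * z"

definition ram_points :: "complex \<Rightarrow> complex set" where
  "ram_points \<tau> = {1/2, \<tau>/2, - (1 + \<tau>)/2, 0}"

text \<open>A multidifferential \<open>W\<^sub>g\<^sub>,\<^sub>n(z\<^sub>1, \<dots>, z\<^sub>n) = w(z\<^sub>1, \<dots>, z\<^sub>n) dz\<^sub>1 \<dots> dz\<^sub>n\<close> is represented by its
  coefficient \<open>w\<close>, a function of the list \<open>[z\<^sub>1, \<dots>, z\<^sub>n]\<close>.

  \<open>R2 w g z zs\<close> is the coefficient of \<open>dz\<^sup>2\<close> (and of the \<open>dz\<^sub>i\<close>) in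
  \<open>\<R>\<^sup>(\<^sup>2\<^sup>)W\<^sub>g\<^sub>,\<^sub>n\<^sub>+\<^sub>1(z, -z; zs)\<close>. Exactly one argument of each term is \<open>-z\<close>; it stands for the pullback
  under \<open>z \<mapsto> -z\<close>, and \<open>d(-z) = -dz\<close> is where the minus signs come from.
  The subset \<open>I\<close> of index positions selects the first part of the splitting of \<open>zs\<close>.\<close>

definition splittings :: "nat \<Rightarrow> nat \<Rightarrow> (nat \<times> nat set) set" where
  "splittings g n = {(g1, I). g1 \<le> g \<and> I \<subseteq> {..<n} \<and>
     (g1, card I) \<noteq> (0, 0) \<and> (g - g1, card ({..<n} - I)) \<noteq> (0, 0)}"

definition R2 :: "(nat \<Rightarrow> complex list \<Rightarrow> complex) \<Rightarrow> nat \<Rightarrow> complex \<Rightarrow> complex list \<Rightarrow> complex" where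
  "R2 w g z zs =
     (if g = 0 then 0 else - w (g - 1) (z # (-z) # zs)) +
     (\<Sum>(g1, I)\<in>splittings g (length zs).
        - (w g1 (z # nths zs I) * w (g - g1) ((-z) # nths zs ({..<length zs} - I))))"

lemma length_nths_subset: "I \<subseteq> {..<length zs} \<Longrightarrow> length (nths zs I) = card I"
  by (simp add: length_nths) (rule arg_cong[where f = card], auto)

lemma R2_cong [fundef_cong]:
  assumes "g = g'" "z = z'" "zs = zs'"
    and w: "\<And>h us. 2 * h + length us < 2 * g' + length zs' + 1 \<Longrightarrow> w h us = w' h us"
  shows "R2 w g z zs = R2 w' g' z' zs'"
proof -
  have "w g1 (z' # nths zs' I) = w' g1 (z' # nths zs' I) \<and>
        w (g' - g1) (- z' # nths zs' ({..<length zs'} - I)) =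
        w' (g' - g1) (- z' # nths zs' ({..<length zs'} - I))"
    if "(g1, I) \<in> splittings g' (length zs')" for g1 I
  proof -
    let ?n = "length zs'"
    have I: "I \<subseteq> {..<?n}" and g1: "g1 \<le> g'"
      and ne: "g1 \<noteq> 0 \<or> card I \<noteq> 0" "g' - g1 \<noteq> 0 \<or> card ({..<?n} - I) \<noteq> 0"
      using that by (auto simp: splittings_def)
    have "card I + card ({..<?n} - I) = ?n"
      using card_Int_Diff[of "{..<?n}" I] I by (simp add: Int_absorb1)
    moreover have "length (nths zs' I) = card I"
        "length (nths zs' ({..<?n} - I)) = card ({..<?n} - I)"
      using I by (auto intro!: length_nths_subset)
    ultimately show ?thesis
      using g1 ne by (intro conjI w; simp only: length_Cons; linarith)
  qed
  then show ?thesis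
    unfolding R2_def assms(1-3) using w by (intro arg_cong2[of _ _ _ _ "(+)"] sum.cong) auto
qed

text \<open>\<open>\<alpha>\<close> is the base point of the recursion kernel. The value at \<open>[]\<close> (there is no \<open>W\<^sub>g\<^sub>,\<^sub>0\<close>) is
  arbitrary and never used. \<open>W \<tau> \<alpha> g (-z # zs)\<close> itself is the coefficient evaluated at \<open>-z\<close>, without
  the sign of the pullback: the terms \<open>W(-z\<^sub>0, \<dots>)/dz\<^sub>0\<close> and \<open>W(-z\<^sub>i, \<dots>)/dx(z\<^sub>i)\<close> of the formula for \<open>B\<close>
  are meant in this sense (with pullbacks there, its right-hand side would change sign).\<close>

function W :: "complex \<Rightarrow> complex \<Rightarrow> nat \<Rightarrow> complex list \<Rightarrow> complex" where
  "W \<tau> \<alpha> g [] = 0"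
| "W \<tau> \<alpha> g (z0 # zs) =
     (if g = 0 \<and> length zs = 0 then (wp' \<tau> z0)\<^sup>2
      else if g = 0 \<and> length zs = 1 then P2 \<tau> (z0 - hd zs)
      else \<Sum>a\<in>ram_points \<tau>.
        residue (\<lambda>z. (P1 \<tau> (z0 - \<alpha>) - P1 \<tau> (z0 - z)) / (2 * (wp' \<tau> z)\<^sup>2) *
                     R2 (\<lambda>h us. W \<tau> \<alpha> h us) g z zs) a)"
  by pat_completeness auto
termination
  by (relation "Wellfounded.measure (\<lambda>(\<tau>, \<alpha>, g, zs). 2 * g + length zs)") auto

definition A_cycle :: "real \<Rightarrow> real \<Rightarrow> complex" where
  "A_cycle \<epsilon> = linepath (\<i> * of_real \<epsilon>) (1 + \<i> * of_real \<epsilon>)"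

text \<open>The coefficient of \<open>dz\<^sub>1 \<dots> dz\<^sub>n\<close> in \<open>B\<^sub>g\<^sub>,\<^sub>n\<^sub>+\<^sub>1(z\<^sub>1, \<dots>, z\<^sub>n)\<close>.\<close>

definition B :: "complex \<Rightarrow> complex \<Rightarrow> real \<Rightarrow> nat \<Rightarrow> complex list \<Rightarrow> complex" where
  "B \<tau> \<alpha> \<epsilon> g zs =
     contour_integral (A_cycle \<epsilon>) (\<lambda>z. R2 (W \<tau> \<alpha>) g z zs / (2 * (wp' \<tau> z)\<^sup>2))"

text \<open>The shifted \<open>A\<close>-cycle lies above all \<open>\<plusminus>z\<^sub>i\<close> and below the half period \<open>\<tau>/2\<close>. The values of
  \<open>W\<close> and \<open>R2\<close> are unchanged under \<open>z\<^sub>i \<mapsto> z\<^sub>i + \<tau>\<close>, but \<open>P1 \<tau> (z\<^sub>i)\<close> changes by \<open>2\<pi>\<i>\<close>, and the integral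
  jumps when a pole \<open>\<plusminus>z\<^sub>i\<close> crosses the contour; so the position of the \<open>z\<^sub>i\<close> relative to the contour
  has to be fixed.\<close>

definition admissible_shift :: "complex \<Rightarrow> complex list \<Rightarrow> real \<Rightarrow> bool" where
  "admissible_shift \<tau> zs \<epsilon> \<longleftrightarrow> 0 < \<epsilon> \<and> \<epsilon> < Im \<tau> / 2 \<and> (\<forall>z\<in>set zs. \<bar>Im z\<bar> < \<epsilon>)"

text \<open>The points \<open>z\<^sub>i\<close> avoid the poles of the multidifferentials: the points of \<open>R\<close>, and the pole
  \<open>z\<^sub>i = -z\<^sub>j\<close> of \<open>W\<^sub>0\<^sub>,\<^sub>2(-z\<^sub>i, z\<^sub>j)\<close>.\<close>

definition admissible_points :: "complex \<Rightarrow> complex list \<Rightarrow> bool" where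
  "admissible_points \<tau> zs \<longleftrightarrow>
     (\<forall>z\<in>set zs. \<forall>a\<in>ram_points \<tau>. z - a \<notin> lattice \<tau>) \<and>
     (\<forall>i<length zs. \<forall>j<length zs. i \<noteq> j \<longrightarrow> zs ! i + zs ! j \<notin> lattice \<tau>)"

text \<open>The term \<open>P1 \<tau> (z\<^sub>0 - \<alpha>)\<close> has no pole at the points \<open>z\<^sub>0\<close> that matter: those of \<open>R\<close>, the
  \<open>\<plusminus>z\<^sub>i\<close>, and the points \<open>\<plusminus>z\<close> with \<open>z\<close> on the contour.\<close>

definition generic_base_point :: "complex \<Rightarrow> complex list \<Rightarrow> real \<Rightarrow> complex \<Rightarrow> bool" where
  "generic_base_point \<tau> zs \<epsilon> \<alpha> \<longleftrightarrow>
     (\<forall>p \<in> ram_points \<tau> \<union> set zs \<union> path_image (A_cycle \<epsilon>).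
        p - \<alpha> \<notin> lattice \<tau> \<and> - p - \<alpha> \<notin> lattice \<tau>)"

definition remove_nth :: "nat \<Rightarrow> 'a list \<Rightarrow> 'a list" where
  "remove_nth i xs = take i xs @ drop (Suc i) xs"

end

theory Submission
  imports Defs
begin

text \<open>\<open>P1\<close> is odd, has simple poles on the lattice, is invariant under \<open>1\<close> and gains \<open>2\<pi>\<i>\<close> under \<open>\<tau>\<close>.
  Hence, for an elliptic \<open>t\<close>, integrating \<open>P1 \<cdot> t\<close> around the torus expresses the \<open>A\<close>-period of \<open>t\<close> as
  minus the sum of the residues of \<open>P1 \<cdot> t\<close>. For the integrand of \<open>B\<close>, the residues at the ramification
  points add up to \<open>- W(0, zs)\<close>, and the double poles of the factors \<open>W\<^sub>0\<^sub>,\<^sub>2\<close> at \<open>\<plusminus>z\<^sub>i\<close> yield the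
  derivative terms; the two signs agree because all stable \<open>W\<close> are even and elliptic in every argument.
  The latter follows by induction along the recursion, the parity being needed to cancel the dependence
  on the base point; the base case \<open>W\<^sub>0\<^sub>,\<^sub>3\<close> needs that the zeros of \<open>wp'\<close> are simple.\<close>

subsection \<open>Lattice sums\<close>

text \<open>Since \<open>P1\<close> is not elliptic, the recursion kernel is not elliptic in
  \<open>z0\<close>. But the integrand is symmetric about every half period, and a function with
  this symmetry has no residue there. So the symmetric part of the kernel, base point included,
  drops out; what remains is \<open>P1 \<tau> (x - u) - P1 \<tau> (x + u)\<close>, which is even and
  elliptic in \<open>x\<close>. To take residues in one variable and stay in a class of functions of
  the others, variables are separated: \<open>elliptic_alg\<close> consists of polynomials in
  functions of single points, so a residue in \<open>u\<close> meets only Taylor coefficients of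
  kernels. The case \<open>(g, n) = (0, 2)\<close> resists this scheme, as both factors of a
  splitting are \<open>W\<^sub>0\<^sub>,\<^sub>2\<close>; it is symmetrised, and the remainder is
  harmless because \<open>1 / wp'\<close> has at most simple poles. That fact is obtained without
  the cubic equation for \<open>wp'\<close>, by writing \<open>1 / wp'\<close> as a combination of
  translates of \<open>P1\<close>. Values at poles are arbitrary, so identities are stated off the
  half periods \<open>H\<close> and transferred through punctured neighbourhoods.\<close>

lemma summable_on_int_powr:
  fixes s :: real
  assumes "s < -1"
  shows "(\<lambda>m::int. (1 + \<bar>of_int m\<bar>) powr s) summable_on UNIV"
proof -
  have "summable (\<lambda>n. of_nat n powr s :: real)"
    using assms by (simp add: summable_real_powr_iff)
  then have "summable (\<lambda>n. of_nat (Suc n) powr s :: real)"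
    by (subst summable_Suc_iff)
  then have nat: "(\<lambda>n. (1 + real n) powr s) summable_on UNIV"
    by (intro norm_summable_imp_summable_on) (simp add: add.commute)
  have "(\<lambda>m::int. (1 + \<bar>of_int m\<bar>) powr s) summable_on range int"
    by (subst summable_on_reindex) (use nat in \<open>auto simp: o_def\<close>)
  moreover have "(\<lambda>m::int. (1 + \<bar>of_int m\<bar>) powr s) summable_on range (\<lambda>n. - int n)"
    by (subst summable_on_reindex) (use nat in \<open>auto simp: o_def inj_on_def\<close>)
  then have "(\<lambda>m::int. (1 + \<bar>of_int m\<bar>) powr s) summable_on (range (\<lambda>n. - int n) - range int)"
    by (rule summable_on_subset_banach) auto
  ultimately have "(\<lambda>m::int. (1 + \<bar>of_int m\<bar>) powr s) summable_on
      range int \<union> (range (\<lambda>n. - int n) - range int)"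
    by (rule summable_on_Un_disjoint) auto
  moreover have "x \<in> range int \<union> (range (\<lambda>n. - int n) - range int)" for x
    by (cases x rule: int_cases2) auto
  then have "range int \<union> (range (\<lambda>n. - int n) - range int) = UNIV" by blast
  ultimately show ?thesis by simp
qed

text \<open>The half-lines of nonnegative and of negative integers telescope separately, to
  \<open>- b 0\<close> and to \<open>b 0\<close>.\<close>

lemma infsum_telescope_int:
  fixes b :: "int \<Rightarrow> complex"
  assumes sm: "(\<lambda>m. b (m + 1) - b m) summable_on UNIV"
    and top: "(\<lambda>n. b (int n)) \<longlonglongrightarrow> 0" and bot: "(\<lambda>n. b (- int n)) \<longlonglongrightarrow> 0"
  shows "(\<Sum>\<^sub>\<infinity>m. b (m + 1) - b m) = 0"
proof -
  let ?f = "\<lambda>m. b (m + 1) - b m"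
  have sub: "?f summable_on A" for A
    by (rule summable_on_subset_banach[OF sm]) auto
  have "((\<lambda>n. ?f (int n)) has_sum infsum ?f (range int)) UNIV"
    using has_sum_infsum[OF sub, of "range int"] by (subst (asm) has_sum_reindex) (auto simp: o_def)
  then have 1: "(\<lambda>n. ?f (int n)) sums infsum ?f (range int)"
    by (rule has_sum_imp_sums)
  have "(\<lambda>n. b (int (Suc n)) - b (int n)) sums (0 - b (int 0))"
    by (rule telescope_sums[OF top])
  then have 2: "(\<lambda>n. ?f (int n)) sums (- b 0)" by (simp add: add.commute)
  have "((\<lambda>n. ?f (- int (Suc n))) has_sum infsum ?f (range (\<lambda>n. - int (Suc n)))) UNIV"
    using has_sum_infsum[OF sub, of "range (\<lambda>n. - int (Suc n))"]
    by (subst (asm) has_sum_reindex) (auto simp: o_def inj_on_def)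
  then have 3: "(\<lambda>n. ?f (- int (Suc n))) sums infsum ?f (range (\<lambda>n. - int (Suc n)))"
    by (rule has_sum_imp_sums)
  have "(\<lambda>n. b (- int n) - b (- int (Suc n))) sums (b (- int 0) - 0)"
    by (rule telescope_sums'[OF bot])
  then have 4: "(\<lambda>n. ?f (- int (Suc n))) sums b 0" by simp
  have "range int \<inter> range (\<lambda>n. - int (Suc n)) = {}" by auto
  then have "infsum ?f (range int \<union> range (\<lambda>n. - int (Suc n))) = - b 0 + b 0"
    using sums_unique2[OF 1 2] sums_unique2[OF 3 4]
    by (simp only: infsum_Un_disjoint[OF sub sub])
  moreover have "x \<in> range int \<union> range (\<lambda>n. - int (Suc n))" for x
    by (cases x rule: int_cases) (auto simp del: of_nat_Suc)
  then have "range int \<union> range (\<lambda>n. - int (Suc n)) = UNIV" by blast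
  ultimately show ?thesis by simp
qed

lemma lattice_int_tau: "of_int m + of_int n * \<tau> \<in> lattice \<tau>"
  unfolding lattice_def by blast

lemma latticeE:
  assumes "z \<in> lattice \<tau>"
  obtains m n where "z = of_int m + of_int n * \<tau>"
  using assms unfolding lattice_def by blast

lemma lattice_0: "0 \<in> lattice \<tau>"
  using lattice_int_tau[of 0 0 \<tau>] by simp

lemma lattice_uminus:
  assumes "z \<in> lattice \<tau>"
  shows "- z \<in> lattice \<tau>"
proof -
  obtain m n where "z = of_int m + of_int n * \<tau>" using assms by (rule latticeE)
  then show ?thesis using lattice_int_tau[of "- m" "- n" \<tau>] by simp
qed

lemma lattice_add:
  assumes "z \<in> lattice \<tau>" "w \<in> lattice \<tau>"
  shows "z + w \<in> lattice \<tau>"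
proof -
  obtain m n where z: "z = of_int m + of_int n * \<tau>" using assms(1) by (rule latticeE)
  obtain m' n' where w: "w = of_int m' + of_int n' * \<tau>" using assms(2) by (rule latticeE)
  show ?thesis
    using lattice_int_tau[of "m + m'" "n + n'" \<tau>] by (simp add: z w algebra_simps)
qed

lemma lattice_diff: "z \<in> lattice \<tau> \<Longrightarrow> w \<in> lattice \<tau> \<Longrightarrow> z - w \<in> lattice \<tau>"
  using lattice_add[OF _ lattice_uminus, of z \<tau> w] by simp

lemma lattice_uminus_iff: "- z \<in> lattice \<tau> \<longleftrightarrow> z \<in> lattice \<tau>"
  using lattice_uminus[of z \<tau>] lattice_uminus[of "- z" \<tau>] by auto

lemma lattice_1: "1 \<in> lattice \<tau>"
  using lattice_int_tau[of 1 0 \<tau>] by simp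

lemma lattice_tau: "\<tau> \<in> lattice \<tau>"
  using lattice_int_tau[of 0 1 \<tau>] by simp

lemma lattice_of_int: "of_int m \<in> lattice \<tau>"
  using lattice_int_tau[of m 0 \<tau>] by simp

lemma lattice_add_iff: "w \<in> lattice \<tau> \<Longrightarrow> z + w \<in> lattice \<tau> \<longleftrightarrow> z \<in> lattice \<tau>"
  using lattice_add[of z \<tau> w] lattice_diff[of "z + w" \<tau> w] by auto

section \<open>Lattice points: coordinates, cubic summability, finiteness in discs\<close>

locale upper_half =
  fixes \<tau> :: complex
  assumes Im_pos: "Im \<tau> > 0"
begin

abbreviation "\<Lambda> \<equiv> lattice \<tau>"

text \<open>The coefficient of \<tau> comes first in the pair, so that the inner sum of an iterated
  sum over pairs runs along a row with fixed \<open>n\<close>. This is the order of summation in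
  \<open>G2\<close>.\<close>

definition lpt :: "int \<times> int \<Rightarrow> complex" where
  "lpt = (\<lambda>(n, m). of_int m + of_int n * \<tau>)"

lemma lpt_eq_iff:
  "of_int m + of_int n * \<tau> = of_int m' + of_int n' * \<tau> \<longleftrightarrow> m = m' \<and> n = n'"
proof
  assume *: "of_int m + of_int n * \<tau> = of_int m' + of_int n' * \<tau>"
  have "of_int n * Im \<tau> = of_int n' * Im \<tau>" using arg_cong[OF *, of Im] by simp
  then have "n = n'" using Im_pos by simp
  with * show "m = m' \<and> n = n'" by simp
qed simp

lemma inj_lpt: "inj lpt"
  by (rule injI) (simp add: lpt_def case_prod_unfold lpt_eq_iff prod_eq_iff)

lemma range_lpt: "range lpt = \<Lambda>"
proof -
  have "z \<in> range lpt \<longleftrightarrow> z \<in> \<Lambda>" for z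
    unfolding lpt_def lattice_def image_iff by (simp add: split_paired_Ex) blast
  then show ?thesis by blast
qed

lemma lpt_eq_0_iff: "lpt p = 0 \<longleftrightarrow> p = (0, 0)"
  using injD[OF inj_lpt, of p "(0, 0)"] by (auto simp: lpt_def)

text \<open>The imaginary part controls \<open>n\<close>; the triangle inequality then controls
  \<open>m\<close>.\<close>

lemma lpt_lower_bound:
  obtains C where "C > 0"
    and "\<And>n m. \<bar>of_int m\<bar> + \<bar>of_int n\<bar> \<le> C * norm (lpt (n, m))"
proof
  let ?C = "1 + norm \<tau> / Im \<tau> + 1 / Im \<tau>"
  show "?C > 0" using Im_pos by (simp add: add_pos_nonneg)
  fix n m :: int
  let ?w = "lpt (n, m)"
  have "\<bar>of_int n\<bar> * Im \<tau> = \<bar>Im ?w\<bar>"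
    using Im_pos by (simp add: lpt_def abs_mult)
  then have "\<bar>of_int n\<bar> * Im \<tau> \<le> norm ?w" using abs_Im_le_cmod[of ?w] by simp
  then have n: "\<bar>of_int n\<bar> \<le> norm ?w / Im \<tau>" using Im_pos by (simp add: field_simps)
  have "norm (of_int m :: complex) \<le> norm ?w + norm (of_int n * \<tau>)"
    using norm_triangle_ineq4[of ?w "of_int n * \<tau>"] by (simp add: lpt_def)
  then have "\<bar>of_int m\<bar> \<le> norm ?w + \<bar>of_int n\<bar> * norm \<tau>" by (simp add: norm_mult)
  also have "\<dots> \<le> norm ?w + norm ?w / Im \<tau> * norm \<tau>"
    using n by (intro add_left_mono mult_right_mono) auto
  finally show "\<bar>of_int m\<bar> + \<bar>of_int n\<bar> \<le> ?C * norm ?w"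
    using n by (simp add: algebra_simps)
qed

text \<open>Both \<open>1 + |n|\<close> and \<open>1 + |m|\<close> are at most a constant times the
  norm of a nonzero lattice point. Giving each of them half of the exponent 3 bounds the summand by
  a product, and 3/2 > 1 makes the two one-dimensional sums converge.\<close>

lemma lpt_summable_cube: "(\<lambda>p. 1 / norm (lpt p) ^ 3) summable_on - {(0, 0)}"
proof -
  obtain C where C: "C > 0" "\<And>n m. \<bar>of_int m\<bar> + \<bar>of_int n\<bar> \<le> C * norm (lpt (n, m))"
    using lpt_lower_bound by metis
  let ?a = "\<lambda>m::int. (1 + \<bar>of_int m\<bar>) powr (-3/2) :: real"
  have a: "?a summable_on UNIV" by (rule summable_on_int_powr) simp
  have "(\<lambda>(n, m). ?a n * ?a m) summable_on UNIV \<times> UNIV"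
  proof (rule summable_on_SigmaI)
    fix n :: int
    show "((\<lambda>m. case (n, m) of (n, m) \<Rightarrow> ?a n * ?a m) has_sum ?a n * infsum ?a UNIV) UNIV"
      using has_sum_cmult_right[OF has_sum_infsum[OF a]] by simp
  next
    show "(\<lambda>n. ?a n * infsum ?a UNIV) summable_on UNIV"
      by (rule summable_on_cmult_left[OF a])
  qed auto
  then have "(\<lambda>(n, m). 8 * C ^ 3 * (?a n * ?a m)) summable_on UNIV"
    using summable_on_cmult_right[of "\<lambda>(n,m). ?a n * ?a m" UNIV "8 * C ^ 3"]
    by (simp add: case_prod_unfold)
  then have "(\<lambda>(n, m). 8 * C ^ 3 * (?a n * ?a m)) summable_on - {(0, 0)}"
    by (rule summable_on_subset_banach) auto
  then show ?thesis
  proof (rule summable_on_comparison_test)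
    fix p :: "int \<times> int" assume p: "p \<in> - {(0, 0)}"
    obtain n m where nm: "p = (n, m)" by (cases p)
    let ?w = "norm (lpt p)"
    let ?x = "1 + \<bar>of_int n :: real\<bar>" and ?y = "1 + \<bar>of_int m :: real\<bar>"
    have w: "?w > 0" using p by (simp add: lpt_eq_0_iff)
    have "\<bar>m\<bar> + \<bar>n\<bar> \<ge> 1" using p nm by (auto; linarith)
    then have 1: "1 \<le> \<bar>of_int m :: real\<bar> + \<bar>of_int n\<bar>" by linarith
    have le: "\<bar>of_int m\<bar> + \<bar>of_int n\<bar> \<le> C * ?w" using C(2) nm by simp
    have "?x * ?y \<le> (2 * (C * ?w)) * (2 * (C * ?w))"
      by (intro mult_mono) (use 1 le in linarith)+
    also have "\<dots> = (2 * C * ?w) powr 2" using C w by (simp add: powr_numeral power2_eq_square)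
    finally have "(?x * ?y) powr (3/2) \<le> ((2 * C * ?w) powr 2) powr (3/2)"
      by (intro powr_mono2) auto
    also have "\<dots> = (2 * C * ?w) ^ 3"
      using C w by (simp add: powr_powr flip: powr_numeral)
    also have "\<dots> = 8 * C ^ 3 * ?w ^ 3" by (simp add: power_mult_distrib)
    finally have "?x powr (3/2) * ?y powr (3/2) \<le> 8 * C ^ 3 * ?w ^ 3" by (simp add: powr_mult)
    moreover have "?x powr (3/2) > 0" "?y powr (3/2) > 0" by (auto simp: add_pos_nonneg)
    ultimately have "1 / ?w ^ 3 \<le> 8 * C ^ 3 * (?x powr (-3/2) * ?y powr (-3/2))"
      using w by (simp add: powr_minus field_simps)
    then show "1 / norm (lpt p) ^ 3 \<le> (case p of (n, m) \<Rightarrow> 8 * C ^ 3 * (?a n * ?a m))"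
      using nm by simp
  qed auto
qed

lemma bij_lpt: "bij_betw lpt (- {(0, 0)}) (\<Lambda> - {0})"
proof -
  have "lpt ` (- {(0, 0)}) = \<Lambda> - {0}"
    unfolding range_lpt[symmetric] by (auto simp: lpt_eq_0_iff)
  then show ?thesis
    by (simp add: bij_betw_def inj_on_subset[OF inj_lpt])
qed

lemma lattice_summable_cube: "(\<lambda>\<omega>. 1 / norm \<omega> ^ 3) summable_on \<Lambda> - {0}"
  using lpt_summable_cube summable_on_reindex_bij_betw[OF bij_lpt, of "\<lambda>\<omega>. 1 / norm \<omega> ^ 3"]
  by simp

lemma finite_lattice_ball: "finite {\<omega> \<in> \<Lambda>. norm \<omega> \<le> R}"
proof -
  obtain C where C: "C > 0" "\<And>n m. \<bar>of_int m\<bar> + \<bar>of_int n\<bar> \<le> C * norm (lpt (n, m))"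
    using lpt_lower_bound by metis
  let ?K = "\<lceil>C * R\<rceil>"
  have "{\<omega> \<in> \<Lambda>. norm \<omega> \<le> R} \<subseteq> lpt ` ({-?K..?K} \<times> {-?K..?K})"
  proof
    fix \<omega> assume "\<omega> \<in> {\<omega> \<in> \<Lambda>. norm \<omega> \<le> R}"
    then obtain n m where nm: "\<omega> = lpt (n, m)" and le: "norm (lpt (n, m)) \<le> R"
      unfolding range_lpt[symmetric] by auto
    have "C * norm (lpt (n, m)) \<le> C * R" using le C by simp
    with C(2)[of m n] have "\<bar>of_int m\<bar> + \<bar>of_int n\<bar> \<le> C * R" by linarith
    then have "\<bar>m\<bar> \<le> ?K" "\<bar>n\<bar> \<le> ?K" by linarith+
    then have "(n, m) \<in> {-?K..?K} \<times> {-?K..?K}" by auto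
    then show "\<omega> \<in> lpt ` ({-?K..?K} \<times> {-?K..?K})" using nm by blast
  qed
  then show ?thesis by (rule finite_subset) auto
qed

end

section \<open>The series of zeta and \<open>wp\<close>, term by term\<close>

definition zt :: "complex \<Rightarrow> complex \<Rightarrow> complex" where
  "zt \<omega> z = 1 / (z - \<omega>) + 1 / \<omega> + z / \<omega>\<^sup>2"

definition pt :: "complex \<Rightarrow> complex \<Rightarrow> complex" where
  "pt \<omega> z = 1 / (z - \<omega>)\<^sup>2 - 1 / \<omega>\<^sup>2"

lemma zt_0: "zt 0 z = 1 / z" and pt_0: "pt 0 z = 1 / z\<^sup>2"
  by (simp_all add: zt_def pt_def)

lemma zt_has_field_derivative:
  assumes "z \<noteq> \<omega>"
  shows "(zt \<omega> has_field_derivative - pt \<omega> z) (at z)"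
  unfolding zt_def pt_def using assms
  by (cases "\<omega> = 0") (auto intro!: derivative_eq_intros simp: field_simps power2_eq_square)

lemma zt_minus: "zt (- \<omega>) z = - zt \<omega> (- z)"
proof -
  have "z - - \<omega> = - (- z - \<omega>)" by simp
  then show ?thesis unfolding zt_def by (simp only: divide_minus_right power2_minus) simp
qed

lemma pt_minus: "pt (- \<omega>) z = pt \<omega> (- z)"
proof -
  have "z - - \<omega> = - (- z - \<omega>)" by simp
  then show ?thesis unfolding pt_def by (simp only: power2_minus)
qed

lemma
  fixes f g :: "'a \<Rightarrow> complex"
  assumes "f summable_on A" "g summable_on A"
  shows summable_on_diff: "(\<lambda>x. f x - g x) summable_on A"
    and infsum_diff: "(\<Sum>\<^sub>\<infinity>x\<in>A. f x - g x) = infsum f A - infsum g A"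
  using summable_on_add[of f A "\<lambda>x. - g x"] infsum_add[of f A "\<lambda>x. - g x"] assms
  by (simp_all add: infsum_uminus summable_on_uminus)

lemma inverse_arith_progression_tendsto:
  fixes c d :: complex
  assumes "d \<noteq> 0"
  shows "(\<lambda>n. 1 / (c + of_nat n * d)) \<longlonglongrightarrow> 0"
proof -
  have "filterlim (\<lambda>n. c + d * of_nat n) at_infinity sequentially"
    by (rule tendsto_add_filterlim_at_infinity[OF tendsto_const
          tendsto_mult_filterlim_at_infinity[OF tendsto_const assms tendsto_of_nat]])
  from filterlim_compose[OF tendsto_inverse_0 this] show ?thesis
    by (simp add: inverse_eq_divide mult.commute)
qed

context upper_half
begin

text \<open>The terms \<open>1 / \<omega> + z / \<omega>\<^sup>2\<close> cancel the Taylor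
  polynomial of degree one of \<open>1 / (z - \<omega>)\<close>, which leaves
  \<open>z\<^sup>2 / (\<omega>\<^sup>2 * (z - \<omega>))\<close>. For
  \<open>norm \<omega> > 2 * R\<close> the factor \<open>z - \<omega>\<close> has norm at least
  \<open>norm \<omega> / 2\<close>.\<close>

lemma zt_bound:
  assumes R: "R > 0" and z: "norm z \<le> R" and w: "norm \<omega> > 2 * R"
  shows "norm (zt \<omega> z) \<le> 2 * R\<^sup>2 * (1 / norm \<omega> ^ 3)"
proof -
  have ne: "\<omega> \<noteq> 0" "z \<noteq> \<omega>" using assms by auto
  have "norm \<omega> - norm z \<le> norm (z - \<omega>)"
    by (metis norm_minus_commute norm_triangle_ineq2)
  then have le: "norm \<omega> / 2 \<le> norm (z - \<omega>)" using z w by simp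
  have "zt \<omega> z = z\<^sup>2 / (\<omega>\<^sup>2 * (z - \<omega>))"
    using ne by (simp add: zt_def divide_simps) (simp add: algebra_simps power2_eq_square)
  then have "norm (zt \<omega> z) = norm z ^ 2 / (norm \<omega> ^ 2 * norm (z - \<omega>))"
    by (simp add: norm_divide norm_mult norm_power)
  also have "\<dots> \<le> R\<^sup>2 / (norm \<omega> ^ 2 * (norm \<omega> / 2))"
    using le z w R ne by (intro frac_le mult_left_mono power_mono) (auto simp: zero_less_mult_iff)
  also have "\<dots> = 2 * R\<^sup>2 * (1 / norm \<omega> ^ 3)"
    by (simp add: power2_eq_square power3_eq_cube)
  finally show ?thesis .
qed

text \<open>Inside the disc of radius \<open>R\<close> only the finitely many near terms can have
  poles; the far terms converge uniformly.\<close>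

abbreviation "far R \<equiv> {\<omega> \<in> \<Lambda>. norm \<omega> > 2 * R}"
abbreviation "near R \<equiv> {\<omega> \<in> \<Lambda>. norm \<omega> \<le> 2 * R}"

lemma finite_near: "finite (near R)"
  by (rule finite_lattice_ball)

lemma far_summable_cube:
  assumes "R > 0"
  shows "(\<lambda>\<omega>. 2 * R\<^sup>2 * (1 / norm \<omega> ^ 3)) summable_on far R"
proof -
  have "far R \<subseteq> \<Lambda> - {0}" using assms by auto
  then show ?thesis
    by (intro summable_on_cmult_right summable_on_subset_banach[OF lattice_summable_cube])
qed

lemma zt_far_summable:
  assumes "R > 0" "norm z \<le> R"
  shows "(\<lambda>\<omega>. zt \<omega> z) summable_on far R"
proof -
  have "(\<lambda>\<omega>. norm (zt \<omega> z)) summable_on far R"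
    by (rule Infinite_Sum.abs_summable_on_comparison_test'[OF far_summable_cube[OF assms(1)]])
       (use zt_bound[OF assms] in blast)
  then show ?thesis by (rule abs_summable_summable)
qed

text \<open>A uniform limit of holomorphic functions may be differentiated term by term. Convergence
  of the series of derivatives is part of that result, so \<open>pt\<close> needs no estimate of its
  own.\<close>

lemma zt_far_derivative:
  assumes R: "R > 0"
  shows zt_far_has_field_derivative: "norm z < R \<Longrightarrow>
      ((\<lambda>z. \<Sum>\<^sub>\<infinity>\<omega>\<in>far R. zt \<omega> z) has_field_derivative - (\<Sum>\<^sub>\<infinity>\<omega>\<in>far R. pt \<omega> z)) (at z)"
    and pt_far_summable: "norm z < R \<Longrightarrow> (\<lambda>\<omega>. pt \<omega> z) summable_on far R"
proof -
  let ?F = "finite_subsets_at_top (far R)"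
  have ulim: "uniform_limit (cball 0 R) (\<lambda>X z. \<Sum>\<omega>\<in>X. zt \<omega> z) (\<lambda>z. \<Sum>\<^sub>\<infinity>\<omega>\<in>far R. zt \<omega> z) ?F"
    by (rule Weierstrass_m_test_general[OF _ far_summable_cube[OF R]])
       (use zt_bound[OF R] in simp)
  have der: "((\<lambda>z. \<Sum>\<omega>\<in>X. zt \<omega> z) has_field_derivative (\<Sum>\<omega>\<in>X. - pt \<omega> z)) (at z)"
    if "X \<subseteq> far R" "z \<in> cball 0 R" for X z
    by (rule DERIV_sum, rule zt_has_field_derivative) (use that R in auto)
  have "\<forall>\<^sub>F X in ?F. continuous_on (cball 0 R) (\<lambda>z. \<Sum>\<omega>\<in>X. zt \<omega> z) \<and>
      (\<forall>z\<in>ball 0 R. ((\<lambda>z. \<Sum>\<omega>\<in>X. zt \<omega> z) has_field_derivative (\<Sum>\<omega>\<in>X. - pt \<omega> z)) (at z))"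
  proof (rule eventually_finite_subsets_at_top_weakI)
    fix X assume "X \<subseteq> far R"
    then show "continuous_on (cball 0 R) (\<lambda>z. \<Sum>\<omega>\<in>X. zt \<omega> z) \<and>
      (\<forall>z\<in>ball 0 R. ((\<lambda>z. \<Sum>\<omega>\<in>X. zt \<omega> z) has_field_derivative (\<Sum>\<omega>\<in>X. - pt \<omega> z)) (at z))"
      using der by (auto intro!: continuous_at_imp_continuous_on DERIV_isCont)
  qed
  then obtain g' where g': "\<And>w. w \<in> ball 0 R \<Longrightarrow>
      ((\<lambda>z. \<Sum>\<^sub>\<infinity>\<omega>\<in>far R. zt \<omega> z) has_field_derivative g' w) (at w) \<and>
      ((\<lambda>X. \<Sum>\<omega>\<in>X. - pt \<omega> w) \<longlongrightarrow> g' w) ?F"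
    by (rule has_complex_derivative_uniform_limit[OF _ ulim finite_subsets_at_top_neq_bot R]) blast
  show "((\<lambda>z. \<Sum>\<^sub>\<infinity>\<omega>\<in>far R. zt \<omega> z) has_field_derivative - (\<Sum>\<^sub>\<infinity>\<omega>\<in>far R. pt \<omega> z)) (at z)"
       "(\<lambda>\<omega>. pt \<omega> z) summable_on far R" if "norm z < R" for z
  proof -
    have z: "z \<in> ball 0 R" using that by simp
    have "((\<lambda>\<omega>. - pt \<omega> z) has_sum g' z) (far R)"
      using g'[OF z] unfolding has_sum_def by blast
    then have hs: "((\<lambda>\<omega>. pt \<omega> z) has_sum (- g' z)) (far R)"
      by (simp add: has_sum_uminus[symmetric])
    then show "(\<lambda>\<omega>. pt \<omega> z) summable_on far R" by (rule has_sum_imp_summable)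
    have "- (\<Sum>\<^sub>\<infinity>\<omega>\<in>far R. pt \<omega> z) = g' z" using infsumI[OF hs] by simp
    then show "((\<lambda>z. \<Sum>\<^sub>\<infinity>\<omega>\<in>far R. zt \<omega> z) has_field_derivative - (\<Sum>\<^sub>\<infinity>\<omega>\<in>far R. pt \<omega> z)) (at z)"
      using g'[OF z] by simp
  qed
qed

lemma infsum_near_far:
  fixes f :: "complex \<Rightarrow> complex"
  assumes "f summable_on far R"
  shows "f summable_on \<Lambda>" "(\<Sum>\<^sub>\<infinity>\<omega>\<in>\<Lambda>. f \<omega>) = (\<Sum>\<omega>\<in>near R. f \<omega>) + (\<Sum>\<^sub>\<infinity>\<omega>\<in>far R. f \<omega>)"
proof -
  have eq: "\<Lambda> = near R \<union> far R" and disj: "near R \<inter> far R = {}" by auto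
  have s: "f summable_on near R" using finite_near by simp
  show "f summable_on \<Lambda>" by (subst eq, rule summable_on_Un_disjoint[OF s assms disj])
  show "(\<Sum>\<^sub>\<infinity>\<omega>\<in>\<Lambda>. f \<omega>) = (\<Sum>\<omega>\<in>near R. f \<omega>) + (\<Sum>\<^sub>\<infinity>\<omega>\<in>far R. f \<omega>)"
    using infsum_Un_disjoint[OF s assms disj] finite_near by (simp flip: eq)
qed

lemma zt_summable: "(\<lambda>\<omega>. zt \<omega> z) summable_on \<Lambda>"
  by (rule infsum_near_far(1)[of _ "norm z + 1"], rule zt_far_summable) (auto simp: add_nonneg_pos)

lemma pt_summable: "(\<lambda>\<omega>. pt \<omega> z) summable_on \<Lambda>"
  by (rule infsum_near_far(1)[of _ "norm z + 1"], rule pt_far_summable) (auto simp: add_nonneg_pos)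

lemma infsum_lattice_0:
  fixes f :: "complex \<Rightarrow> complex"
  assumes "f summable_on \<Lambda>"
  shows "(\<Sum>\<^sub>\<infinity>\<omega>\<in>\<Lambda>. f \<omega>) = f 0 + (\<Sum>\<^sub>\<infinity>\<omega>\<in>\<Lambda> - {0}. f \<omega>)"
proof -
  have eq: "\<Lambda> = insert 0 (\<Lambda> - {0})" using lattice_0 by blast
  have "f summable_on \<Lambda> - {0}" by (rule summable_on_subset_banach[OF assms]) auto
  then have "infsum f (insert 0 (\<Lambda> - {0})) = f 0 + infsum f (\<Lambda> - {0})"
    by (rule infsum_insert) simp
  then show ?thesis using eq by simp
qed

text \<open>Since \<open>1 / 0 = 0\<close>, the summands at \<open>\<omega> = 0\<close> are the polar parts.\<close>

lemma wzeta_eq: "wzeta \<tau> z = (\<Sum>\<^sub>\<infinity>\<omega>\<in>\<Lambda>. zt \<omega> z)"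
  by (simp add: infsum_lattice_0[OF zt_summable] zt_0) (simp add: wzeta_def zt_def)

lemma wp_eq: "wp \<tau> z = (\<Sum>\<^sub>\<infinity>\<omega>\<in>\<Lambda>. pt \<omega> z)"
  by (simp add: infsum_lattice_0[OF pt_summable] pt_0) (simp add: wp_def pt_def)

lemma wzeta_split:
  assumes "norm z < R"
  shows "wzeta \<tau> z = (\<Sum>\<omega>\<in>near R. zt \<omega> z) + (\<Sum>\<^sub>\<infinity>\<omega>\<in>far R. zt \<omega> z)"
  unfolding wzeta_eq using assms norm_ge_zero[of z]
  by (intro infsum_near_far(2) zt_far_summable) linarith+

lemma wp_split:
  assumes "norm z < R"
  shows "wp \<tau> z = (\<Sum>\<omega>\<in>near R. pt \<omega> z) + (\<Sum>\<^sub>\<infinity>\<omega>\<in>far R. pt \<omega> z)"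
  unfolding wp_eq using assms norm_ge_zero[of z]
  by (intro infsum_near_far(2) pt_far_summable) linarith+

lemma wzeta_has_field_derivative:
  assumes "z \<notin> \<Lambda>"
  shows "(wzeta \<tau> has_field_derivative - wp \<tau> z) (at z)"
proof -
  define R where "R = norm z + 1"
  have R: "R > 0" "norm z < R" by (simp_all add: R_def add_nonneg_pos)
  have "((\<lambda>z. (\<Sum>\<omega>\<in>near R. zt \<omega> z) + (\<Sum>\<^sub>\<infinity>\<omega>\<in>far R. zt \<omega> z)) has_field_derivative
      (\<Sum>\<omega>\<in>near R. - pt \<omega> z) + - (\<Sum>\<^sub>\<infinity>\<omega>\<in>far R. pt \<omega> z)) (at z)"
    by (intro DERIV_add DERIV_sum zt_has_field_derivative zt_far_has_field_derivative R)
       (use assms in auto)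
  also have "(\<Sum>\<omega>\<in>near R. - pt \<omega> z) + - (\<Sum>\<^sub>\<infinity>\<omega>\<in>far R. pt \<omega> z) = - wp \<tau> z"
    by (simp add: wp_split[OF R(2)] sum_negf)
  finally show ?thesis
    by (rule has_field_derivative_transform_within_open[of _ _ _ "ball 0 R"])
       (use R in \<open>auto simp: wzeta_split[of _ R]\<close>)
qed

lemma closed_lattice: "closed \<Lambda>"
proof -
  have "\<exists>T. open T \<and> x \<in> T \<and> T \<subseteq> - \<Lambda>" if "x \<in> - \<Lambda>" for x
  proof (intro exI conjI)
    let ?F = "{\<omega> \<in> \<Lambda>. norm \<omega> \<le> norm x + 1}"
    show "open (ball x 1 - ?F)"
      by (intro open_Diff finite_imp_closed finite_lattice_ball) auto
    show "x \<in> ball x 1 - ?F" using that by simp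
    show "ball x 1 - ?F \<subseteq> - \<Lambda>"
    proof
      fix y assume y: "y \<in> ball x 1 - ?F"
      then have "norm (y - x) \<le> 1" by (simp add: dist_norm norm_minus_commute)
      then have "norm y \<le> norm x + 1" using norm_triangle_ineq2[of y x] by simp
      then show "y \<in> - \<Lambda>" using y by simp
    qed
  qed
  then have "open (- \<Lambda>)" by (subst open_subopen) blast
  then show ?thesis by (simp add: closed_def)
qed

lemma wzeta_holomorphic: "wzeta \<tau> holomorphic_on - \<Lambda>"
  using wzeta_has_field_derivative closed_lattice
  by (subst holomorphic_on_open) (auto simp: closed_def)

lemma wzeta_polar_0:
  obtains h where "h analytic_on {0}" "\<forall>\<^sub>F z in nhds 0. wzeta \<tau> z = 1 / z + h z"
proof -
  define h where "h z = (\<Sum>\<omega>\<in>near 1 - {0}. zt \<omega> z) + (\<Sum>\<^sub>\<infinity>\<omega>\<in>far 1. zt \<omega> z)" for z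
  have "(\<lambda>z. \<Sum>\<^sub>\<infinity>\<omega>\<in>far 1. zt \<omega> z) holomorphic_on ball 0 1"
    by (subst holomorphic_on_open, simp, use zt_far_has_field_derivative[of 1] in fastforce)
  then have "(\<lambda>z. \<Sum>\<^sub>\<infinity>\<omega>\<in>far 1. zt \<omega> z) analytic_on {0}"
    by (rule holomorphic_on_imp_analytic_at) auto
  then have "h analytic_on {0}"
    unfolding h_def zt_def by (intro analytic_intros) auto
  moreover have "wzeta \<tau> z = 1 / z + h z" if "z \<in> ball 0 1" for z
    using that sum.remove[of "near 1" 0 "\<lambda>\<omega>. zt \<omega> z"] finite_near[of 1]
    by (subst wzeta_split[of _ 1]) (auto simp: h_def zt_0 lattice_0)
  then have "\<forall>\<^sub>F z in nhds 0. wzeta \<tau> z = 1 / z + h z"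
    by (intro eventually_nhds_in_open[of "ball 0 1", THEN eventually_mono]) auto
  ultimately show ?thesis by (rule that)
qed

lemma wzeta_minus: "wzeta \<tau> (- z) = - wzeta \<tau> z"
proof -
  have "(\<Sum>\<^sub>\<infinity>\<omega>\<in>\<Lambda>. zt \<omega> (- z)) = (\<Sum>\<^sub>\<infinity>\<omega>\<in>\<Lambda>. - zt \<omega> z)"
    by (rule infsum_reindex_bij_witness[of _ uminus uminus])
       (auto simp: lattice_uminus_iff zt_minus)
  then show ?thesis by (simp add: wzeta_eq infsum_uminus)
qed

lemma wp_minus: "wp \<tau> (- z) = wp \<tau> z"
  unfolding wp_eq
  by (rule infsum_reindex_bij_witness[of _ uminus uminus])
     (auto simp: lattice_uminus_iff pt_minus)

section \<open>Translation of zeta by 1 and of \<open>wp\<close> by \<tau>\<close>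

lemma infsum_lattice_lpt:
  fixes f :: "complex \<Rightarrow> complex"
  shows "(\<Sum>\<^sub>\<infinity>\<omega>\<in>\<Lambda>. f \<omega>) = (\<Sum>\<^sub>\<infinity>p. f (lpt p))"
    and "f summable_on \<Lambda> \<longleftrightarrow> (\<lambda>p. f (lpt p)) summable_on UNIV"
proof -
  have b: "bij_betw lpt UNIV \<Lambda>" by (simp add: bij_betw_def inj_lpt range_lpt)
  show "(\<Sum>\<^sub>\<infinity>\<omega>\<in>\<Lambda>. f \<omega>) = (\<Sum>\<^sub>\<infinity>p. f (lpt p))"
    using infsum_reindex_bij_betw[OF b, of f] by simp
  show "f summable_on \<Lambda> \<longleftrightarrow> (\<lambda>p. f (lpt p)) summable_on UNIV"
    using summable_on_reindex_bij_betw[OF b, of f] by simp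
qed

text \<open>For \<open>m \<noteq> 0\<close> the lower bound for lattice points gives
  \<open>1 + |m| \<le> 2 * C * norm \<omega>\<close>, hence a comparison with inverse squares of
  integers.\<close>

lemma row_summable: "(\<lambda>m::int. 1 / (of_int m + of_int n * \<tau>)\<^sup>2) summable_on UNIV"
proof -
  obtain C where C: "C > 0" "\<And>n m. \<bar>of_int m\<bar> + \<bar>of_int n\<bar> \<le> C * norm (lpt (n, m))"
    using lpt_lower_bound by metis
  let ?f = "\<lambda>m::int. 1 / (of_int m + of_int n * \<tau>)\<^sup>2"
  have "(\<lambda>m::int. 4 * C\<^sup>2 * (1 + \<bar>of_int m\<bar>) powr (-2)) summable_on - {0}"
    by (intro summable_on_cmult_right summable_on_subset_banach[OF summable_on_int_powr]) auto
  then have "(\<lambda>m. norm (?f m)) summable_on - {0}"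
  proof (rule Infinite_Sum.abs_summable_on_comparison_test')
    fix m :: int assume m: "m \<in> - {0}"
    let ?w = "norm (lpt (n, m))"
    have 1: "1 \<le> \<bar>of_int m :: real\<bar>" using m by (simp add: abs_if)
    have w: "\<bar>of_int m\<bar> \<le> C * ?w" using C(2)[of m n] by linarith
    have w0: "?w > 0" using m by (simp add: lpt_eq_0_iff)
    have "(1 + \<bar>of_int m\<bar>)\<^sup>2 \<le> (2 * (C * ?w))\<^sup>2"
      by (intro power_mono) (use 1 w in linarith)+
    then have le: "(1 + \<bar>of_int m\<bar>)\<^sup>2 \<le> 4 * C\<^sup>2 * ?w\<^sup>2" by (simp add: power_mult_distrib)
    have p: "(1 + \<bar>of_int m :: real\<bar>)\<^sup>2 > 0" by (simp add: add_pos_nonneg)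
    have "1 / ?w\<^sup>2 \<le> 4 * C\<^sup>2 * (1 / (1 + \<bar>of_int m\<bar>)\<^sup>2)"
      using le p w0 by (simp add: field_simps)
    moreover have "norm (?f m) = 1 / ?w\<^sup>2" by (simp add: norm_divide norm_power lpt_def)
    ultimately show "norm (?f m) \<le> 4 * C\<^sup>2 * (1 + \<bar>of_int m\<bar>) powr (-2)"
      by (simp add: powr_minus powr_numeral inverse_eq_divide add_pos_nonneg)
  qed
  then have "?f summable_on - {0}" by (rule abs_summable_summable)
  then have "?f summable_on {0} \<union> - {0}" by (intro summable_on_Un_disjoint) auto
  then show ?thesis by (simp add: Compl_partition)
qed

text \<open>Along a row, the change of \<open>zt \<omega>\<close> under
  \<open>z \<mapsto> z + 1\<close> is a telescoping difference plus
  \<open>1 / \<omega>\<^sup>2\<close>. The telescoping parts sum to zero over the row. The whole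
  double sum converges absolutely, and summing it by rows yields \<open>G2\<close> in the order that
  defines it.\<close>

lemma wzeta_plus_1: "wzeta \<tau> (z + 1) = wzeta \<tau> z + G2 \<tau>"
proof -
  let ?d = "\<lambda>\<omega>. zt \<omega> (z + 1) - zt \<omega> z"
  let ?r = "\<lambda>n m::int. 1 / (of_int m + of_int n * \<tau>)\<^sup>2"
  let ?R = "\<lambda>n. \<Sum>\<^sub>\<infinity>m. ?r n m"
  have "?d summable_on \<Lambda>" by (intro summable_on_diff zt_summable)
  then have sp: "(\<lambda>p. ?d (lpt p)) summable_on UNIV \<times> UNIV"
    by (simp add: infsum_lattice_lpt)
  then have sp': "(\<lambda>(n, m). ?d (lpt (n, m))) summable_on UNIV \<times> UNIV"
    by (simp add: case_prod_unfold)
  have inner: "(\<Sum>\<^sub>\<infinity>m. ?d (lpt (n, m))) = ?R n" for n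
  proof -
    define b where "b m = - 1 / (z + 1 - of_int m - of_int n * \<tau>)" for m :: int
    have d: "?d (lpt (n, m)) = (b (m + 1) - b m) + ?r n m" for m
      by (simp add: zt_def lpt_def b_def diff_divide_distrib[symmetric] algebra_simps)
         (simp add: add_divide_distrib algebra_simps)
    have "(\<lambda>m. ?d (lpt (n, m))) summable_on UNIV"
      by (rule summable_on_SigmaD1[OF sp']) auto
    then have "(\<lambda>m. ?d (lpt (n, m)) - ?r n m) summable_on UNIV"
      by (rule summable_on_diff[OF _ row_summable])
    then have s': "(\<lambda>m. b (m + 1) - b m) summable_on UNIV" by (simp add: d)
    have "(\<lambda>k. - (1 / ((z + 1 - of_int n * \<tau>) + of_nat k * (-1)))) \<longlonglongrightarrow> - 0"
      by (intro tendsto_minus inverse_arith_progression_tendsto) simp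
    then have t1: "(\<lambda>k. b (int k)) \<longlonglongrightarrow> 0" by (simp add: b_def algebra_simps)
    have "(\<lambda>k. - (1 / ((z + 1 - of_int n * \<tau>) + of_nat k * 1))) \<longlonglongrightarrow> - 0"
      by (intro tendsto_minus inverse_arith_progression_tendsto) simp
    then have t2: "(\<lambda>k. b (- int k)) \<longlonglongrightarrow> 0" by (simp add: b_def algebra_simps)
    have "(\<Sum>\<^sub>\<infinity>m. ?d (lpt (n, m))) = (\<Sum>\<^sub>\<infinity>m. b (m + 1) - b m) + ?R n"
      unfolding d by (rule infsum_add[OF s' row_summable])
    then show ?thesis by (simp add: infsum_telescope_int[OF s' t1 t2])
  qed
  have "(\<lambda>n. \<Sum>\<^sub>\<infinity>m. ?d (lpt (n, m))) summable_on UNIV"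
    by (rule summable_on_Sigma_banach[OF sp'])
  then have sR: "?R summable_on UNIV" by (simp add: inner)
  have "wzeta \<tau> (z + 1) - wzeta \<tau> z = (\<Sum>\<^sub>\<infinity>\<omega>\<in>\<Lambda>. ?d \<omega>)"
    unfolding wzeta_eq by (rule infsum_diff[OF zt_summable zt_summable, symmetric])
  also have "\<dots> = (\<Sum>\<^sub>\<infinity>p\<in>UNIV \<times> UNIV. ?d (lpt p))" by (simp add: infsum_lattice_lpt)
  also have "\<dots> = (\<Sum>\<^sub>\<infinity>n. \<Sum>\<^sub>\<infinity>m. ?d (lpt (n, m)))" by (rule infsum_Sigma_banach[OF sp, symmetric])
  also have "\<dots> = infsum ?R ({0} \<union> - {0})" by (simp add: inner Compl_partition)
  also have "\<dots> = ?R 0 + infsum ?R (- {0})"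
    by (subst infsum_Un_disjoint) (auto intro: summable_on_subset_banach[OF sR])
  \<comment> \<open>The row of \<open>n = 0\<close> contains \<open>m = 0\<close>, whose term is
    \<open>1 / 0 = 0\<close>; this matches the first sum of \<open>G2\<close>.\<close>
  also have "?R 0 = (\<Sum>\<^sub>\<infinity>m\<in>- {0::int}. 1 / (of_int m)\<^sup>2)"
    by (rule infsum_cong_neutral) auto
  finally show ?thesis by (simp add: G2_def algebra_simps)
qed

text \<open>The terms telescope along columns of fixed \<open>m\<close> without remainder, so here
  the double sum is evaluated with the sum over \<open>n\<close> inside. The period 1 is obtained
  differently, by differentiating that of \<open>P1\<close>.\<close>

lemma wp_plus_tau: "wp \<tau> (z + \<tau>) = wp \<tau> z"
proof -
  let ?d = "\<lambda>\<omega>. pt \<omega> (z + \<tau>) - pt \<omega> z"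
  have "?d summable_on \<Lambda>" by (intro summable_on_diff pt_summable)
  then have sp: "(\<lambda>p. ?d (lpt p)) summable_on UNIV \<times> UNIV"
    by (simp add: infsum_lattice_lpt)
  then have sw: "(\<lambda>(m, n). ?d (lpt (n, m))) summable_on UNIV \<times> UNIV"
    by (subst summable_on_swap) (simp add: case_prod_unfold)
  have inner: "(\<Sum>\<^sub>\<infinity>n. ?d (lpt (n, m))) = 0" for m
  proof -
    define b where "b n = - 1 / (z + \<tau> - of_int m - of_int n * \<tau>)\<^sup>2" for n :: int
    have d: "?d (lpt (n, m)) = b (n + 1) - b n" for n
      by (simp add: pt_def lpt_def b_def algebra_simps)
    have s: "(\<lambda>n. ?d (lpt (n, m))) summable_on UNIV"
      by (rule summable_on_SigmaD1[OF sw]) auto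
    have t: "\<tau> \<noteq> 0" using Im_pos by auto
    have "(\<lambda>k. - ((1 / ((z + \<tau> - of_int m) + of_nat k * (-\<tau>))) ^ 2)) \<longlonglongrightarrow> - (0 ^ 2)"
      by (intro tendsto_minus tendsto_power inverse_arith_progression_tendsto) (use t in auto)
    then have t1: "(\<lambda>k. b (int k)) \<longlonglongrightarrow> 0" by (simp add: b_def algebra_simps power_divide)
    have "(\<lambda>k. - ((1 / ((z + \<tau> - of_int m) + of_nat k * \<tau>)) ^ 2)) \<longlonglongrightarrow> - (0 ^ 2)"
      by (intro tendsto_minus tendsto_power inverse_arith_progression_tendsto) (use t in auto)
    then have t2: "(\<lambda>k. b (- int k)) \<longlonglongrightarrow> 0" by (simp add: b_def algebra_simps power_divide)
    show ?thesis using infsum_telescope_int[OF _ t1 t2] s by (simp add: d)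
  qed
  have "wp \<tau> (z + \<tau>) - wp \<tau> z = (\<Sum>\<^sub>\<infinity>\<omega>\<in>\<Lambda>. ?d \<omega>)"
    unfolding wp_eq by (rule infsum_diff[OF pt_summable pt_summable, symmetric])
  also have "\<dots> = (\<Sum>\<^sub>\<infinity>p\<in>UNIV \<times> UNIV. ?d (lpt p))" by (simp add: infsum_lattice_lpt)
  also have "\<dots> = (\<Sum>\<^sub>\<infinity>n. \<Sum>\<^sub>\<infinity>m. ?d (lpt (n, m)))" by (rule infsum_Sigma_banach[OF sp, symmetric])
  also have "\<dots> = (\<Sum>\<^sub>\<infinity>m. \<Sum>\<^sub>\<infinity>n. ?d (lpt (n, m)))"
    by (rule infsum_swap_banach) (use sp in \<open>simp add: case_prod_unfold\<close>)
  finally show ?thesis by (simp add: inner)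
qed

end

subsection \<open>Residues of periodic functions\<close>

text \<open>Periodicity is assumed off \<open>X\<close> only: the values of a meromorphic function
  at its poles are arbitrary and need not repeat.\<close>

lemma periodic_of_int:
  assumes per: "\<And>x::'a::ring_1. x \<notin> X \<Longrightarrow> h (x + 1) = h x" and X: "\<And>x. x + 1 \<in> X \<longleftrightarrow> x \<in> X"
    and x: "x \<notin> X"
  shows "h (x + of_int k) = h x \<and> x + of_int k \<notin> X"
proof (induction k rule: int_induct[of _ 0])
  case base
  then show ?case using x by simp
next
  case (step1 k)
  have "x + of_int (k + 1) = (x + of_int k) + 1" by (simp add: add.assoc)
  then show ?case using step1 per[of "x + of_int k"] X[of "x + of_int k"] by metis
next
  case (step2 k)
  have "x + of_int k = (x + of_int (k - 1)) + 1" by simp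
  then show ?case using step2 per[of "x + of_int (k - 1)"] X[of "x + of_int (k - 1)"] by metis
qed

lemma periodic_integral_shift:
  fixes h :: "real \<Rightarrow> complex"
  assumes cont: "continuous_on UNIV h" and per: "\<And>x. h (x + 1) = h x"
  shows "integral {s..s+1} h = integral {0..1} h"
proof -
  have int: "h integrable_on {a..b}" for a b
    by (rule integrable_continuous_real[OF continuous_on_subset[OF cont]]) auto
  have base: "integral {r..r+1} h = integral {0..1} h" if "0 \<le> r" "r \<le> 1" for r
  proof -
    have "integral {r..r+1} h = integral {r..1} h + integral {1..r+1} h"
      by (rule Henstock_Kurzweil_Integration.integral_combine[symmetric]) (use that int in auto)
    also have "integral {1..r+1} h = integral {0..r} h"
      using integral_shift_real_ivl[of 1 1 "r + 1" h] by (simp add: per)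
    also have "integral {r..1} h + integral {0..r} h = integral {0..1} h"
      using that int Henstock_Kurzweil_Integration.integral_combine[of 0 r 1 h] by (simp add: add.commute)
    finally show ?thesis .
  qed
  define k where "k = \<lfloor>s\<rfloor>"
  have hk: "h (x + of_int k) = h x" for x
    using periodic_of_int[of "{}" h x k] per by simp
  have "integral {s..s+1} h = integral {s - of_int k..s - of_int k + 1} (\<lambda>x. h (x + of_int k))"
    using integral_shift_real_ivl[of s "of_int k" "s + 1" h] by (simp add: algebra_simps)
  also have "\<dots> = integral {s - of_int k..s - of_int k + 1} h" by (simp add: hk)
  also have "\<dots> = integral {0..1} h"
    by (rule base) (unfold k_def, linarith+)
  finally show ?thesis .
qed

lemma contour_integral_unit_segment:
  "contour_integral (linepath a (a + 1)) F = integral {0..1} (\<lambda>x. F (a + of_real x))"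
proof -
  have "linepath a (a + 1) x = a + of_real x" for x
    by (simp add: linepath_def scaleR_conv_of_real algebra_simps)
  then show ?thesis
    by (simp add: contour_integral_integral)
qed

lemma contour_integral_unit_segment_shift:
  assumes cont: "continuous_on {z. Im z = Im a} F"
    and per: "\<And>z. Im z = Im a \<Longrightarrow> F (z + 1) = F z"
  shows "contour_integral (linepath (a + of_real s) (a + of_real s + 1)) F =
         contour_integral (linepath a (a + 1)) F"
proof -
  define h where "h x = F (a + of_real x)" for x :: real
  have "continuous_on UNIV h"
    unfolding h_def by (intro continuous_on_compose2[OF cont] continuous_intros) auto
  moreover have "h (x + 1) = h x" for x
    using per[of "a + of_real x"] by (simp add: h_def add.assoc)
  ultimately have *: "integral {s..s+1} h = integral {0..1} h" by (rule periodic_integral_shift)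
  have "integral {0..1} (\<lambda>x. h (x + s)) = integral {s..s+1} h"
    using integral_shift_real_ivl[of s s "s + 1" h] by simp
  with * show ?thesis
    unfolding contour_integral_unit_segment h_def by (simp add: add_ac)
qed

text \<open>The residue theorem on a cylinder: \<open>P\<close> contains one representative modulo \<open>\<int>\<close> of each
  singularity in the strip.\<close>

lemma strip_residues:
  fixes F :: "complex \<Rightarrow> complex" and P :: "complex set"
  defines "S \<equiv> {p + of_int n | p n. p \<in> P}"
  assumes fin: "finite P"
    and holo: "F holomorphic_on {z. c' < Im z \<and> Im z < d'} - S"
    and per: "\<And>z. c' < Im z \<Longrightarrow> Im z < d' \<Longrightarrow> z \<notin> S \<Longrightarrow> F (z + 1) = F z"
    and cd: "c' < c" "c < d" "d < d'"
    and P: "\<And>p. p \<in> P \<Longrightarrow> c < Im p \<and> Im p < d"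
    and inj: "\<And>p q n. p \<in> P \<Longrightarrow> q \<in> P \<Longrightarrow> p - q = of_int n \<Longrightarrow> p = q"
  shows "contour_integral (linepath (\<i> * of_real c) (\<i> * of_real c + 1)) F -
         contour_integral (linepath (\<i> * of_real d) (\<i> * of_real d + 1)) F =
         2 * of_real pi * \<i> * (\<Sum>p\<in>P. residue F p)"
proof -
  have S_shift: "z + 1 \<in> S \<longleftrightarrow> z \<in> S" for z
  proof
    assume "z + 1 \<in> S"
    then obtain p n where "p \<in> P" "z + 1 = p + of_int n" unfolding S_def by blast
    then have "p \<in> P" "z = p + of_int (n - 1)" by (auto simp: algebra_simps)
    then show "z \<in> S" unfolding S_def by blast
  next
    assume "z \<in> S"
    then obtain p n where "p \<in> P" "z = p + of_int n" unfolding S_def by blast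
    then have "p \<in> P" "z + 1 = p + of_int (n + 1)" by auto
    then show "z + 1 \<in> S" unfolding S_def by blast
  qed
  \<comment> \<open>The real parts of all singularities form a countable set, so some vertical line,
    together with its integer translates, avoids them.\<close>
  have "countable ((\<lambda>(p, n). Re p + of_int n) ` (P \<times> (UNIV :: int set)))"
    using fin by (intro countable_image countable_SIGMA) (auto intro: countable_finite)
  then obtain x0 where x0: "x0 \<notin> (\<lambda>(p, n). Re p + of_int n) ` (P \<times> (UNIV :: int set))"
    by (metis UNIV_I countable_subset subsetI uncountable_UNIV_real)
  \<comment> \<open>\<open>nn p\<close> moves \<open>p\<close> by an integer into the open strip
    between the lines at \<open>x0\<close> and \<open>x0 + 1\<close>.\<close>
  define nn where "nn p = - \<lfloor>Re p - x0\<rfloor>" for p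
  define sh where "sh p = p + of_int (nn p)" for p :: complex
  define P' where "P' = sh ` P"
  have sh_Re: "x0 < Re (sh p)" "Re (sh p) < x0 + 1" if "p \<in> P" for p
  proof -
    have "x0 \<noteq> Re p + of_int (nn p)" using x0 that by force
    moreover have "Re p + of_int (nn p) \<ge> x0" "Re p + of_int (nn p) < x0 + 1"
      unfolding nn_def by (simp_all, linarith+)
    ultimately show "x0 < Re (sh p)" "Re (sh p) < x0 + 1" by (auto simp: sh_def)
  qed
  have sh_Im: "Im (sh p) = Im p" for p by (simp add: sh_def)
  have finP': "finite P'" using fin by (simp add: P'_def)
  \<comment> \<open>\<open>\<delta>\<close> is so small that widening the rectangle by
    \<open>\<delta>\<close> on both sides admits no further translate of a singularity; this
    provides the open set for the residue theorem.\<close>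
  have "\<forall>\<^sub>F \<delta> in at_right (0::real). \<forall>p\<in>P'. x0 + \<delta> < Re p \<and> Re p < x0 + 1 - \<delta>"
  proof (intro eventually_ball_finite[OF finP'] ballI)
    fix p assume "p \<in> P'"
    then have *: "0 < Re p - x0" "0 < x0 + 1 - Re p" using sh_Re by (auto simp: P'_def)
    show "\<forall>\<^sub>F \<delta> in at_right 0. x0 + \<delta> < Re p \<and> Re p < x0 + 1 - \<delta>"
      using eventually_at_right_less[of "0::real"]
        order_tendstoD(2)[OF tendsto_ident_at *(1)] order_tendstoD(2)[OF tendsto_ident_at *(2)]
      by eventually_elim auto
  qed
  then have "\<forall>\<^sub>F \<delta> in at_right (0::real). \<delta> > 0 \<and> (\<forall>p\<in>P'. x0 + \<delta> < Re p \<and> Re p < x0 + 1 - \<delta>)"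
    using eventually_at_right_less[of "0::real"] by eventually_elim auto
  from eventually_happens'[OF trivial_limit_at_right_real this]
  obtain \<delta> :: real where \<delta>: "\<delta> > 0" "\<And>p. p \<in> P' \<Longrightarrow> x0 + \<delta> < Re p \<and> Re p < x0 + 1 - \<delta>"
    by blast
  define U where "U = box (Complex (x0 - \<delta>) c') (Complex (x0 + 1 + \<delta>) d')"
  have inU: "z \<in> U \<longleftrightarrow> x0 - \<delta> < Re z \<and> Re z < x0 + 1 + \<delta> \<and> c' < Im z \<and> Im z < d'" for z
    by (auto simp: U_def in_box_complex_iff)
  have US: "U \<inter> S = P'"
  proof
    show "U \<inter> S \<subseteq> P'"
    proof
      fix z assume z: "z \<in> U \<inter> S"
      then obtain p n where p: "p \<in> P" "z = p + of_int n" by (auto simp: S_def)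
      define k where "k = n - nn p"
      have zk: "z = sh p + of_int k" by (simp add: k_def sh_def p)
      have "sh p \<in> P'" using p by (simp add: P'_def)
      from \<delta>(2)[OF this] have b: "x0 + \<delta> < Re (sh p)" "Re (sh p) < x0 + 1 - \<delta>" by auto
      have "x0 - \<delta> < Re (sh p) + of_int k" "Re (sh p) + of_int k < x0 + 1 + \<delta>"
        using z inU[of z] by (auto simp: zk)
      with b have "of_int k < (1 :: real)" "of_int k > (-1 :: real)" by linarith+
      then have "k = 0" by linarith
      then show "z \<in> P'" using zk p by (simp add: P'_def)
    qed
    show "P' \<subseteq> U \<inter> S"
    proof
      fix z assume z: "z \<in> P'"
      then obtain p where p: "p \<in> P" "z = sh p" by (auto simp: P'_def)
      then have "z \<in> S" unfolding sh_def S_def by blast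
      moreover have "z \<in> U" using \<delta>(2)[OF z] \<delta>(1) P[OF p(1)] cd sh_Im[of p] p by (auto simp: inU)
      ultimately show "z \<in> U \<inter> S" by simp
    qed
  qed
  have holU: "F holomorphic_on U - P'"
    by (rule holomorphic_on_subset[OF holo]) (use US inU in auto)
  have opU: "open U" unfolding U_def by (rule open_box)
  define a1 a2 a3 a4 where "a1 = Complex x0 c" "a2 = Complex (x0 + 1) c"
    "a3 = Complex (x0 + 1) d" "a4 = Complex x0 d"
  note a_defs = this
  have rect: "rectpath a1 a3 = linepath a1 a2 +++ linepath a2 a3 +++ linepath a3 a4 +++ linepath a4 a1"
    by (simp add: rectpath_def Let_def a_defs)
  have box: "z \<in> box a1 a3" if "z \<in> P'" for z
    using that P sh_Im sh_Re by (auto simp: P'_def in_box_complex_iff a_defs)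
  have cbox: "cbox a1 a3 \<subseteq> U"
    using cd \<delta>(1) by (auto simp: inU in_cbox_complex_iff a_defs)
  have path: "path_image (rectpath a1 a3) = cbox a1 a3 - box a1 a3"
    by (rule path_image_rectpath_cbox_minus_box) (use cd in \<open>simp_all add: a_defs\<close>)
  have pi_sub: "path_image (rectpath a1 a3) \<subseteq> U - P'" using path cbox box by blast
  have "contour_integral (rectpath a1 a3) F =
      2 * pi * \<i> * (\<Sum>p\<in>P'. winding_number (rectpath a1 a3) p * residue F p)"
  proof (rule Residue_theorem[OF opU _ finP' holU _ _ pi_sub])
    show "connected U" unfolding U_def by (rule convex_connected) (rule convex_box)
    show "\<forall>z. z \<notin> U \<longrightarrow> winding_number (rectpath a1 a3) z = 0"
      using cbox cd by (auto intro!: winding_number_rectpath_outside simp: a_defs)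
  qed auto
  also have "(\<Sum>p\<in>P'. winding_number (rectpath a1 a3) p * residue F p) = (\<Sum>p\<in>P'. residue F p)"
    by (intro sum.cong refl) (simp add: winding_number_rectpath box)
  also have "\<dots> = (\<Sum>p\<in>P. residue F (sh p))"
    unfolding P'_def
  proof (subst sum.reindex)
    show "inj_on sh P"
    proof (rule inj_onI)
      fix p q assume pq: "p \<in> P" "q \<in> P" "sh p = sh q"
      then have "p - q = of_int (nn q - nn p)" by (simp add: sh_def algebra_simps)
      then show "p = q" using inj pq by blast
    qed
  qed simp
  \<comment> \<open>An integer translation preserves the residue, since \<open>F\<close> is periodic
    on a punctured neighbourhood.\<close>
  also have "\<dots> = (\<Sum>p\<in>P. residue F p)"
  proof (intro sum.cong refl)
    fix p assume p: "p \<in> P"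
    then have "sh p \<in> U" "sh p \<in> P'" using US by (auto simp: P'_def)
    have "open (U - (P' - {sh p}))" using opU finP' by (intro open_Diff finite_imp_closed) auto
    then have "\<forall>\<^sub>F z in at (sh p). z \<in> (U - (P' - {sh p})) - {sh p}"
      by (rule eventually_at_in_open) (use \<open>sh p \<in> U\<close> in auto)
    then have "\<forall>\<^sub>F z in at (sh p). z \<notin> S"
      by eventually_elim (use US in blast)
    then have ev: "\<forall>\<^sub>F x in at 0. sh p + x \<notin> S"
      by (subst (asm) at_to_0) (simp add: eventually_filtermap add.commute)
    have "\<forall>\<^sub>F z in at (sh p). z \<in> U - {sh p}"
      by (rule eventually_at_in_open[OF opU \<open>sh p \<in> U\<close>])
    then have "\<forall>\<^sub>F z in at (sh p). z \<in> U" by eventually_elim simp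
    then have evU: "\<forall>\<^sub>F x in at 0. sh p + x \<in> U"
      by (subst (asm) at_to_0) (simp add: eventually_filtermap add.commute)
    have "\<forall>\<^sub>F x in at 0. F (sh p + x) = F (p + x)"
      using ev evU
    proof eventually_elim
      case (elim x)
      have "F (sh p + x + of_int (- nn p)) = F (sh p + x)"
        using periodic_of_int[of "S \<union> {z. \<not> (c' < Im z \<and> Im z < d')}" F "sh p + x" "- nn p"]
          per S_shift elim inU by auto
      then show ?case by (simp add: sh_def algebra_simps)
    qed
    then have "residue (\<lambda>x. F (sh p + x)) 0 = residue (\<lambda>x. F (p + x)) 0"
      by (rule residue_cong) simp
    then show "residue F (sh p) = residue F p"
      by (simp add: residue_shift_0[of F p] residue_shift_0[of F "sh p"])
  qed
  finally have main: "contour_integral (rectpath a1 a3) F = 2 * pi * \<i> * (\<Sum>p\<in>P. residue F p)" .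
  have contF: "continuous_on (U - P') F" by (rule holomorphic_on_imp_continuous_on[OF holU])
  have "path_image (linepath a1 a2) \<union> path_image (linepath a2 a3) \<union> path_image (linepath a3 a4) \<union>
      path_image (linepath a4 a1) \<subseteq> U - P'"
    using pi_sub unfolding rect by (simp add: path_image_join)
  then have ci: "F contour_integrable_on linepath a1 a2" "F contour_integrable_on linepath a2 a3"
    "F contour_integrable_on linepath a3 a4" "F contour_integrable_on linepath a4 a1"
    by (auto intro!: contour_integrable_continuous_linepath continuous_on_subset[OF contF])
  have "contour_integral (rectpath a1 a3) F = contour_integral (linepath a1 a2) F +
      (contour_integral (linepath a2 a3) F + (contour_integral (linepath a3 a4) F +
       contour_integral (linepath a4 a1) F))"
    unfolding rect using ci by (simp add: contour_integral_join)
  also have "contour_integral (linepath a4 a1) F = - contour_integral (linepath a1 a4) F"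
    using contour_integral_reverse_linepath[of a1 a4 F]
      continuous_on_subset[OF contF, of "closed_segment a1 a4"] pi_sub
    unfolding rect by (simp add: path_image_join closed_segment_commute)
  also have "contour_integral (linepath a3 a4) F = - contour_integral (linepath a4 a3) F"
    using contour_integral_reverse_linepath[of a4 a3 F]
      continuous_on_subset[OF contF, of "closed_segment a4 a3"] pi_sub
    unfolding rect by (simp add: path_image_join closed_segment_commute)
  \<comment> \<open>The vertical sides differ by the period 1 and are traversed in opposite
    directions, so they cancel.\<close>
  also have "contour_integral (linepath a2 a3) F = contour_integral (linepath a1 a4) F"
  proof -
    have "F (linepath a2 a3 x) = F (linepath a1 a4 x)" if "x \<in> {0..1}" for x
    proof -
      have "linepath a1 a4 x \<in> path_image (linepath a4 a1)"
        using that by (auto simp: path_image_linepath closed_segment_commute linepath_in_path)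
      then have "linepath a1 a4 x \<in> U - P'" using pi_sub unfolding rect by (auto simp: path_image_join)
      then have "linepath a1 a4 x \<notin> S" using US by blast
      moreover have "linepath a2 a3 x = linepath a1 a4 x + 1"
        by (simp add: linepath_def a_defs complex_eq_iff algebra_simps)
      moreover have "c' < Im (linepath a1 a4 x)" "Im (linepath a1 a4 x) < d'"
        using \<open>linepath a1 a4 x \<in> U - P'\<close> inU by auto
      ultimately show ?thesis by (simp add: per)
    qed
    moreover have "a3 - a2 = a4 - a1" by (simp add: a_defs complex_eq_iff)
    ultimately show ?thesis
      unfolding contour_integral_integral by (intro integral_cong) simp
  qed
  finally have sides: "contour_integral (rectpath a1 a3) F =
      contour_integral (linepath a1 a2) F - contour_integral (linepath a4 a3) F" by simp
  \<comment> \<open>The horizontal sides run over a full period, so their starting points can be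
    moved from \<open>x0\<close> to the imaginary axis.\<close>
  have line: "contour_integral (linepath (Complex x0 y) (Complex (x0 + 1) y)) F =
      contour_integral (linepath (\<i> * of_real y) (\<i> * of_real y + 1)) F"
    if y: "c' < y" "y < d'" "\<And>p. p \<in> P \<Longrightarrow> Im p \<noteq> y" for y
  proof -
    have S: "z \<notin> S" if "Im z = y" for z
    proof
      assume "z \<in> S"
      then obtain p n where "p \<in> P" "z = p + of_int n" by (auto simp: S_def)
      then show False using y(3)[of p] that by simp
    qed
    have "continuous_on {z. Im z = y} F"
      by (rule holomorphic_on_imp_continuous_on[OF holomorphic_on_subset[OF holo]]) (use S y in auto)
    then have "contour_integral (linepath (\<i> * of_real y + of_real x0) (\<i> * of_real y + of_real x0 + 1)) F =
        contour_integral (linepath (\<i> * of_real y) (\<i> * of_real y + 1)) F"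
      by (intro contour_integral_unit_segment_shift) (use y in \<open>auto intro!: per S\<close>)
    moreover have "Complex x0 y = \<i> * of_real y + of_real x0"
      "Complex (x0 + 1) y = \<i> * of_real y + of_real x0 + 1" by (simp_all add: complex_eq_iff)
    ultimately show ?thesis by simp
  qed
  have "p \<in> P \<Longrightarrow> Im p \<noteq> c" "p \<in> P \<Longrightarrow> Im p \<noteq> d" for p using P[of p] by auto
  then show ?thesis
    using sides main line[of c] line[of d] cd unfolding a_defs by simp
qed

subsection \<open>Periods and poles of P1 and P2\<close>

lemma analytic_factor:
  fixes f :: "complex \<Rightarrow> complex"
  assumes "f analytic_on {a}" "f a = 0"
  obtains k where "k analytic_on {a}" "k a = deriv f a" "\<forall>\<^sub>F z in nhds a. f z = (z - a) * k z"
proof -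
  obtain r where r: "r > 0" "f holomorphic_on ball a r"
    using assms(1) by (auto simp: analytic_at_ball)
  define k where "k z = (if z = a then deriv f a else (f z - f a) / (z - a))" for z
  have "k holomorphic_on ball a r" unfolding k_def by (rule pole_lemma_open[OF r(2)]) simp
  then have "k analytic_on {a}" using r(1) by (intro holomorphic_on_imp_analytic_at[of _ "ball a r"]) auto
  moreover have "f z = (z - a) * k z" for z using assms(2) by (simp add: k_def)
  ultimately show ?thesis by (intro that[of k]) (simp_all add: k_def)
qed

text \<open>Allows polar expansions, which hold only off the pole, to be differentiated.\<close>

lemma at_eq_imp_deriv_eq:
  assumes "\<forall>\<^sub>F z in at a. f z = g z"
  shows "\<forall>\<^sub>F z in at a. deriv f z = deriv g z"
proof -
  obtain S where S: "open S" "a \<in> S" "\<And>z. z \<in> S \<Longrightarrow> z \<noteq> a \<Longrightarrow> f z = g z"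
    using assms unfolding eventually_at_topological by blast
  have "\<forall>\<^sub>F z in at a. z \<in> S - {a}" by (rule eventually_at_in_open[OF S(1,2)])
  then show ?thesis
  proof eventually_elim
    case (elim z)
    have "open (S - {a})" using S(1) by (rule open_delete)
    then have "\<forall>\<^sub>F w in nhds z. w \<in> S - {a}" using elim by (rule eventually_nhds_in_open)
    then have "\<forall>\<^sub>F w in nhds z. f w = g w" by eventually_elim (use S(3) in auto)
    then show ?case by (rule deriv_cong_ev) simp
  qed
qed

lemma analytic_on_shift:
  assumes "f analytic_on {z + c}"
  shows "(\<lambda>w. f (w + c)) analytic_on {z}"
proof -
  have "(\<lambda>w. w + c) analytic_on {z}" by (intro analytic_intros)
  then show ?thesis
    using analytic_on_compose_gen[of "\<lambda>w. w + c" "{z}" f "{z + c}"] assms by (simp add: o_def)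
qed

context upper_half
begin

text \<open>The points fixed by \<open>z \<mapsto> - z\<close> modulo the lattice, that is, the
  translates of the ramification points.\<close>

definition half_lattice :: "complex set" ("H") where
  "H = {z. 2 * z \<in> \<Lambda>}"

lemma half_lattice_minus_iff [simp]: "- z \<in> H \<longleftrightarrow> z \<in> H"
  by (simp add: half_lattice_def lattice_uminus_iff)

lemma lattice_double: "z \<in> \<Lambda> \<Longrightarrow> 2 * z \<in> \<Lambda>"
  using lattice_add[of z \<tau> z] by simp

lemma lattice_imp_half_lattice: "z \<in> \<Lambda> \<Longrightarrow> z \<in> H"
  by (simp add: half_lattice_def lattice_double)

lemma half_lattice_add_iff [simp]: "w \<in> H \<Longrightarrow> z + w \<in> H \<longleftrightarrow> z \<in> H"
  by (simp add: half_lattice_def distrib_left lattice_add_iff)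

lemma half_lattice_diff_iff [simp]: "w \<in> H \<Longrightarrow> z - w \<in> H \<longleftrightarrow> z \<in> H"
  using half_lattice_add_iff[of "- w" z] by simp

lemma half_lattice_diff_iff' [simp]: "w \<in> H \<Longrightarrow> w - z \<in> H \<longleftrightarrow> z \<in> H"
  using half_lattice_add_iff[of w "- z"] by (simp add: add.commute)

lemma closed_half_lattice: "closed H"
proof -
  have "H = (\<lambda>z. 2 * z) -` \<Lambda>" by (auto simp: half_lattice_def)
  moreover have "closed ((\<lambda>z::complex. 2 * z) -` \<Lambda>)"
    by (intro closed_vimage closed_lattice continuous_intros)
  ultimately show ?thesis by simp
qed

lemma open_Compl_lattice: "open (- \<Lambda>)" and open_Compl_half_lattice: "open (- H)"
  using closed_lattice closed_half_lattice by (simp_all add: open_Compl)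

lemma eventually_not_lattice: "\<forall>\<^sub>F z in at a. z \<notin> \<Lambda>"
proof -
  let ?F = "{\<omega> \<in> \<Lambda>. norm \<omega> \<le> norm a + 1} - {a}"
  have "open (ball a 1 - ?F)"
    using finite_lattice_ball[of "norm a + 1"] by (intro open_Diff finite_imp_closed) auto
  then have "\<forall>\<^sub>F z in at a. z \<in> (ball a 1 - ?F) - {a}"
    by (rule eventually_at_in_open) simp
  then show ?thesis
  proof eventually_elim
    case (elim z)
    then have "norm (z - a) \<le> 1" by (simp add: dist_norm norm_minus_commute)
    then have "norm z \<le> norm a + 1" using norm_triangle_ineq2[of z a] by simp
    then show ?case using elim by auto
  qed
qed

lemma eventually_not_half_lattice: "\<forall>\<^sub>F z in at a. z \<notin> H"
proof -
  have "filterlim (\<lambda>z. 2 * z) (at (2 * a)) (at a)"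
    by (intro filterlim_atI tendsto_intros) (auto simp: eventually_at_filter)
  from eventually_compose_filterlim[OF eventually_not_lattice this] show ?thesis
    by (simp add: half_lattice_def)
qed

lemma connected_Compl_lattice: "connected (- \<Lambda>)"
proof -
  have "countable \<Lambda>" unfolding range_lpt[symmetric] by simp
  then have "connected (UNIV - \<Lambda>)"
    by (intro connected_open_diff_countable convex_connected) auto
  then show ?thesis by (simp add: Compl_eq_Diff_UNIV)
qed

section \<open>Derivatives, parity and translations of \<open>P1\<close>, \<open>P2\<close> and
  \<open>wp'\<close>\<close>

lemma P1_has_field_derivative:
  assumes "z \<notin> \<Lambda>"
  shows "(P1 \<tau> has_field_derivative P2 \<tau> z) (at z)"
  unfolding P1_def[abs_def] P2_def
  by (auto intro!: derivative_eq_intros wzeta_has_field_derivative assms)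

lemma wp_holomorphic: "wp \<tau> holomorphic_on - \<Lambda>"
proof -
  have "(\<lambda>z. - deriv (wzeta \<tau>) z) holomorphic_on - \<Lambda>"
    by (intro holomorphic_intros wzeta_holomorphic open_Compl_lattice)
  then show ?thesis
    by (rule holomorphic_transform)
       (auto simp: DERIV_imp_deriv[OF wzeta_has_field_derivative])
qed

lemma P2_holomorphic: "P2 \<tau> holomorphic_on - \<Lambda>"
  unfolding P2_def[abs_def] by (intro holomorphic_intros wp_holomorphic)

lemma P1_holomorphic: "P1 \<tau> holomorphic_on - \<Lambda>"
  unfolding P1_def[abs_def] by (intro holomorphic_intros wzeta_holomorphic)

lemma wp'_holomorphic: "wp' \<tau> holomorphic_on - \<Lambda>"
  by (intro holomorphic_deriv wp_holomorphic open_Compl_lattice)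

lemma analytic_at_Compl_lattice:
  assumes "z \<notin> \<Lambda>"
  shows P1_analytic: "P1 \<tau> analytic_on {z}" and P2_analytic: "P2 \<tau> analytic_on {z}"
    and wp'_analytic: "wp' \<tau> analytic_on {z}"
  using assms P1_holomorphic P2_holomorphic wp'_holomorphic open_Compl_lattice
  by (auto intro!: holomorphic_on_imp_analytic_at)

lemma P2_has_field_derivative:
  assumes "z \<notin> \<Lambda>"
  shows "(P2 \<tau> has_field_derivative wp' \<tau> z) (at z)"
  unfolding P2_def[abs_def]
  using holomorphic_derivI[OF wp_holomorphic open_Compl_lattice, of z] assms
  by (auto intro!: derivative_eq_intros)

lemma P1_minus: "P1 \<tau> (- z) = - P1 \<tau> z"
  by (simp add: P1_def wzeta_minus)

lemma P2_minus: "P2 \<tau> (- z) = P2 \<tau> z"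
  by (simp add: P2_def wp_minus)

lemma P1_plus_1: "P1 \<tau> (z + 1) = P1 \<tau> z"
  unfolding P1_def wzeta_plus_1 by (simp add: algebra_simps)

lemma DERIV_shift_lattice:
  assumes "\<And>z. z \<notin> \<Lambda> \<Longrightarrow> (f has_field_derivative f' z) (at z)" "\<omega> \<in> \<Lambda>" "z \<notin> \<Lambda>"
  shows "((\<lambda>z. f (z + \<omega>)) has_field_derivative f' (z + \<omega>)) (at z)"
  using assms(1)[of "z + \<omega>"] assms(2,3) by (simp add: DERIV_shift lattice_add_iff)

lemma periodic_lattice:
  assumes 1: "\<And>z. z \<notin> X \<Longrightarrow> f (z + 1) = f z" and t: "\<And>z. z \<notin> X \<Longrightarrow> f (z + \<tau>) = f z"
    and X: "\<And>z \<omega>. \<omega> \<in> \<Lambda> \<Longrightarrow> z + \<omega> \<in> X \<longleftrightarrow> z \<in> X" and "\<omega> \<in> \<Lambda>" "z \<notin> X"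
  shows "f (z + \<omega>) = f z"
proof -
  obtain m n where w: "\<omega> = of_int m + of_int n * \<tau>" using assms(4) by (rule latticeE)
  have a: "f (z + of_int k) = f z" if "z \<notin> X" for z k
    using periodic_of_int[of X f z k] 1 X[OF lattice_1] that by blast
  have "f (z + of_int k * \<tau>) = f z" if z: "z \<notin> X" for z k
  proof -
    have "\<tau> \<noteq> 0" using Im_pos by auto
    \<comment> \<open>Rescaling by \<tau> turns the translation by \<tau> into a translation by
      1.\<close>
    then have "(\<lambda>x. f (x * \<tau>)) (z / \<tau> + of_int k) = (\<lambda>x. f (x * \<tau>)) (z / \<tau>)"
      using periodic_of_int[of "(\<lambda>x. x * \<tau>) -` X" "\<lambda>x. f (x * \<tau>)" "z / \<tau>" k] t X[OF lattice_tau] z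
      by (simp add: distrib_right)
    then show ?thesis using \<open>\<tau> \<noteq> 0\<close> by (simp add: distrib_right)
  qed
  from this[of "z + of_int m" n] a[of z m] show ?thesis
    using assms(5) X[OF lattice_of_int, of z m] by (simp add: w add.assoc)
qed

lemma P2_plus_1:
  assumes "z \<notin> \<Lambda>"
  shows "P2 \<tau> (z + 1) = P2 \<tau> z"
proof (rule DERIV_unique[OF _ P1_has_field_derivative[OF assms]])
  show "(P1 \<tau> has_field_derivative P2 \<tau> (z + 1)) (at z)"
    using DERIV_shift_lattice[OF P1_has_field_derivative lattice_1 assms] by (simp add: P1_plus_1)
qed

lemma P2_plus_lattice:
  assumes "z \<notin> \<Lambda>" "\<omega> \<in> \<Lambda>"
  shows "P2 \<tau> (z + \<omega>) = P2 \<tau> z"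
  by (rule periodic_lattice[where X = \<Lambda>])
     (use assms in \<open>auto simp: P2_plus_1 lattice_add_iff, simp add: P2_def wp_plus_tau\<close>)

lemma wp'_plus_lattice:
  assumes "z \<notin> \<Lambda>" "\<omega> \<in> \<Lambda>"
  shows "wp' \<tau> (z + \<omega>) = wp' \<tau> z"
proof -
  have "((\<lambda>z. P2 \<tau> (z + \<omega>)) has_field_derivative wp' \<tau> (z + \<omega>)) (at z)"
    by (rule DERIV_shift_lattice[OF P2_has_field_derivative assms(2,1)])
  then have "(P2 \<tau> has_field_derivative wp' \<tau> (z + \<omega>)) (at z)"
    by (rule has_field_derivative_transform_within_open[OF _ open_Compl_lattice])
       (use assms in \<open>auto simp: P2_plus_lattice\<close>)
  then show ?thesis using P2_has_field_derivative[OF assms(1)] by (rule DERIV_unique)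
qed

lemma wp'_minus:
  assumes "z \<notin> \<Lambda>"
  shows "wp' \<tau> (- z) = - wp' \<tau> z"
proof -
  have "((\<lambda>z. P2 \<tau> (- z)) has_field_derivative wp' \<tau> (- z) * - 1) (at z)"
    by (rule DERIV_chain2[OF P2_has_field_derivative])
       (use assms in \<open>auto simp: lattice_uminus_iff intro!: derivative_eq_intros\<close>)
  then have "(P2 \<tau> has_field_derivative - wp' \<tau> (- z)) (at z)" by (simp add: P2_minus)
  then have "- wp' \<tau> (- z) = wp' \<tau> z" using P2_has_field_derivative[OF assms] by (rule DERIV_unique)
  then show ?thesis by (metis minus_minus)
qed

text \<open>The derivative \<open>P2\<close> is periodic and the complement of the lattice is
  connected, so translation changes \<open>P1\<close> by a constant.\<close>

lemma P1_plus_lattice: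
  assumes "\<omega> \<in> \<Lambda>"
  obtains c where "\<And>z. z \<notin> \<Lambda> \<Longrightarrow> P1 \<tau> (z + \<omega>) = P1 \<tau> z + c"
proof -
  have "(\<lambda>z. P1 \<tau> (z + \<omega>) - P1 \<tau> z) constant_on - \<Lambda>"
  proof (rule has_field_derivative_0_imp_constant_on)
    fix z assume "z \<in> - \<Lambda>"
    then have z: "z \<notin> \<Lambda>" by simp
    show "((\<lambda>z. P1 \<tau> (z + \<omega>) - P1 \<tau> z) has_field_derivative 0) (at z)"
      using DERIV_diff[OF DERIV_shift_lattice[OF P1_has_field_derivative assms z]
          P1_has_field_derivative[OF z]] by (simp add: P2_plus_lattice z assms)
  qed (auto intro: connected_Compl_lattice open_Compl_lattice)
  then obtain c where "\<And>z. z \<notin> \<Lambda> \<Longrightarrow> P1 \<tau> (z + \<omega>) - P1 \<tau> z = c"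
    unfolding constant_on_def by auto
  then show ?thesis by (intro that[of c]) (metis diff_add_cancel add.commute)
qed

section \<open>Polar parts at lattice points and the quasi-period of \<open>P1\<close>\<close>

lemma P1_polar_0:
  obtains h where "h analytic_on {0}" "\<forall>\<^sub>F z in at 0. P1 \<tau> z = - 1 / z + h z"
proof -
  obtain h where h: "h analytic_on {0}" "\<forall>\<^sub>F z in nhds 0. wzeta \<tau> z = 1 / z + h z"
    using wzeta_polar_0 by metis
  have "\<forall>\<^sub>F z in at 0. P1 \<tau> z = - 1 / z + (- h z + G2 \<tau> * z)"
    using h(2) eventually_nhds_conv_at
    by (auto simp: P1_def eventually_nhds_conv_at elim!: eventually_mono)
  moreover have "(\<lambda>z. - h z + G2 \<tau> * z) analytic_on {0}" by (intro analytic_intros h(1))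
  ultimately show ?thesis using that by blast
qed

lemma eventually_at_shift:
  fixes a c :: complex
  shows "(\<forall>\<^sub>F z in at (a + c). P z) \<longleftrightarrow> (\<forall>\<^sub>F z in at a. P (z + c))"
  by (subst (1 2) at_to_0) (simp add: eventually_filtermap add_ac)

lemma P1_polar:
  assumes "\<omega> \<in> \<Lambda>"
  obtains h where "h analytic_on {\<omega>}" "\<forall>\<^sub>F z in at \<omega>. P1 \<tau> z = - 1 / (z - \<omega>) + h z"
proof -
  obtain h where h: "h analytic_on {0}" "\<forall>\<^sub>F z in at 0. P1 \<tau> z = - 1 / z + h z"
    by (rule P1_polar_0)
  obtain c where c: "\<And>z. z \<notin> \<Lambda> \<Longrightarrow> P1 \<tau> (z + \<omega>) = P1 \<tau> z + c"
    using P1_plus_lattice assms by metis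
  have "\<forall>\<^sub>F z in at (0 + \<omega>). P1 \<tau> z = - 1 / (z - \<omega>) + (h (z - \<omega>) + c)"
    unfolding eventually_at_shift
    using h(2) eventually_not_lattice by eventually_elim (simp add: c)
  moreover have "(\<lambda>z. h (z + - \<omega>) + c) analytic_on {\<omega>}"
    by (intro analytic_intros analytic_on_shift) (use h in simp)
  ultimately show ?thesis using that[of "\<lambda>z. h (z - \<omega>) + c"] by simp
qed

lemma P2_polar:
  assumes "\<omega> \<in> \<Lambda>"
  obtains h where "h analytic_on {\<omega>}" "\<forall>\<^sub>F z in at \<omega>. P2 \<tau> z = 1 / (z - \<omega>)\<^sup>2 + h z"
proof -
  obtain h where h: "h analytic_on {\<omega>}" "\<forall>\<^sub>F z in at \<omega>. P1 \<tau> z = - 1 / (z - \<omega>) + h z"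
    using P1_polar assms by metis
  obtain r where r: "r > 0" "h holomorphic_on ball \<omega> r"
    using h(1) by (auto simp: analytic_at_ball)
  have "\<forall>\<^sub>F z in at \<omega>. z \<in> ball \<omega> r - {\<omega>}"
    by (rule eventually_at_in_open) (use r in auto)
  with at_eq_imp_deriv_eq[OF h(2)] eventually_not_lattice
  have "\<forall>\<^sub>F z in at \<omega>. P2 \<tau> z = 1 / (z - \<omega>)\<^sup>2 + deriv h z"
  proof eventually_elim
    case (elim z)
    then have ne: "z \<noteq> \<omega>" and z: "z \<in> ball \<omega> r" by auto
    have "(h has_field_derivative deriv h z) (at z)"
      by (rule holomorphic_derivI[OF r(2) _ z]) simp
    then have "((\<lambda>z. - 1 / (z - \<omega>) + h z) has_field_derivative 1 / (z - \<omega>)\<^sup>2 + deriv h z) (at z)"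
      using ne by (auto intro!: derivative_eq_intros simp: power2_eq_square)
    then have "deriv (\<lambda>z. - 1 / (z - \<omega>) + h z) z = 1 / (z - \<omega>)\<^sup>2 + deriv h z"
      by (rule DERIV_imp_deriv)
    moreover have "deriv (P1 \<tau>) z = P2 \<tau> z"
      using elim by (intro DERIV_imp_deriv P1_has_field_derivative)
    ultimately show ?case using elim by simp
  qed
  then show ?thesis using that[of "deriv h"] h(1) by (simp add: analytic_deriv)
qed

lemma wp'_polar_0:
  obtains h where "h analytic_on {0}" "\<forall>\<^sub>F z in at 0. wp' \<tau> z = - 2 / z ^ 3 + h z"
proof -
  obtain h where h: "h analytic_on {0}" "\<forall>\<^sub>F z in at 0. P2 \<tau> z = 1 / (z - 0)\<^sup>2 + h z"
    using P2_polar lattice_0 by metis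
  obtain r where r: "r > 0" "h holomorphic_on ball 0 r"
    using h(1) by (auto simp: analytic_at_ball)
  have "\<forall>\<^sub>F z in at 0. z \<in> ball 0 r - {0}"
    by (rule eventually_at_in_open) (use r in auto)
  with at_eq_imp_deriv_eq[OF h(2)] eventually_not_lattice
  have "\<forall>\<^sub>F z in at 0. wp' \<tau> z = - 2 / z ^ 3 + deriv h z"
  proof eventually_elim
    case (elim z)
    then have ne: "z \<noteq> 0" and z: "z \<in> ball 0 r" by auto
    have "(h has_field_derivative deriv h z) (at z)"
      by (rule holomorphic_derivI[OF r(2) _ z]) simp
    then have "((\<lambda>z. 1 / (z - 0)\<^sup>2 + h z) has_field_derivative - 2 / z ^ 3 + deriv h z) (at z)"
      using ne by (auto intro!: derivative_eq_intros simp: field_simps power_eq_if)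
    then have "deriv (\<lambda>z. 1 / (z - 0)\<^sup>2 + h z) z = - 2 / z ^ 3 + deriv h z"
      by (rule DERIV_imp_deriv)
    moreover have "deriv (P2 \<tau>) z = wp' \<tau> z"
      using elim by (intro DERIV_imp_deriv P2_has_field_derivative)
    ultimately show ?case using elim by simp
  qed
  then show ?thesis using that[of "deriv h"] h(1) by (simp add: analytic_deriv)
qed

lemma P1_meromorphic: "P1 \<tau> meromorphic_on UNIV"
proof (subst meromorphic_on_meromorphic_at, intro ballI)
  fix z :: complex
  show "P1 \<tau> meromorphic_on {z}"
  proof (cases "z \<in> \<Lambda>")
    case True
    then obtain h where h: "h analytic_on {z}" "\<forall>\<^sub>F w in at z. P1 \<tau> w = - 1 / (w - z) + h w"
      using P1_polar by metis
    have "(\<lambda>w. - 1 / (w - z) + h w) meromorphic_on {z}"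
      by (intro meromorphic_intros analytic_on_imp_meromorphic_on[OF h(1)])
    then show ?thesis using meromorphic_on_cong[of "{z}" "P1 \<tau>" "\<lambda>w. - 1 / (w - z) + h w" "{z}"] h(2)
      by simp
  qed (auto intro: analytic_on_imp_meromorphic_on P1_analytic)
qed

lemma meromorphic_on_UNIV_subset: "f meromorphic_on UNIV \<Longrightarrow> f meromorphic_on A"
  by (rule meromorphic_on_subset) auto

lemma P2_meromorphic: "P2 \<tau> meromorphic_on UNIV"
proof -
  have "deriv (P1 \<tau>) meromorphic_on UNIV" by (intro meromorphic_intros P1_meromorphic)
  moreover have "\<forall>\<^sub>F w in at z. deriv (P1 \<tau>) w = P2 \<tau> w" for z
    using eventually_not_lattice
    by eventually_elim (auto intro: DERIV_imp_deriv P1_has_field_derivative)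
  ultimately show ?thesis using meromorphic_on_cong[of UNIV "deriv (P1 \<tau>)" "P2 \<tau>" UNIV] by simp
qed

lemma wp'_meromorphic: "wp' \<tau> meromorphic_on UNIV"
proof -
  have "deriv (P2 \<tau>) meromorphic_on UNIV" by (intro meromorphic_intros P2_meromorphic)
  moreover have "\<forall>\<^sub>F w in at z. deriv (P2 \<tau>) w = wp' \<tau> w" for z
    using eventually_not_lattice
    by eventually_elim (auto intro: DERIV_imp_deriv P2_has_field_derivative)
  ultimately show ?thesis using meromorphic_on_cong[of UNIV "deriv (P2 \<tau>)" "wp' \<tau>" UNIV] by simp
qed

lemma residue_P1_0: "residue (P1 \<tau>) 0 = - 1"
proof -
  obtain h where h: "h analytic_on {0}" "\<forall>\<^sub>F z in at 0. P1 \<tau> z = - 1 / z + h z"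
    by (rule P1_polar_0)
  obtain r where r: "r > 0" "h holomorphic_on ball 0 r"
    using h(1) by (auto simp: analytic_at_ball)
  have "\<forall>\<^sub>F z in at 0. P1 \<tau> z = (- 1 + z * h z) / (z - 0)"
    using h(2) eventually_neq_at_within[of 0] by eventually_elim (simp add: field_simps)
  then have "residue (P1 \<tau>) 0 = residue (\<lambda>z. (- 1 + z * h z) / (z - 0)) 0"
    by (rule residue_cong) simp
  also have "\<dots> = - 1 + 0 * h 0"
    by (rule residue_simple[of "ball 0 r"]) (use r in \<open>auto intro!: holomorphic_intros\<close>)
  finally show ?thesis by simp
qed

lemma Im_lattice:
  assumes "\<omega> \<in> \<Lambda>" "\<bar>Im \<omega>\<bar> < Im \<tau>"
  obtains n where "\<omega> = of_int n"
proof -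
  obtain m n where w: "\<omega> = of_int m + of_int n * \<tau>" using assms(1) by (rule latticeE)
  have "\<bar>of_int n :: real\<bar> * Im \<tau> < 1 * Im \<tau>" using assms(2) Im_pos by (simp add: w abs_mult)
  then have "\<bar>of_int n :: real\<bar> < 1" using Im_pos by (simp only: mult_less_cancel_right_pos)
  then have "n = 0" by linarith
  then show ?thesis using that[of m] w by simp
qed

text \<open>The Legendre relation, from the residue of \<open>P1\<close> at \<open>0\<close>.\<close>

lemma P1_plus_tau:
  assumes "z \<notin> \<Lambda>"
  shows "P1 \<tau> (z + \<tau>) = P1 \<tau> z + 2 * of_real pi * \<i>"
proof -
  obtain c where c: "\<And>z. z \<notin> \<Lambda> \<Longrightarrow> P1 \<tau> (z + \<tau>) = P1 \<tau> z + c"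
    using P1_plus_lattice lattice_tau by metis
  \<comment> \<open>The lines at heights \<open>- y\<close> and \<open>y\<close> enclose, modulo 1,
    just the pole at 0, and their heights differ by that of \<tau>.\<close>
  define y where "y = Im \<tau> / 2"
  have y: "y > 0" "2 * y = Im \<tau>" using Im_pos by (simp_all add: y_def)
  let ?S = "{p + of_int n | p n. p \<in> {0 :: complex}}"
  have S: "?S \<subseteq> \<Lambda>" using lattice_of_int by auto
  have notin: "z \<notin> \<Lambda>" if "\<bar>Im z\<bar> < Im \<tau>" "Im z \<noteq> 0" for z
    using Im_lattice[of z] that by (metis Im_complex_of_real of_real_of_int_eq)
  have "contour_integral (linepath (\<i> * of_real (- y)) (\<i> * of_real (- y) + 1)) (P1 \<tau>) -
        contour_integral (linepath (\<i> * of_real y) (\<i> * of_real y + 1)) (P1 \<tau>) =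
        2 * of_real pi * \<i> * (\<Sum>p\<in>{0}. residue (P1 \<tau>) p)"
  proof (rule strip_residues)
    show "P1 \<tau> holomorphic_on {z. - Im \<tau> < Im z \<and> Im z < Im \<tau>} - ?S"
      by (rule holomorphic_on_subset[OF P1_holomorphic]) (auto elim!: Im_lattice)
  qed (use y Im_pos in \<open>auto simp: P1_plus_1\<close>)
  moreover have "contour_integral (linepath (\<i> * of_real y) (\<i> * of_real y + 1)) (P1 \<tau>) =
      contour_integral (linepath (\<i> * of_real (- y)) (\<i> * of_real (- y) + 1)) (P1 \<tau>) + c"
  proof -
    have cont: "continuous_on {z. Im z = s} (P1 \<tau>)" if "\<bar>s\<bar> < Im \<tau>" "s \<noteq> 0" for s
      by (rule holomorphic_on_imp_continuous_on[OF holomorphic_on_subset[OF P1_holomorphic]])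
         (use that notin in auto)
    define x where "x = Re \<tau>"
    \<comment> \<open>Sliding the upper segment horizontally by \<open>Re \<tau>\<close> makes it
      the translate by \<tau> of the lower one.\<close>
    have eq: "\<i> * of_real y + of_real x = \<i> * of_real (- y) + \<tau>"
      using y by (simp add: complex_eq_iff x_def)
    have "contour_integral (linepath (\<i> * of_real y) (\<i> * of_real y + 1)) (P1 \<tau>) =
        contour_integral (linepath (\<i> * of_real y + of_real x) (\<i> * of_real y + of_real x + 1)) (P1 \<tau>)"
      by (rule contour_integral_unit_segment_shift[symmetric])
         (use cont[of y] y in \<open>auto simp: P1_plus_1\<close>)
    also have "\<dots> = integral {0..1} (\<lambda>t. P1 \<tau> (\<i> * of_real (- y) + of_real t + \<tau>))"
      unfolding contour_integral_unit_segment eq by (simp add: algebra_simps)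
    also have "\<dots> = integral {0..1} (\<lambda>t. P1 \<tau> (\<i> * of_real (- y) + of_real t) + c)"
      by (intro integral_cong c notin) (use y in auto)
    also have "\<dots> = integral {0..1} (\<lambda>t. P1 \<tau> (\<i> * of_real (- y) + of_real t)) + integral {0..1} (\<lambda>t::real. c)"
    proof -
      have "(\<lambda>t. P1 \<tau> (\<i> * of_real (- y) + of_real t)) integrable_on {0..1}"
        by (intro integrable_continuous_real continuous_on_compose2[OF cont[of "- y"]] continuous_intros)
           (use y in auto)
      from Henstock_Kurzweil_Integration.integral_add[OF this integrable_const_ivl[of c 0 1]]
      show ?thesis .
    qed
    finally show ?thesis unfolding contour_integral_unit_segment by simp
  qed
  ultimately have "c = 2 * of_real pi * \<i>" by (simp add: residue_P1_0)
  then show ?thesis using c[OF assms] by simp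
qed

end

subsection \<open>Zeros of wp'\<close>

lemma analytic_imp_tendsto: "f analytic_on {a} \<Longrightarrow> (f \<longlongrightarrow> f a) (at a)"
  using analytic_at_imp_isCont isContD by blast

lemma common_denominator:
  fixes x :: "'a :: field"
  assumes "x \<noteq> 0"
  shows "a * (k1 / x + c1) + b * (k2 / x + c2) + c * (k3 / x + c3) =
      (a * (k1 + c1 * x) + b * (k2 + c2 * x) + c * (k3 + c3 * x)) / x"
  using assms by (simp add: field_simps)

context upper_half
begin

section \<open>Half periods modulo the lattice\<close>

definition w1 :: complex where "w1 = 1 / 2"
definition w2 :: complex where "w2 = \<tau> / 2"
definition w3 :: complex where "w3 = - (1 + \<tau>) / 2"

lemma ram_points_eq: "ram_points \<tau> = {w1, w2, w3, 0}"
  by (simp add: ram_points_def w1_def w2_def w3_def)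

lemma half_lattice_cases:
  assumes "z \<in> H"
  obtains a \<omega> where "a \<in> ram_points \<tau>" "\<omega> \<in> \<Lambda>" "z = a + \<omega>"
proof -
  obtain m n where mn: "2 * z = of_int m + of_int n * \<tau>"
    using assms by (auto simp: half_lattice_def elim: latticeE)
  define m' n' where "m' = m div 2" and "n' = n div 2"
  define r s where "r = m mod 2" and "s = n mod 2"
  have rs: "r = 0 \<or> r = 1" "s = 0 \<or> s = 1" unfolding r_def s_def by presburger+
  have m: "m = 2 * m' + r" "n = 2 * n' + s" by (simp_all add: m'_def n'_def r_def s_def)
  have z: "z = (of_int r + of_int s * \<tau>) / 2 + (of_int m' + of_int n' * \<tau>)"
    using mn by (simp add: m field_simps)
  have 1: "of_int m' + of_int n' * \<tau> \<in> \<Lambda>" by (rule lattice_int_tau)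
  show ?thesis
  proof (cases "r = 1 \<and> s = 1")
    case True
    \<comment> \<open>The remainder is \<open>(1 + \<tau>) / 2\<close>, whereas \<open>w3\<close>
      carries the opposite sign; the two differ by the lattice point
      \<open>1 + \<tau>\<close>.\<close>
    have "1 + \<tau> \<in> \<Lambda>" by (intro lattice_add lattice_1 lattice_tau)
    with 1 have "(1 + \<tau>) + (of_int m' + of_int n' * \<tau>) \<in> \<Lambda>" by (rule lattice_add[rotated])
    then show ?thesis
      by (rule that[of w3, rotated]) (use z True in \<open>auto simp: ram_points_def field_simps w3_def\<close>)
  next
    case False
    then have "(of_int r + of_int s * \<tau>) / 2 \<in> ram_points \<tau>"
      using rs by (auto simp: ram_points_def)
    then show ?thesis using 1 z by (rule that)
  qed
qed

lemma w_half_lattice: "w1 \<in> H" "w2 \<in> H" "w3 \<in> H"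
proof -
  have "2 * w1 = 1" "2 * w2 = \<tau>" "2 * w3 = - (1 + \<tau>)" by (simp_all add: w1_def w2_def w3_def)
  then show "w1 \<in> H" "w2 \<in> H" "w3 \<in> H"
    unfolding half_lattice_def
    by (simp_all only: mem_Collect_eq lattice_1 lattice_tau lattice_uminus_iff lattice_add)
qed

lemma ram_points_half_lattice: "a \<in> ram_points \<tau> \<Longrightarrow> a \<in> H"
  using w_half_lattice lattice_imp_half_lattice[OF lattice_0] by (auto simp: ram_points_eq)

lemma not_lattice_if_coords:
  assumes "z = of_real x + of_real y * \<tau>" "x \<notin> \<int> \<or> y \<notin> \<int>"
  shows "z \<notin> \<Lambda>"
proof
  assume "z \<in> \<Lambda>"
  then obtain m n where "z = of_int m + of_int n * \<tau>" by (rule latticeE)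
  with assms(1) have eq: "of_real x + of_real y * \<tau> = of_int m + of_int n * \<tau>" by simp
  have "y * Im \<tau> = of_int n * Im \<tau>" using arg_cong[OF eq, of Im] by simp
  then have y: "y = of_int n" using Im_pos by simp
  with arg_cong[OF eq, of Re] have "x = of_int m" by simp
  with y assms(2) show False by simp
qed

lemma half_notin_Ints: "(1 / 2 :: real) \<notin> \<int>" "(- 1 / 2 :: real) \<notin> \<int>"
proof -
  have *: "x \<notin> \<int>" if x: "\<bar>2 * x\<bar> = 1" for x :: real
  proof
    assume "x \<in> \<int>"
    then obtain k where "x = of_int k" by (rule Ints_cases)
    with x have "\<bar>2 * k\<bar> = 1" by linarith
    then show False by presburger
  qed
  show "(1 / 2 :: real) \<notin> \<int>" "(- 1 / 2 :: real) \<notin> \<int>" by (rule *; simp)+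
qed

lemma w_notin_lattice: "w1 \<notin> \<Lambda>" "w2 \<notin> \<Lambda>" "w3 \<notin> \<Lambda>"
  by (rule not_lattice_if_coords[of _ "1/2" 0] not_lattice_if_coords[of _ 0 "1/2"]
      not_lattice_if_coords[of _ "-1/2" "-1/2"]; use half_notin_Ints in \<open>simp add: field_simps w1_def w2_def w3_def\<close>)+

lemma w_diff_notin_lattice:
  "w1 - w2 \<notin> \<Lambda>" "w2 - w1 \<notin> \<Lambda>" "w3 - w1 \<notin> \<Lambda>" "w1 - w3 \<notin> \<Lambda>" "w3 - w2 \<notin> \<Lambda>" "w2 - w3 \<notin> \<Lambda>"
proof -
  have a: "w1 - w2 \<notin> \<Lambda>"
    by (rule not_lattice_if_coords[of _ "1/2" "-1/2"]; use half_notin_Ints in \<open>simp add: field_simps w1_def w2_def w3_def\<close>)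
  have b: "w3 - w1 \<notin> \<Lambda>"
    by (rule not_lattice_if_coords[of _ "-1" "-1/2"]; use half_notin_Ints in \<open>simp add: field_simps w1_def w2_def w3_def\<close>)
  have c: "w3 - w2 \<notin> \<Lambda>"
    by (rule not_lattice_if_coords[of _ "-1/2" "-1"]; use half_notin_Ints in \<open>simp add: field_simps w1_def w2_def w3_def\<close>)
  show "w1 - w2 \<notin> \<Lambda>" "w2 - w1 \<notin> \<Lambda>" "w3 - w1 \<notin> \<Lambda>" "w1 - w3 \<notin> \<Lambda>" "w3 - w2 \<notin> \<Lambda>" "w2 - w3 \<notin> \<Lambda>"
    using a b c lattice_uminus_iff[of "w1 - w2"] lattice_uminus_iff[of "w3 - w1"]
      lattice_uminus_iff[of "w3 - w2"] by auto
qed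

text \<open>Each point of \<open>H\<close> is a translate of a ramification point, so limits at
  these four suffice to remove all singularities. The resulting entire function takes all its values
  on the compact fundamental parallelogram \<open>Q\<close>, and Liouville's theorem
  applies.\<close>

lemma elliptic_Liouville:
  assumes holo: "E holomorphic_on - H"
    and per: "\<And>z. z \<notin> H \<Longrightarrow> E (z + 1) = E z" "\<And>z. z \<notin> H \<Longrightarrow> E (z + \<tau>) = E z"
    and lim: "\<And>a. a \<in> ram_points \<tau> \<Longrightarrow> \<exists>L. (E \<longlongrightarrow> L) (at a)"
  obtains K where "\<And>z. z \<notin> H \<Longrightarrow> E z = K" "\<And>a. (E \<longlongrightarrow> K) (at a)"
proof -
  have E_per: "E (z + \<omega>) = E z" if "\<omega> \<in> \<Lambda>" "z \<notin> H" for z \<omega>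
    by (rule periodic_lattice[of H]) (use per that lattice_imp_half_lattice in auto)
  have an: "E analytic_on {z}" if "z \<notin> H" for z
    by (rule holomorphic_on_imp_analytic_at[OF holo open_Compl_half_lattice]) (use that in auto)
  have lim': "\<exists>L. (E \<longlongrightarrow> L) (at z)" for z
  proof (cases "z \<in> H")
    case True
    then obtain a \<omega> where aw: "a \<in> ram_points \<tau>" "\<omega> \<in> \<Lambda>" "z = a + \<omega>" by (rule half_lattice_cases)
    obtain L where "(E \<longlongrightarrow> L) (at a)" using lim aw by blast
    moreover have "\<forall>\<^sub>F x in at a. E x = E (x + \<omega>)"
      using eventually_not_half_lattice by eventually_elim (simp add: E_per aw)
    ultimately have "((\<lambda>x. E (x + \<omega>)) \<longlongrightarrow> L) (at a)" by (rule Lim_transform_eventually)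
    moreover have "at (a + \<omega>) = filtermap (\<lambda>x. x + \<omega>) (at a)"
      using filtermap_at_shift[of "- \<omega>" a] by simp
    ultimately have "(E \<longlongrightarrow> L) (at (a + \<omega>))" by (simp add: filterlim_filtermap)
    then show ?thesis using aw by blast
  qed (use an analytic_imp_tendsto in blast)
  have iso: "isolated_singularity_at E z" for z
  proof -
    have "\<forall>\<^sub>F w in at z. E analytic_on {w}" by (rule eventually_mono[OF eventually_not_half_lattice an])
    then show ?thesis by (simp add: isolated_singularity_at_altdef)
  qed
  let ?R = "remove_sings E"
  have "?R analytic_on {z}" for z using lim'[of z] iso[of z] remove_sings_analytic_at by blast
  then have "?R analytic_on UNIV" by (subst analytic_on_analytic_at) blast
  then have R_holo: "?R holomorphic_on UNIV" by (rule analytic_imp_holomorphic)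
  have R_eq: "?R z = E z" if "z \<notin> H" for z using an[OF that] by simp
  have R_per: "?R (z + \<omega>) = ?R z" if "\<omega> \<in> \<Lambda>" for z \<omega>
  proof -
    have "\<forall>\<^sub>F w in at 0. E (z + \<omega> + w) = E (z + w)"
      using eventually_not_half_lattice[of "0 + z", unfolded eventually_at_shift]
      by eventually_elim (use E_per[OF that] in \<open>metis add.commute add.assoc\<close>)
    then have "remove_sings (\<lambda>w. E (z + \<omega> + w)) 0 = remove_sings (\<lambda>w. E (z + w)) 0"
      by (rule remove_sings_cong) simp
    then show ?thesis by (simp add: remove_sings_shift_0[of E z] remove_sings_shift_0[of E "z + \<omega>"])
  qed
  define Q where "Q = (\<lambda>(s, t). of_real s + of_real t * \<tau>) ` ({0..1} \<times> {0..1 :: real})"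
  have "compact Q"
    unfolding Q_def case_prod_unfold
    by (intro compact_continuous_image compact_Times continuous_intros) auto
  then have "bounded (?R ` Q)"
    by (intro compact_imp_bounded compact_continuous_image holomorphic_on_imp_continuous_on
        holomorphic_on_subset[OF R_holo]) auto
  moreover have "range ?R \<subseteq> ?R ` Q"
  proof (rule image_subsetI)
    fix z :: complex
    define t where "t = Im z / Im \<tau>"
    define s where "s = Re z - t * Re \<tau>"
    have z: "z = of_real s + of_real t * \<tau>" using Im_pos by (simp add: complex_eq_iff s_def t_def)
    define z0 where "z0 = of_real (frac s) + of_real (frac t) * \<tau>"
    define \<omega> where "\<omega> = of_int \<lfloor>s\<rfloor> + of_int \<lfloor>t\<rfloor> * \<tau>"
    have "z = z0 + \<omega>" by (simp add: z z0_def \<omega>_def frac_def algebra_simps)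
    moreover have "\<omega> \<in> \<Lambda>" unfolding \<omega>_def by (rule lattice_int_tau)
    moreover have "z0 \<in> Q" unfolding Q_def z0_def
      by (intro image_eqI[of _ _ "(frac s, frac t)"]) (auto simp: frac_lt_1 less_imp_le)
    ultimately show "?R z \<in> ?R ` Q" using R_per by simp
  qed
  ultimately have "bounded (range ?R)" by (rule bounded_subset)
  with R_holo have "?R constant_on UNIV" by (rule Liouville_theorem)
  then obtain K where K: "\<And>z. ?R z = K" unfolding constant_on_def by auto
  have EK: "E z = K" if "z \<notin> H" for z using K[of z] R_eq[OF that] by simp
  moreover have "(E \<longlongrightarrow> K) (at a)" for a
  proof (rule Lim_transform_eventually[OF tendsto_const])
    show "\<forall>\<^sub>F z in at a. K = E z"
      using eventually_not_half_lattice by eventually_elim (simp add: EK)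
  qed
  ultimately show ?thesis by (rule that)
qed

text \<open>Periodicity identifies the values at \<open>w\<close> and \<open>- w\<close>, and
  oddness makes them opposite.\<close>

lemma wp'_half_period:
  assumes "w \<in> H" "w \<notin> \<Lambda>"
  shows "wp' \<tau> w = 0"
proof -
  have "- (2 * w) \<in> \<Lambda>" using assms by (simp add: half_lattice_def lattice_uminus)
  from wp'_plus_lattice[OF assms(2) this] have "wp' \<tau> (- w) = wp' \<tau> w" by simp
  then show ?thesis using wp'_minus[OF assms(2)] by simp
qed

text \<open>By the identity theorem \<open>wp'\<close> would vanish everywhere off the lattice,
  against its triple pole at 0.\<close>

lemma P2_neq_const:
  assumes "a \<notin> \<Lambda>" "\<forall>\<^sub>F z in at a. wp' \<tau> z = 0"
  shows False
proof -
  have fr: "\<exists>\<^sub>F z in at a. wp' \<tau> z = 0"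
    using assms(2) by (rule eventually_frequently[rotated]) simp
  have "wp' \<tau> nicely_meromorphic_on - \<Lambda>"
    by (intro analytic_on_imp_nicely_meromorphic_on)
       (simp add: analytic_on_open open_Compl_lattice wp'_holomorphic)
  from frequently_eq_meromorphic_imp_constant[OF fr this open_Compl_lattice connected_Compl_lattice] assms(1)
  have z: "wp' \<tau> z = 0" if "z \<notin> \<Lambda>" for z using that by auto
  obtain h where h: "h analytic_on {0}" "\<forall>\<^sub>F z in at 0. wp' \<tau> z = - 2 / z ^ 3 + h z"
    by (rule wp'_polar_0)
  have "\<forall>\<^sub>F z in at 0. z ^ 3 * h z = 2"
    using h(2) eventually_not_lattice eventually_neq_at_within[of 0]
    by eventually_elim (simp add: z field_simps)
  moreover have "((\<lambda>z. z ^ 3 * h z) \<longlongrightarrow> 0 ^ 3 * h 0) (at 0)"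
    by (intro tendsto_intros analytic_imp_tendsto h)
  ultimately have "((\<lambda>z::complex. 2 :: complex) \<longlongrightarrow> 0 ^ 3 * h 0) (at 0)"
    by (rule Lim_transform_eventually[rotated])
  then show False by (simp add: tendsto_const_iff)
qed

text \<open>One normal form whether or not \<open>a\<close> is a pole, so that combinations of
  translates can be treated at all points alike; \<open>k a\<close> records the residue.\<close>

lemma P1_shift_simple_pole:
  obtains k where "k analytic_on {a}" "\<forall>\<^sub>F z in at a. P1 \<tau> (z - b) = k z / (z - a)"
    "a - b \<in> \<Lambda> \<Longrightarrow> k a = - 1" "a - b \<notin> \<Lambda> \<Longrightarrow> k a = 0"
proof (cases "a - b \<in> \<Lambda>")
  case True
  obtain h where h: "h analytic_on {a - b}"
      "\<forall>\<^sub>F z in at (a - b). P1 \<tau> z = - 1 / (z - (a - b)) + h z"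
    using True by (rule P1_polar)
  have 1: "\<forall>\<^sub>F z in at a. P1 \<tau> (z - b) = - 1 / (z - a) + h (z - b)"
    using h(2) eventually_at_shift[of "\<lambda>z. P1 \<tau> z = - 1 / (z - (a - b)) + h z" a "- b"] by simp
  have "(\<lambda>z. h (z + - b)) analytic_on {a}" by (rule analytic_on_shift) (use h in simp)
  then have "(\<lambda>z. - 1 + (z - a) * h (z - b)) analytic_on {a}"
    by (intro analytic_intros) auto
  moreover have "\<forall>\<^sub>F z in at a. P1 \<tau> (z - b) = (- 1 + (z - a) * h (z - b)) / (z - a)"
    using 1 eventually_neq_at_within[of a] by eventually_elim (simp add: field_simps)
  ultimately show ?thesis using True by (intro that[of "\<lambda>z. - 1 + (z - a) * h (z - b)"]) auto
next
  case False
  have "(\<lambda>z. P1 \<tau> (z + - b)) analytic_on {a}"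
    by (rule analytic_on_shift) (use False P1_analytic in simp)
  then have "(\<lambda>z. (z - a) * P1 \<tau> (z - b)) analytic_on {a}"
    by (intro analytic_intros) auto
  moreover have "\<forall>\<^sub>F z in at a. P1 \<tau> (z - b) = ((z - a) * P1 \<tau> (z - b)) / (z - a)"
    using eventually_neq_at_within[of a] by eventually_elim simp
  ultimately show ?thesis using False by (intro that[of "\<lambda>z. (z - a) * P1 \<tau> (z - b)"]) auto
qed

lemma P2_shift_double_pole:
  assumes "a - b \<in> \<Lambda>"
  obtains k where "k analytic_on {a}" "\<forall>\<^sub>F z in at a. P2 \<tau> (z - b) = k z / (z - a)\<^sup>2" "k a = 1"
proof -
  obtain h where h: "h analytic_on {a - b}"
      "\<forall>\<^sub>F z in at (a - b). P2 \<tau> z = 1 / (z - (a - b))\<^sup>2 + h z"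
    using assms by (rule P2_polar)
  have 1: "\<forall>\<^sub>F z in at a. P2 \<tau> (z - b) = 1 / (z - a)\<^sup>2 + h (z - b)"
    using h(2) eventually_at_shift[of "\<lambda>z. P2 \<tau> z = 1 / (z - (a - b))\<^sup>2 + h z" a "- b"] by simp
  have "(\<lambda>z. h (z + - b)) analytic_on {a}" by (rule analytic_on_shift) (use h in simp)
  then have "(\<lambda>z. 1 + (z - a)\<^sup>2 * h (z - b)) analytic_on {a}"
    by (intro analytic_intros) auto
  moreover have "\<forall>\<^sub>F z in at a. P2 \<tau> (z - b) = (1 + (z - a)\<^sup>2 * h (z - b)) / (z - a)\<^sup>2"
    using 1 eventually_neq_at_within[of a] by eventually_elim (simp add: field_simps)
  ultimately show ?thesis by (intro that[of "\<lambda>z. 1 + (z - a)\<^sup>2 * h (z - b)"]) auto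
qed

lemma P2_shift_analytic:
  assumes "a - b \<notin> \<Lambda>"
  shows "(\<lambda>z. P2 \<tau> (z - b)) analytic_on {a}"
  using analytic_on_shift[of "P2 \<tau>" a "- b"] P2_analytic assms by simp

lemma P2_shift_deriv:
  assumes "a - b \<notin> \<Lambda>"
  shows "((\<lambda>z. P2 \<tau> (z - b)) has_field_derivative wp' \<tau> (a - b)) (at a)"
  using P2_has_field_derivative[OF assms] DERIV_shift[of "P2 \<tau>" "wp' \<tau> (a - b)" a "- b"] by simp

lemma double_zero:
  assumes "f analytic_on {a}" "f a = 0" "(f has_field_derivative 0) (at a)"
  obtains k where "k analytic_on {a}" "\<forall>\<^sub>F z in nhds a. f z = (z - a)\<^sup>2 * k z"
proof -
  obtain k where k: "k analytic_on {a}" "k a = deriv f a" "\<forall>\<^sub>F z in nhds a. f z = (z - a) * k z"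
    using analytic_factor assms by metis
  have "k a = 0" using k(2) assms(3) by (simp add: DERIV_imp_deriv)
  then obtain l where l: "l analytic_on {a}" "\<forall>\<^sub>F z in nhds a. k z = (z - a) * l z"
    using analytic_factor k(1) by metis
  have "\<forall>\<^sub>F z in nhds a. f z = (z - a)\<^sup>2 * l z"
    using k(3) l(2) by eventually_elim (simp add: power2_eq_square)
  with l(1) show ?thesis by (rule that)
qed

lemma double_zero_times_double_pole_tendsto:
  assumes f: "f analytic_on {a}" "f a = 0" "(f has_field_derivative 0) (at a)"
    and k: "k analytic_on {a}" "\<forall>\<^sub>F z in at a. g z = k z / (z - a)\<^sup>2"
  shows "\<exists>L. ((\<lambda>z. f z * g z) \<longlongrightarrow> L) (at a)"
proof -
  obtain l where l: "l analytic_on {a}" "\<forall>\<^sub>F z in nhds a. f z = (z - a)\<^sup>2 * l z"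
    using double_zero f by metis
  have l2: "\<forall>\<^sub>F z in at a. f z = (z - a)\<^sup>2 * l z" using l(2) by (simp add: eventually_nhds_conv_at)
  have "((\<lambda>z. l z * k z) \<longlongrightarrow> l a * k a) (at a)"
    by (intro tendsto_intros analytic_imp_tendsto l k)
  moreover have "\<forall>\<^sub>F z in at a. l z * k z = f z * g z"
    using l2 k(2) eventually_neq_at_within[of a] by eventually_elim simp
  ultimately show ?thesis by (blast intro: Lim_transform_eventually)
qed

text \<open>If the two values agreed, \<open>f\<close> would have double zeros at \<open>w1\<close>
  and \<open>w2\<close> and a double pole at 0, while \<open>g\<close> would have double poles at
  \<open>w1\<close> and \<open>w2\<close> and a double zero at 0, the latter by evenness and the
  vanishing of \<open>wp'\<close> at half periods. Then \<open>f * g\<close> is constant, and its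
  value at \<open>w3\<close> is 0. As \<open>g\<close> does not vanish near \<open>w1\<close>,
  \<open>f\<close> does, and \<open>P2\<close> is locally constant there. This takes the place of
  counting zeros of elliptic functions.\<close>

lemma P2_w1_neq_P2_w2: "P2 \<tau> w1 \<noteq> P2 \<tau> w2"
proof
  assume eq: "P2 \<tau> w1 = P2 \<tau> w2"
  define f where "f z = P2 \<tau> z - P2 \<tau> w1" for z
  define g where "g z = P2 \<tau> (z - w1) - P2 \<tau> (z - w2)" for z
  have notin: "z \<notin> \<Lambda>" "z - w1 \<notin> \<Lambda>" "z - w2 \<notin> \<Lambda>" if "z \<notin> H" for z
    using that lattice_imp_half_lattice[of z] lattice_imp_half_lattice[of "z - w1"]
      lattice_imp_half_lattice[of "z - w2"] half_lattice_diff_iff[OF w_half_lattice(1), of z]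
      half_lattice_diff_iff[OF w_half_lattice(2), of z] by blast+
  have f_an: "f analytic_on {z}" if "z \<notin> \<Lambda>" for z
    unfolding f_def by (intro analytic_intros P2_analytic that)
  have f_der: "(f has_field_derivative wp' \<tau> z) (at z)" if "z \<notin> \<Lambda>" for z
    unfolding f_def by (auto intro!: derivative_eq_intros P2_has_field_derivative that)
  have g_an: "g analytic_on {z}" if "z - w1 \<notin> \<Lambda>" "z - w2 \<notin> \<Lambda>" for z
    unfolding g_def by (intro analytic_intros P2_shift_analytic that)
  have g_der: "(g has_field_derivative wp' \<tau> (z - w1) - wp' \<tau> (z - w2)) (at z)"
    if "z - w1 \<notin> \<Lambda>" "z - w2 \<notin> \<Lambda>" for z
    unfolding g_def by (intro DERIV_diff P2_shift_deriv that)
  note wn = w_notin_lattice w_diff_notin_lattice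
  have g0: "g 0 = 0" "(g has_field_derivative 0) (at 0)" "g analytic_on {0}"
  proof -
    have n: "- w1 \<notin> \<Lambda>" "- w2 \<notin> \<Lambda>" using wn by (simp_all only: lattice_uminus_iff not_False_eq_True)
    show "g 0 = 0" using P2_minus[of w1] P2_minus[of w2] eq by (simp add: g_def)
    show "g analytic_on {0}" by (rule g_an) (use n in simp_all)
    have "wp' \<tau> (- w1) = 0" "wp' \<tau> (- w2) = 0"
      using n w_half_lattice half_lattice_minus_iff by (blast intro!: wp'_half_period)+
    then show "(g has_field_derivative 0) (at 0)" using g_der[of 0] n by simp
  qed
  have g_w1: "\<exists>k. k analytic_on {w1} \<and> (\<forall>\<^sub>F z in at w1. g z = k z / (z - w1)\<^sup>2) \<and> k w1 = 1"
  proof -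
    obtain k where k: "k analytic_on {w1}" "\<forall>\<^sub>F z in at w1. P2 \<tau> (z - w1) = k z / (z - w1)\<^sup>2" "k w1 = 1"
      using P2_shift_double_pole[of w1 w1] lattice_0 by auto
    have "(\<lambda>z. k z - (z - w1)\<^sup>2 * P2 \<tau> (z - w2)) analytic_on {w1}"
      by (intro analytic_intros k P2_shift_analytic wn)
    moreover have "\<forall>\<^sub>F z in at w1. g z = (k z - (z - w1)\<^sup>2 * P2 \<tau> (z - w2)) / (z - w1)\<^sup>2"
      using k(2) eventually_neq_at_within[of w1]
      by eventually_elim (simp add: g_def diff_divide_distrib)
    ultimately show ?thesis using k(3) by (intro exI[of _ "\<lambda>z. k z - (z - w1)\<^sup>2 * P2 \<tau> (z - w2)"]) simp
  qed
  have g_w2: "\<exists>k. k analytic_on {w2} \<and> (\<forall>\<^sub>F z in at w2. g z = k z / (z - w2)\<^sup>2)"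
  proof -
    obtain k where k: "k analytic_on {w2}" "\<forall>\<^sub>F z in at w2. P2 \<tau> (z - w2) = k z / (z - w2)\<^sup>2" "k w2 = 1"
      using P2_shift_double_pole[of w2 w2] lattice_0 by auto
    have "(\<lambda>z. (z - w2)\<^sup>2 * P2 \<tau> (z - w1) - k z) analytic_on {w2}"
      by (intro analytic_intros k P2_shift_analytic wn)
    moreover have "\<forall>\<^sub>F z in at w2. g z = ((z - w2)\<^sup>2 * P2 \<tau> (z - w1) - k z) / (z - w2)\<^sup>2"
      using k(2) eventually_neq_at_within[of w2]
      by eventually_elim (simp add: g_def diff_divide_distrib)
    ultimately show ?thesis by blast
  qed
  have lim: "\<exists>L. ((\<lambda>z. f z * g z) \<longlongrightarrow> L) (at a)" if "a \<in> ram_points \<tau>" for a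
  proof -
    from that consider "a = w1" | "a = w2" | "a = w3" | "a = 0" unfolding ram_points_eq by auto
    then show ?thesis
    proof cases
      case 1
      have "f w1 = 0" "(f has_field_derivative 0) (at w1)"
        using f_der[OF wn(1)] wp'_half_period[OF w_half_lattice(1) wn(1)] by (simp_all add: f_def)
      with g_w1 show ?thesis unfolding 1
        using double_zero_times_double_pole_tendsto[OF f_an[OF wn(1)]] by blast
    next
      case 2
      have "f w2 = 0" "(f has_field_derivative 0) (at w2)"
        using f_der[OF wn(2)] wp'_half_period[OF w_half_lattice(2) wn(2)] eq by (simp_all add: f_def)
      with g_w2 show ?thesis unfolding 2
        using double_zero_times_double_pole_tendsto[OF f_an[OF wn(2)]] by blast
    next
      case 3
      have "(\<lambda>z. f z * g z) analytic_on {w3}" by (intro analytic_intros f_an g_an wn)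
      then show ?thesis unfolding 3 using analytic_imp_tendsto by blast
    next
      case 4
      obtain k where k: "k analytic_on {0}" "\<forall>\<^sub>F z in at 0. P2 \<tau> (z - 0) = k z / (z - 0)\<^sup>2"
        using P2_shift_double_pole[of 0 0] lattice_0 by auto
      have "(\<lambda>z. k z - (z - 0)\<^sup>2 * P2 \<tau> w1) analytic_on {0}" by (intro analytic_intros k)
      moreover have "\<forall>\<^sub>F z in at 0. f z = (k z - (z - 0)\<^sup>2 * P2 \<tau> w1) / (z - 0)\<^sup>2"
        using k(2) eventually_neq_at_within[of 0]
        by eventually_elim (simp add: f_def diff_divide_distrib)
      ultimately have "\<exists>L. ((\<lambda>z. g z * f z) \<longlongrightarrow> L) (at 0)"
        by (rule double_zero_times_double_pole_tendsto[OF g0(3,1,2)])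
      then show ?thesis unfolding 4 by (simp add: mult.commute)
    qed
  qed
  obtain K where K: "\<And>z. z \<notin> H \<Longrightarrow> f z * g z = K" "\<And>a. ((\<lambda>z. f z * g z) \<longlongrightarrow> K) (at a)"
  proof (rule elliptic_Liouville[of "\<lambda>z. f z * g z"])
    have "(\<lambda>z. f z * g z) analytic_on - H"
      by (subst analytic_on_analytic_at) (auto intro!: analytic_intros f_an g_an notin)
    then show "(\<lambda>z. f z * g z) holomorphic_on - H" by (rule analytic_imp_holomorphic)
    fix z assume z: "z \<notin> H"
    have s: "z + \<omega> - w = z - w + \<omega>" for \<omega> w by simp
    show "f (z + 1) * g (z + 1) = f z * g z" "f (z + \<tau>) * g (z + \<tau>) = f z * g z"
      unfolding f_def g_def s using notin[OF z] by (simp_all add: P2_plus_lattice lattice_1 lattice_tau)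
  qed (use lim in blast)+
  have "((\<lambda>z. f z * g z) \<longlongrightarrow> f w3 * g w3) (at w3)"
    by (rule analytic_imp_tendsto) (intro analytic_intros f_an g_an wn)
  then have K3: "K = f w3 * g w3" using K(2)[of w3] tendsto_unique[of "at w3"] by simp
  \<comment> \<open>Modulo the lattice \<open>w3 - w1\<close> is \<open>- w2\<close> and
    \<open>w3 - w2\<close> is \<open>- w1\<close>, so \<open>g w3\<close> is a difference of the two
    values assumed equal.\<close>
  have "w3 - w1 = - w2 + (- 1)" "w3 - w2 = - w1 + (- \<tau>)"
    by (simp_all add: w1_def w2_def w3_def field_simps)
  then have "P2 \<tau> (w3 - w1) = P2 \<tau> w2" "P2 \<tau> (w3 - w2) = P2 \<tau> w1"
    using P2_plus_lattice[of "- w2" "- 1"] P2_plus_lattice[of "- w1" "- \<tau>"] wn(1,2)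
    by (simp_all only: lattice_uminus_iff lattice_1 lattice_tau P2_minus not_False_eq_True)
  then have "K = 0" using K3 eq by (simp add: g_def)
  obtain k where k: "k analytic_on {w1}" "\<forall>\<^sub>F z in at w1. g z = k z / (z - w1)\<^sup>2" "k w1 = 1"
    using g_w1 by blast
  have "\<forall>\<^sub>F z in at w1. k z \<noteq> 0"
    using analytic_imp_tendsto[OF k(1)] k(3) by (intro tendsto_imp_eventually_ne[of k 1]) auto
  then have "\<forall>\<^sub>F z in at w1. P2 \<tau> z = P2 \<tau> w1"
    using k(2) eventually_neq_at_within[of w1] eventually_not_half_lattice
  proof eventually_elim
    case (elim z)
    then have "f z * g z = 0" using K(1) \<open>K = 0\<close> by blast
    then show ?case using elim by (simp add: f_def)
  qed
  then have "\<forall>\<^sub>F z in at w1. deriv (P2 \<tau>) z = deriv (\<lambda>_. P2 \<tau> w1) z" by (rule at_eq_imp_deriv_eq)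
  then have "\<forall>\<^sub>F z in at w1. wp' \<tau> z = 0"
    using eventually_not_lattice
    by eventually_elim (simp add: DERIV_imp_deriv[OF P2_has_field_derivative])
  with wn(1) show False by (rule P2_neq_const)
qed

text \<open>The function \<open>g\<close> below has simple poles at the half periods and a triple zero at \<open>0\<close>, so
  \<open>g \<cdot> wp'\<close> is entire and elliptic; hence \<open>1 / wp'\<close> is a multiple of \<open>g\<close>.\<close>

lemma wp'_neq_0_and_inverse:
  shows wp'_neq_0: "z \<notin> H \<Longrightarrow> wp' \<tau> z \<noteq> 0"
    and inverse_wp'_simple_pole:
      "\<exists>k. k analytic_on {a} \<and> (\<forall>\<^sub>F z in at a. 1 / wp' \<tau> z = k z / (z - a))"
proof -
  note wn = w_notin_lattice w_diff_notin_lattice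
  \<comment> \<open>The coefficients of \<open>g\<close> add up to zero, so the constants that
    \<open>P1\<close> gains under lattice translations cancel and \<open>g\<close> is elliptic. The
    summands \<open>P1 \<tau> w1\<close>, \<open>P1 \<tau> w2\<close> and
    \<open>P1 \<tau> w3\<close> give \<open>g 0 = 0\<close>. The cyclic sum of
    \<open>(e2 - e3) * e1\<close> vanishes, so the first derivative at 0 is zero; the second one is
    zero because \<open>wp'\<close> vanishes at the half periods.\<close>
  define e1 e2 e3 where "e1 = P2 \<tau> w1" and "e2 = P2 \<tau> w2" and "e3 = P2 \<tau> w3"
  define g where "g z = (e2 - e3) * (P1 \<tau> (z - w1) + P1 \<tau> w1) + (e3 - e1) * (P1 \<tau> (z - w2) + P1 \<tau> w2)
      + (e1 - e2) * (P1 \<tau> (z - w3) + P1 \<tau> w3)" for z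
  have notin: "z \<notin> \<Lambda>" "z - w1 \<notin> \<Lambda>" "z - w2 \<notin> \<Lambda>" "z - w3 \<notin> \<Lambda>" if "z \<notin> H" for z
    using that lattice_imp_half_lattice[of z] lattice_imp_half_lattice[of "z - w1"]
      lattice_imp_half_lattice[of "z - w2"] lattice_imp_half_lattice[of "z - w3"]
      half_lattice_diff_iff[OF w_half_lattice(1), of z] half_lattice_diff_iff[OF w_half_lattice(2), of z]
      half_lattice_diff_iff[OF w_half_lattice(3), of z] by blast+
  have P1s_an: "(\<lambda>z. P1 \<tau> (z - b)) analytic_on {z}" if "z - b \<notin> \<Lambda>" for z b
    using analytic_on_shift[of "P1 \<tau>" z "- b"] P1_analytic that by simp
  have P1s_der: "((\<lambda>z. P1 \<tau> (z - b)) has_field_derivative P2 \<tau> (z - b)) (at z)" if "z - b \<notin> \<Lambda>" for z b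
    using P1_has_field_derivative[OF that] DERIV_shift[of "P1 \<tau>" "P2 \<tau> (z - b)" z "- b"] by simp
  have g_an: "g analytic_on {z}" if "z - w1 \<notin> \<Lambda>" "z - w2 \<notin> \<Lambda>" "z - w3 \<notin> \<Lambda>" for z
    unfolding g_def by (intro analytic_intros P1s_an that)
  define g' where "g' z = (e2 - e3) * P2 \<tau> (z - w1) + (e3 - e1) * P2 \<tau> (z - w2)
      + (e1 - e2) * P2 \<tau> (z - w3)" for z
  have g_der: "(g has_field_derivative g' z) (at z)"
    if "z - w1 \<notin> \<Lambda>" "z - w2 \<notin> \<Lambda>" "z - w3 \<notin> \<Lambda>" for z
    unfolding g_def g'_def by (auto intro!: derivative_eq_intros P1s_der that)
  have n0: "0 - w1 \<notin> \<Lambda>" "0 - w2 \<notin> \<Lambda>" "0 - w3 \<notin> \<Lambda>"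
    using wn(1-3) by (simp_all only: diff_0 lattice_uminus_iff not_False_eq_True)
  have g0: "g 0 = 0" by (simp add: g_def P1_minus[of w1] P1_minus[of w2] P1_minus[of w3])
  have g'0: "g' 0 = 0"
    by (simp add: g'_def P2_minus[of w1] P2_minus[of w2] P2_minus[of w3] e1_def e2_def e3_def algebra_simps
       )
  have g'_der: "(g' has_field_derivative 0) (at 0)"
  proof -
    have "(g' has_field_derivative (e2 - e3) * wp' \<tau> (0 - w1) + (e3 - e1) * wp' \<tau> (0 - w2)
        + (e1 - e2) * wp' \<tau> (0 - w3)) (at 0)"
      unfolding g'_def using n0
      by (auto intro!: derivative_eq_intros P2_shift_deriv simp del: diff_0)
    moreover have "wp' \<tau> (0 - w1) = 0" "wp' \<tau> (0 - w2) = 0" "wp' \<tau> (0 - w3) = 0"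
      using n0 w_half_lattice by (auto intro!: wp'_half_period simp only: diff_0 half_lattice_minus_iff)
    ultimately show ?thesis by simp
  qed
  have lim: "\<exists>L. ((\<lambda>z. g z * wp' \<tau> z) \<longlongrightarrow> L) (at a)" if "a \<in> ram_points \<tau>" for a
  proof (cases "a = 0")
    case False
    then have a: "a \<in> H" "a \<notin> \<Lambda>"
      using that ram_points_half_lattice wn(1-3) by (auto simp: ram_points_eq)
    obtain k where k: "k analytic_on {a}" "\<forall>\<^sub>F z in nhds a. wp' \<tau> z = (z - a) * k z"
      using analytic_factor[OF wp'_analytic[OF a(2)] wp'_half_period[OF a]] by metis
    obtain l where l: "l analytic_on {a}" "\<forall>\<^sub>F z in at a. g z = l z / (z - a)"
    proof -
      obtain k1 where k1: "k1 analytic_on {a}" "\<forall>\<^sub>F z in at a. P1 \<tau> (z - w1) = k1 z / (z - a)"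
        using P1_shift_simple_pole by metis
      obtain k2 where k2: "k2 analytic_on {a}" "\<forall>\<^sub>F z in at a. P1 \<tau> (z - w2) = k2 z / (z - a)"
        using P1_shift_simple_pole by metis
      obtain k3 where k3: "k3 analytic_on {a}" "\<forall>\<^sub>F z in at a. P1 \<tau> (z - w3) = k3 z / (z - a)"
        using P1_shift_simple_pole by metis
      let ?l = "\<lambda>z. (e2 - e3) * (k1 z + P1 \<tau> w1 * (z - a)) + (e3 - e1) * (k2 z + P1 \<tau> w2 * (z - a))
          + (e1 - e2) * (k3 z + P1 \<tau> w3 * (z - a))"
      have "?l analytic_on {a}" by (intro analytic_intros k1 k2 k3)
      moreover have "\<forall>\<^sub>F z in at a. g z = ?l z / (z - a)"
        using k1(2) k2(2) k3(2) eventually_neq_at_within[of a]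
      proof eventually_elim
        case (elim z)
        then have "z - a \<noteq> 0" by simp
        then show ?case unfolding g_def elim(1-3) by (rule common_denominator)
      qed
      ultimately show ?thesis by (rule that)
    qed
    have "((\<lambda>z. l z * k z) \<longlongrightarrow> l a * k a) (at a)"
      by (intro tendsto_intros analytic_imp_tendsto l k)
    moreover have "\<forall>\<^sub>F z in at a. wp' \<tau> z = (z - a) * k z"
      using k(2) by (simp add: eventually_nhds_conv_at)
    then have "\<forall>\<^sub>F z in at a. l z * k z = g z * wp' \<tau> z"
      using l(2) eventually_neq_at_within[of a] by eventually_elim simp
    ultimately show ?thesis by (blast intro: Lim_transform_eventually)
  next
    case True
    obtain m where m: "m analytic_on {0}" "m 0 = deriv g 0" "\<forall>\<^sub>F z in nhds 0. g z = (z - 0) * m z"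
      using analytic_factor[OF g_an[OF n0] g0] by metis
    have g_deriv: "deriv g 0 = 0" using DERIV_imp_deriv[OF g_der[OF n0]] g'0 by simp
    have "\<exists>l. l analytic_on {0} \<and> (\<forall>\<^sub>F z in nhds 0. g z = z ^ 3 * l z)"
    proof -
      have m0: "m 0 = 0" using m(2) g_deriv by simp
      obtain p where p: "p analytic_on {0}" "p 0 = deriv m 0" "\<forall>\<^sub>F z in nhds 0. m z = (z - 0) * p z"
        using analytic_factor[OF m(1) m0] by metis
      have gp: "\<forall>\<^sub>F z in nhds 0. g z = z\<^sup>2 * p z"
        using m(3) p(3) by eventually_elim (simp add: power2_eq_square)
      \<comment> \<open>\<open>p 0\<close> is half the second derivative of \<open>g\<close> at 0.
        It is read off from the limit of \<open>g' z / z = 2 * p z + z * deriv p z\<close>.\<close>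
      have "p 0 = 0"
      proof -
        have "\<forall>\<^sub>F z in at 0. deriv g z = deriv (\<lambda>z. z\<^sup>2 * p z) z"
          using gp by (intro at_eq_imp_deriv_eq) (simp add: eventually_nhds_conv_at)
        moreover obtain r where r: "r > 0" "p holomorphic_on ball 0 r"
          using p(1) by (auto simp: analytic_at_ball)
        have "\<forall>\<^sub>F z in at 0. z \<in> ball 0 r - {0}"
          by (rule eventually_at_in_open) (use r in auto)
        moreover have "\<forall>\<^sub>F z in at 0. deriv g z = g' z"
        proof -
          have "\<forall>\<^sub>F z in at (0::complex). z + - b \<notin> \<Lambda>" for b
            using eventually_not_lattice[of "0 + - b"] unfolding eventually_at_shift .
          from this[of w1] this[of w2] this[of w3] show ?thesis
            by eventually_elim (intro DERIV_imp_deriv g_der, simp_all)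
        qed
        ultimately have "\<forall>\<^sub>F z in at 0. (g' z - g' 0) / (z - 0) = 2 * p z + z * deriv p z"
        proof eventually_elim
          case (elim z)
          then have z: "z \<noteq> 0" "z \<in> ball 0 r" by auto
          have "(p has_field_derivative deriv p z) (at z)"
            by (rule holomorphic_derivI[OF r(2) _ z(2)]) simp
          then have "((\<lambda>z. z\<^sup>2 * p z) has_field_derivative 2 * z * p z + z\<^sup>2 * deriv p z) (at z)"
            by (auto intro!: derivative_eq_intros)
          then have "g' z = 2 * z * p z + z\<^sup>2 * deriv p z" using elim DERIV_imp_deriv by metis
          then show ?case using z(1) g'0 by (simp add: field_simps power2_eq_square)
        qed
        moreover have "((\<lambda>z. (g' z - g' 0) / (z - 0)) \<longlongrightarrow> 0) (at 0)"
          using g'_der by (simp add: has_field_derivative_iff)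
        ultimately have 1: "((\<lambda>z. 2 * p z + z * deriv p z) \<longlongrightarrow> 0) (at 0)"
          by (rule Lim_transform_eventually[rotated])
        have "((\<lambda>z. 2 * p z + z * deriv p z) \<longlongrightarrow> 2 * p 0 + 0 * deriv p 0) (at 0)"
          by (intro tendsto_intros analytic_imp_tendsto p analytic_deriv)
        with 1 have "2 * p 0 + 0 * deriv p 0 = 0" by (intro tendsto_unique[OF at_neq_bot])
        then show ?thesis by simp
      qed
      then obtain q where q: "q analytic_on {0}" "\<forall>\<^sub>F z in nhds 0. p z = (z - 0) * q z"
        using analytic_factor p(1) by metis
      have "\<forall>\<^sub>F z in nhds 0. g z = z ^ 3 * q z"
        using gp q(2) by eventually_elim (simp add: power2_eq_square power3_eq_cube)
      with q(1) show ?thesis by blast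
    qed
    then obtain l where l: "l analytic_on {0}" "\<forall>\<^sub>F z in nhds 0. g z = z ^ 3 * l z" by blast
    obtain h where h: "h analytic_on {0}" "\<forall>\<^sub>F z in at 0. wp' \<tau> z = - 2 / z ^ 3 + h z"
      by (rule wp'_polar_0)
    have "((\<lambda>z. l z * (- 2 + z ^ 3 * h z)) \<longlongrightarrow> l 0 * (- 2 + 0 ^ 3 * h 0)) (at 0)"
      by (intro tendsto_intros analytic_imp_tendsto l h)
    moreover have "\<forall>\<^sub>F z in at 0. g z = z ^ 3 * l z"
      using l(2) by (simp add: eventually_nhds_conv_at)
    then have "\<forall>\<^sub>F z in at 0. l z * (- 2 + z ^ 3 * h z) = g z * wp' \<tau> z"
      using h(2) eventually_neq_at_within[of 0]
    proof eventually_elim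
      case (elim z)
      then have "- 2 + z ^ 3 * h z = z ^ 3 * wp' \<tau> z" by (simp add: field_simps)
      then show ?case using elim(1) by simp
    qed
    ultimately show ?thesis unfolding True by (blast intro: Lim_transform_eventually)
  qed
  obtain K where K: "\<And>z. z \<notin> H \<Longrightarrow> g z * wp' \<tau> z = K"
  proof (rule elliptic_Liouville[of "\<lambda>z. g z * wp' \<tau> z"])
    have "(\<lambda>z. g z * wp' \<tau> z) analytic_on - H"
      by (subst analytic_on_analytic_at) (auto intro!: analytic_intros wp'_analytic g_an notin)
    then show "(\<lambda>z. g z * wp' \<tau> z) holomorphic_on - H" by (rule analytic_imp_holomorphic)
    fix z assume z: "z \<notin> H"
    have s: "z + \<omega> - w = z - w + \<omega>" for \<omega> w by simp
    have "g (z + \<omega>) = g z" if w: "\<omega> \<in> \<Lambda>" for \<omega>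
    proof -
      obtain c where c: "\<And>z. z \<notin> \<Lambda> \<Longrightarrow> P1 \<tau> (z + \<omega>) = P1 \<tau> z + c"
        by (rule P1_plus_lattice[OF w]) blast
      show ?thesis unfolding g_def s using notin[OF z] by (simp add: c) (simp add: algebra_simps)
    qed
    then show "g (z + 1) * wp' \<tau> (z + 1) = g z * wp' \<tau> z" "g (z + \<tau>) * wp' \<tau> (z + \<tau>) = g z * wp' \<tau> z"
      using notin[OF z] by (simp_all add: wp'_plus_lattice lattice_1 lattice_tau)
  qed (use lim that in blast)+
  \<comment> \<open>If \<open>K\<close> were 0, the pole of \<open>g\<close> at \<open>w3\<close>,
    with residue \<open>e2 - e1\<close>, would force \<open>wp'\<close> to vanish near
    \<open>w3\<close>. The residue is nonzero because \<open>P2\<close> separates \<open>w1\<close>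
    from \<open>w2\<close>.\<close>
  have K0: "K \<noteq> 0"
  proof
    assume "K = 0"
    obtain k1 where k1: "k1 analytic_on {w3}" "\<forall>\<^sub>F z in at w3. P1 \<tau> (z - w1) = k1 z / (z - w3)"
        "k1 w3 = 0"
      by (rule P1_shift_simple_pole[of w3 w1]; use wn in blast)
    obtain k2 where k2: "k2 analytic_on {w3}" "\<forall>\<^sub>F z in at w3. P1 \<tau> (z - w2) = k2 z / (z - w3)"
        "k2 w3 = 0"
      by (rule P1_shift_simple_pole[of w3 w2]; use wn in blast)
    obtain k3 where k3: "k3 analytic_on {w3}" "\<forall>\<^sub>F z in at w3. P1 \<tau> (z - w3) = k3 z / (z - w3)"
        "k3 w3 = - 1"
      using P1_shift_simple_pole[of w3 w3 thesis] lattice_0[of \<tau>] by simp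
    let ?l = "\<lambda>z. (e2 - e3) * (k1 z + P1 \<tau> w1 * (z - w3)) + (e3 - e1) * (k2 z + P1 \<tau> w2 * (z - w3))
          + (e1 - e2) * (k3 z + P1 \<tau> w3 * (z - w3))"
    have l: "(?l \<longlongrightarrow> ?l w3) (at w3)" by (intro analytic_imp_tendsto analytic_intros k1 k2 k3)
    have "?l w3 \<noteq> 0" using P2_w1_neq_P2_w2 by (simp add: k1 k2 k3 e1_def e2_def)
    with l have "\<forall>\<^sub>F z in at w3. ?l z \<noteq> 0" by (rule tendsto_imp_eventually_ne)
    then have "\<forall>\<^sub>F z in at w3. wp' \<tau> z = 0"
      using k1(2) k2(2) k3(2) eventually_neq_at_within[of w3] eventually_not_half_lattice
    proof eventually_elim
      case (elim z)
      then have ne: "z - w3 \<noteq> 0" by simp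
      have "g z = ?l z / (z - w3)"
        unfolding g_def elim(2-4) by (rule common_denominator[OF ne])
      then have "g z \<noteq> 0" using ne elim(1) by simp
      then show ?case using K[of z] elim \<open>K = 0\<close> by simp
    qed
    with wn(3) show False by (rule P2_neq_const)
  qed
  show "wp' \<tau> z \<noteq> 0" if "z \<notin> H" for z using K[OF that] K0 by auto
  \<comment> \<open>As \<open>1 / wp'\<close> is \<open>g / K\<close> off \<open>H\<close>, its
    poles are no worse than those of the translates of \<open>P1\<close>.\<close>
  show "\<exists>k. k analytic_on {a} \<and> (\<forall>\<^sub>F z in at a. 1 / wp' \<tau> z = k z / (z - a))"
  proof -
    obtain k1 where k1: "k1 analytic_on {a}" "\<forall>\<^sub>F z in at a. P1 \<tau> (z - w1) = k1 z / (z - a)"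
      using P1_shift_simple_pole by metis
    obtain k2 where k2: "k2 analytic_on {a}" "\<forall>\<^sub>F z in at a. P1 \<tau> (z - w2) = k2 z / (z - a)"
      using P1_shift_simple_pole by metis
    obtain k3 where k3: "k3 analytic_on {a}" "\<forall>\<^sub>F z in at a. P1 \<tau> (z - w3) = k3 z / (z - a)"
      using P1_shift_simple_pole by metis
    let ?l = "\<lambda>z. ((e2 - e3) * (k1 z + P1 \<tau> w1 * (z - a)) + (e3 - e1) * (k2 z + P1 \<tau> w2 * (z - a))
        + (e1 - e2) * (k3 z + P1 \<tau> w3 * (z - a))) / K"
    have "?l analytic_on {a}" by (intro analytic_intros k1 k2 k3) (use K0 in auto)
    moreover have "\<forall>\<^sub>F z in at a. 1 / wp' \<tau> z = ?l z / (z - a)"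
      using k1(2) k2(2) k3(2) eventually_neq_at_within[of a] eventually_not_half_lattice
    proof eventually_elim
      case (elim z)
      then have ne: "z - a \<noteq> 0" by simp
      have "g z / K = ?l z / (z - a)"
        unfolding g_def elim(1-3) common_denominator[OF ne] by simp
      moreover have "1 / wp' \<tau> z = g z / K" using K[of z] K0 elim by (simp add: divide_simps) (metis mult_zero_right)
      ultimately show ?case by simp
    qed
    ultimately show ?thesis by blast
  qed
qed

end

subsection \<open>Residues of meromorphic functions\<close>

text \<open>The power in the denominator is positive even at a regular point, so in all cases the
  residue is the \<open>N\<close>-th derivative of the numerator divided by
  \<open>fact N\<close>.\<close>

lemma meromorphic_at_factor:
  assumes "c meromorphic_on {a}"
  obtains N g where "g analytic_on {a}" "\<forall>\<^sub>F u in at a. c u = g u / (u - a) ^ Suc N"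
proof (cases "\<exists>\<^sub>F w in at a. c w \<noteq> 0")
  case False
  then have "\<forall>\<^sub>F u in at a. c u = 0 / (u - a) ^ Suc 0" by (simp add: not_frequently)
  then show ?thesis by (rule that[of "\<lambda>_. 0", rotated]) (intro analytic_intros)
next
  case True
  define n where "n = zorder c a"
  obtain h r where r: "r > 0" "h holomorphic_on cball a r"
      "\<And>w. w \<in> cball a r - {a} \<Longrightarrow> c w = h w * (w - a) powi n"
    using zorder_exist[OF meromorphic_on_isolated_singularity[OF assms]
        meromorphic_on_not_essential[OF assms] True] unfolding n_def by blast
  define N where "N = nat (- n)"
  define m where "m = nat (n + int (Suc N))"
  have m: "n = int m - int (Suc N)" by (simp add: m_def N_def)
  have "h analytic_on {a}"
    using r(1) holomorphic_on_subset[OF r(2) ball_subset_cball]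
    by (intro holomorphic_on_imp_analytic_at[of _ "ball a r"]) auto
  then have "(\<lambda>w. h w * (w - a) ^ m) analytic_on {a}" by (intro analytic_intros)
  moreover have "\<forall>\<^sub>F w in at a. w \<in> ball a r - {a}"
    by (rule eventually_at_in_open) (use r in auto)
  then have "\<forall>\<^sub>F u in at a. c u = (h u * (u - a) ^ m) / (u - a) ^ Suc N"
  proof eventually_elim
    case (elim w)
    then have "w - a \<noteq> 0" by simp
    then have "(w - a) powi n = (w - a) ^ m / (w - a) ^ Suc N"
      unfolding m by (simp only: power_int_diff power_int_of_nat simp_thms)
    then show ?case using r(3)[of w] elim by simp
  qed
  ultimately show ?thesis by (rule that)
qed

lemma residue_over_power_at:
  assumes "g analytic_on {a}"
  shows "residue (\<lambda>u. g u / (u - a) ^ Suc N) a = (deriv ^^ N) g a / fact N"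
proof -
  obtain r where "r > 0" "g holomorphic_on ball a r"
    using assms by (auto simp: analytic_at_ball)
  then show ?thesis by (intro residue_holomorphic_over_power[of "ball a r"]) auto
qed

lemma meromorphic_holomorphic_punctured:
  assumes "f meromorphic_on {a}"
  obtains r where "r > 0" "f holomorphic_on ball a r - {a}"
  using meromorphic_on_isolated_singularity[OF assms] that
  by (auto simp: isolated_singularity_at_def dest: analytic_imp_holomorphic)

lemma residue_add_at:
  assumes "f meromorphic_on {a}" "g meromorphic_on {a}"
  shows "residue (\<lambda>u. f u + g u) a = residue f a + residue g a"
proof -
  obtain r where r: "r > 0" "f holomorphic_on ball a r - {a}"
    by (rule meromorphic_holomorphic_punctured[OF assms(1)])
  obtain s where s: "s > 0" "g holomorphic_on ball a s - {a}"
    by (rule meromorphic_holomorphic_punctured[OF assms(2)])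
  show ?thesis
    by (rule residue_add[of "ball a (min r s)"])
       (use r s in \<open>auto intro: holomorphic_on_subset[OF r(2)] holomorphic_on_subset[OF s(2)]\<close>)
qed

lemma residue_cmult_at:
  assumes "f meromorphic_on {a}"
  shows "residue (\<lambda>u. c * f u) a = c * residue f a"
proof -
  obtain r where r: "r > 0" "f holomorphic_on ball a r - {a}"
    by (rule meromorphic_holomorphic_punctured[OF assms(1)])
  then show ?thesis by (intro residue_lmul[of "ball a r"]) auto
qed

lemma residue_diff_at:
  assumes "f meromorphic_on {a}" "g meromorphic_on {a}"
  shows "residue (\<lambda>u. f u - g u) a = residue f a - residue g a"
proof -
  have "residue (\<lambda>u. f u + (- 1) * g u) a = residue f a + residue (\<lambda>u. (- 1) * g u) a"
    by (rule residue_add_at) (intro meromorphic_intros assms)+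
  then show ?thesis using residue_cmult_at[OF assms(2), of "- 1"] by simp
qed

lemma residue_sum_at:
  assumes "finite I" "\<And>i. i \<in> I \<Longrightarrow> f i meromorphic_on {a}"
  shows "residue (\<lambda>u. \<Sum>i\<in>I. f i u) a = (\<Sum>i\<in>I. residue (f i) a)"
  using assms
proof (induction I rule: finite_induct)
  case (insert i I)
  then have "residue (\<lambda>u. f i u + (\<Sum>i\<in>I. f i u)) a = residue (f i) a + residue (\<lambda>u. \<Sum>i\<in>I. f i u) a"
    by (intro residue_add_at meromorphic_intros) auto
  then show ?case using insert by simp
qed (simp add: residue_const)

lemma residue_analytic_eq_0:
  assumes "g analytic_on {a}" "\<forall>\<^sub>F u in at a. f u = g u"
  shows "residue f a = 0"
proof -
  obtain r where r: "r > 0" "g holomorphic_on ball a r"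
    using assms(1) by (auto simp: analytic_at_ball)
  have "residue f a = residue g a" using assms(2) by (rule residue_cong) simp
  also have "\<dots> = 0" by (rule residue_holo[of "ball a r"]) (use r in auto)
  finally show ?thesis .
qed

lemma filterlim_reflect_at: "filterlim (\<lambda>u. 2 * a - u) (at a) (at (a :: complex))"
proof (rule filterlim_atI)
  show "((\<lambda>u. 2 * a - u) \<longlongrightarrow> a) (at a)"
    using tendsto_diff[OF tendsto_const[of "2 * a"] tendsto_ident_at[of a UNIV]] by simp
  show "\<forall>\<^sub>F u in at a. 2 * a - u \<noteq> a"
    using eventually_neq_at_within[of a] by eventually_elim (simp add: algebra_simps)
qed

text \<open>Symmetry about \<open>a\<close> leaves only even powers of \<open>u - a\<close> in the
  Laurent series. In terms of the numerator \<open>g\<close>: the reflection multiplies it by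
  \<open>(- 1) ^ Suc N\<close>, while differentiating \<open>N\<close> times contributes
  \<open>(- 1) ^ N\<close>, so the \<open>N\<close>-th derivative at \<open>a\<close> equals its own
  negative.\<close>

lemma residue_reflection_symmetric:
  assumes "f meromorphic_on {a}" and sym: "\<forall>\<^sub>F u in at a. f (2 * a - u) = f u"
  shows "residue f a = 0"
proof -
  obtain N g where g: "g analytic_on {a}" "\<forall>\<^sub>F u in at a. f u = g u / (u - a) ^ Suc N"
    by (rule meromorphic_at_factor[OF assms(1)])
  obtain r where r: "r > 0" "g holomorphic_on ball a r"
    using g(1) by (auto simp: analytic_at_ball)
  define k where "k u = (- 1) ^ Suc N * g (- 1 * u + 2 * a)" for u
  have k_holo: "k holomorphic_on ball a r"
    unfolding k_def
    by (intro holomorphic_intros holomorphic_on_compose_gen[OF _ r(2), unfolded o_def])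
       (auto simp: dist_norm norm_minus_commute algebra_simps)
  have ev: "\<forall>\<^sub>F u in at a. k u = g u"
    using sym g(2) eventually_compose_filterlim[OF g(2) filterlim_reflect_at] eventually_neq_at_within[of a]
  proof eventually_elim
    case (elim u)
    then have ne: "(u - a) ^ Suc N \<noteq> 0" by simp
    have "2 * a - u - a = - (u - a)" by simp
    then have "g u / (u - a) ^ Suc N = g (2 * a - u) / (- (u - a)) ^ Suc N" using elim by metis
    also have "\<dots> = (- 1) ^ Suc N * g (2 * a - u) / (u - a) ^ Suc N"
      by (subst power_minus) (simp add: divide_simps)
    finally show ?case using ne by (simp add: k_def del: power_Suc)
  qed
  \<comment> \<open>Derivatives at \<open>a\<close> need the identity at \<open>a\<close> itself; it
    follows by continuity.\<close>
  have "\<forall>\<^sub>F u in nhds a. k u = g u"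
  proof -
    have "(k \<longlongrightarrow> k a) (at a)" "(g \<longlongrightarrow> g a) (at a)"
      using k_holo g(1) r(1)
      by (auto intro!: analytic_imp_tendsto holomorphic_on_imp_analytic_at[of k "ball a r"])
    moreover have "(g \<longlongrightarrow> k a) (at a)"
      using \<open>(k \<longlongrightarrow> k a) (at a)\<close> ev by (rule Lim_transform_eventually)
    ultimately have "k a = g a" by (intro tendsto_unique[OF at_neq_bot])
    with ev show ?thesis by (simp add: eventually_nhds_conv_at)
  qed
  then have "(deriv ^^ N) k a = (deriv ^^ N) g a" by (rule higher_deriv_cong_ev) simp
  moreover have "(deriv ^^ N) k a = (- 1) ^ Suc N * (deriv ^^ N) (\<lambda>u. g (- 1 * u + 2 * a)) a"
    unfolding k_def
    by (rule higher_deriv_cmult'[OF holomorphic_on_imp_analytic_at[of _ "ball a r"]])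
       (use r(1) in \<open>auto intro!: holomorphic_intros holomorphic_on_compose_gen[OF _ r(2), unfolded o_def]
          simp: dist_norm norm_minus_commute algebra_simps\<close>)
  moreover have "(deriv ^^ N) (\<lambda>u. g (- 1 * u + 2 * a)) a = (- 1) ^ N * (deriv ^^ N) g (- 1 * a + 2 * a)"
    by (rule higher_deriv_compose_linear'[OF r(2), of "ball a r"])
       (use r(1) in \<open>auto simp: dist_norm norm_minus_commute algebra_simps\<close>)
  ultimately have "(deriv ^^ N) g a = (- 1) ^ Suc N * (- 1) ^ N * (deriv ^^ N) g a" by simp
  also have "(- 1 :: complex) ^ Suc N * (- 1) ^ N = - 1"
    by (simp flip: power_mult_distrib)
  finally have z: "(deriv ^^ N) g a = 0" by simp
  have "residue f a = residue (\<lambda>u. g u / (u - a) ^ Suc N) a"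
    using g(2) by (rule residue_cong) simp
  then show ?thesis using residue_over_power_at[OF g(1), of N] z by (simp del: power_Suc)
qed

subsection \<open>Even elliptic functions of several points\<close>

lemma nths_eq_map_nth: "nths xs I = map (nth xs) (nths [0..<length xs] I)"
  by (metis map_nth nths_map)

context upper_half
begin

text \<open>Poles are allowed on \<open>H\<close> only, and nothing is required of the values there,
  where \<open>1 / 0 = 0\<close> and \<open>deriv\<close> at a pole supply meaningless
  numbers.\<close>

definition even_elliptic :: "(complex \<Rightarrow> complex) set" ("\<E>") where
  "\<E> = {\<phi>. \<phi> meromorphic_on UNIV \<and> \<phi> holomorphic_on - H \<and>
     (\<forall>z. z \<notin> H \<longrightarrow> \<phi> (- z) = \<phi> z \<and> \<phi> (z + 1) = \<phi> z \<and> \<phi> (z + \<tau>) = \<phi> z)}"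

lemma
  assumes "\<phi> \<in> \<E>"
  shows even_elliptic_meromorphic: "\<phi> meromorphic_on A"
    and even_elliptic_holomorphic: "\<phi> holomorphic_on - H"
    and even_elliptic_minus: "z \<notin> H \<Longrightarrow> \<phi> (- z) = \<phi> z"
    and even_elliptic_plus: "\<omega> \<in> \<Lambda> \<Longrightarrow> z \<notin> H \<Longrightarrow> \<phi> (z + \<omega>) = \<phi> z"
proof -
  show "\<phi> holomorphic_on - H" "z \<notin> H \<Longrightarrow> \<phi> (- z) = \<phi> z" "\<phi> meromorphic_on A"
    using assms by (auto simp: even_elliptic_def intro: meromorphic_on_UNIV_subset)
  show "\<phi> (z + \<omega>) = \<phi> z" if "\<omega> \<in> \<Lambda>" "z \<notin> H"
    by (rule periodic_lattice[of H])
       (use assms that lattice_imp_half_lattice in \<open>auto simp: even_elliptic_def\<close>)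
qed

lemma even_elliptic_const: "(\<lambda>_. c) \<in> \<E>"
  by (simp add: even_elliptic_def meromorphic_on_const)

lemma even_elliptic_add: "f \<in> \<E> \<Longrightarrow> g \<in> \<E> \<Longrightarrow> (\<lambda>z. f z + g z) \<in> \<E>"
  by (simp add: even_elliptic_def meromorphic_on_add holomorphic_on_add)

lemma even_elliptic_mult: "f \<in> \<E> \<Longrightarrow> g \<in> \<E> \<Longrightarrow> (\<lambda>z. f z * g z) \<in> \<E>"
  by (simp add: even_elliptic_def meromorphic_on_mult holomorphic_on_mult)

lemma inverse_wp'_square_even_elliptic: "(\<lambda>z. 1 / (2 * (wp' \<tau> z)\<^sup>2)) \<in> \<E>"
proof -
  have "(\<lambda>z. 1 / (2 * (wp' \<tau> z)\<^sup>2)) meromorphic_on UNIV"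
    by (intro meromorphic_intros wp'_meromorphic)
  moreover have "(\<lambda>z. 1 / (2 * (wp' \<tau> z)\<^sup>2)) holomorphic_on - H"
    by (intro holomorphic_intros holomorphic_on_subset[OF wp'_holomorphic])
       (use lattice_imp_half_lattice wp'_neq_0 in auto)
  moreover have "wp' \<tau> (- z) = - wp' \<tau> z" "wp' \<tau> (z + 1) = wp' \<tau> z" "wp' \<tau> (z + \<tau>) = wp' \<tau> z"
    if "z \<notin> H" for z
    using that lattice_imp_half_lattice[of z] wp'_minus wp'_plus_lattice lattice_1 lattice_tau by blast+
  ultimately show ?thesis by (simp add: even_elliptic_def)
qed

text \<open>This is \<open>W\<^sub>0\<^sub>,\<^sub>2\<close> at the points \<open>z\<close> and
  \<open>- z\<close>, the first term of \<open>R2\<close> for \<open>g = 1\<close> without further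
  points. Its poles lie on \<open>H\<close> by the definition of \<open>H\<close>.\<close>

lemma P2_double_even_elliptic: "(\<lambda>z. P2 \<tau> (2 * z)) \<in> \<E>"
proof -
  have "(\<lambda>z. 2 * z) analytic_on (UNIV :: complex set)" by (intro analytic_intros)
  then have "(\<lambda>z. P2 \<tau> (2 * z)) meromorphic_on UNIV"
    by (rule meromorphic_on_compose[OF P2_meromorphic]) auto
  moreover have "(\<lambda>z. P2 \<tau> (2 * z)) holomorphic_on - H"
    by (rule holomorphic_on_compose_gen[OF _ P2_holomorphic, unfolded o_def])
       (auto intro!: holomorphic_intros simp: half_lattice_def)
  moreover have "P2 \<tau> (2 * (z + \<omega>)) = P2 \<tau> (2 * z)" if "z \<notin> H" "\<omega> \<in> \<Lambda>" for z \<omega>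
    using P2_plus_lattice[of "2 * z" "2 * \<omega>"] that by (simp add: half_lattice_def lattice_double distrib_left)
  moreover have "P2 \<tau> (2 * (- z)) = P2 \<tau> (2 * z)" for z using P2_minus[of "2 * z"] by simp
  ultimately show ?thesis
    unfolding even_elliptic_def mem_Collect_eq using lattice_1[of \<tau>] lattice_tau[of \<tau>] by blast
qed

section \<open>The algebra of even elliptic functions of several points\<close>

definition regular :: "nat \<Rightarrow> complex list \<Rightarrow> bool" where
  "regular n xs \<longleftrightarrow> length xs = n \<and> set xs \<inter> H = {}"

lemma regular_Cons: "regular (Suc n) (x # xs) \<longleftrightarrow> x \<notin> H \<and> regular n xs"
  by (auto simp: regular_def)

lemma regular_nth: "regular n xs \<Longrightarrow> i < n \<Longrightarrow> xs ! i \<notin> H"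
  by (auto simp: regular_def dest: nth_mem)

lemma regular_map_nth:
  assumes "regular n xs" "set js \<subseteq> {..<n}"
  shows "regular (length js) (map (nth xs) js)"
proof -
  have "x \<notin> H" if x: "x \<in> set (map (nth xs) js)" for x
  proof -
    obtain j where "j \<in> set js" "x = xs ! j" using x by auto
    then show ?thesis using regular_nth[OF assms(1)] assms(2) by blast
  qed
  then show ?thesis by (auto simp: regular_def)
qed

text \<open>Functions of \<open>n\<close> points in the algebra generated by the even elliptic functions of the
  single points. All stable correlation functions are of this form, which makes them
  even and elliptic in every argument.\<close>

inductive_set elliptic_alg :: "nat \<Rightarrow> (complex list \<Rightarrow> complex) set" for n where
  const: "(\<lambda>_. c) \<in> elliptic_alg n"
| var: "\<phi> \<in> \<E> \<Longrightarrow> i < n \<Longrightarrow> (\<lambda>xs. \<phi> (xs ! i)) \<in> elliptic_alg n"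
| add: "F \<in> elliptic_alg n \<Longrightarrow> G \<in> elliptic_alg n \<Longrightarrow> (\<lambda>xs. F xs + G xs) \<in> elliptic_alg n"
| mult: "F \<in> elliptic_alg n \<Longrightarrow> G \<in> elliptic_alg n \<Longrightarrow> (\<lambda>xs. F xs * G xs) \<in> elliptic_alg n"
| regular_cong: "F \<in> elliptic_alg n \<Longrightarrow> (\<And>xs. regular n xs \<Longrightarrow> G xs = F xs) \<Longrightarrow> G \<in> elliptic_alg n"

lemma elliptic_alg_cmult: "F \<in> elliptic_alg n \<Longrightarrow> (\<lambda>xs. c * F xs) \<in> elliptic_alg n"
  by (rule elliptic_alg.mult[OF elliptic_alg.const])

lemma elliptic_alg_diff:
  "F \<in> elliptic_alg n \<Longrightarrow> G \<in> elliptic_alg n \<Longrightarrow> (\<lambda>xs. F xs - G xs) \<in> elliptic_alg n"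
  using elliptic_alg.add[OF _ elliptic_alg_cmult[of G n "- 1"], of F] by simp

lemma elliptic_alg_sum:
  "finite I \<Longrightarrow> (\<And>i. i \<in> I \<Longrightarrow> F i \<in> elliptic_alg n) \<Longrightarrow> (\<lambda>xs. \<Sum>i\<in>I. F i xs) \<in> elliptic_alg n"
  by (induction I rule: finite_induct) (auto intro: elliptic_alg.intros(1,3))

text \<open>Positions in \<open>js\<close> may repeat. This lets one point fill two slots, as in
  \<open>W (g - 1)\<close> at \<open>u # u # zs\<close>, and it selects the sublists of a
  splitting.\<close>

lemma elliptic_alg_reindex:
  assumes "F \<in> elliptic_alg m" "length js = m" "set js \<subseteq> {..<n}"
  shows "(\<lambda>xs. F (map (nth xs) js)) \<in> elliptic_alg n"
  using assms(1)
proof induction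
  case (var \<phi> i)
  have "js ! i < n" using assms(2,3) var(2) nth_mem by blast
  then have "(\<lambda>xs. \<phi> (xs ! (js ! i))) \<in> elliptic_alg n" by (rule elliptic_alg.var[OF var(1)])
  then show ?case using var(2) assms(2) by simp
next
  case (regular_cong F G)
  show ?case
    by (rule elliptic_alg.regular_cong[OF regular_cong(3)]) (use regular_cong(2) regular_map_nth[OF _ assms(3)] assms(2) in auto)
qed (auto intro: elliptic_alg.intros)

lemma elliptic_alg_invariant:
  assumes "F \<in> elliptic_alg n" "regular n xs" "regular n ys"
    and "\<And>i. i < n \<Longrightarrow> ys ! i - xs ! i \<in> \<Lambda> \<or> ys ! i + xs ! i \<in> \<Lambda>"
  shows "F ys = F xs"
  using assms(1)
proof induction
  case (var \<phi> i)
  have x: "xs ! i \<notin> H" using regular_nth[OF assms(2) var(2)] .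
  from assms(4)[OF var(2)] show ?case
  proof
    assume "ys ! i - xs ! i \<in> \<Lambda>"
    from even_elliptic_plus[OF var(1) this x] show ?thesis by simp
  next
    assume "ys ! i + xs ! i \<in> \<Lambda>"
    from even_elliptic_plus[OF var(1) this, of "- (xs ! i)"] x show ?thesis
      by (simp add: even_elliptic_minus[OF var(1)])
  qed
next
  case (regular_cong F G)
  then show ?case using assms(2,3) by simp
qed auto

text \<open>The dependence on the first point is split off, so that residues in it can be taken with
  the other points as parameters.\<close>

inductive separated :: "nat \<Rightarrow> (complex \<Rightarrow> complex list \<Rightarrow> complex) \<Rightarrow> bool" for n where
  prod: "c \<in> \<E> \<Longrightarrow> G \<in> elliptic_alg n \<Longrightarrow> separated n (\<lambda>u zs. c u * G zs)"
| add: "separated n F \<Longrightarrow> separated n F' \<Longrightarrow> separated n (\<lambda>u zs. F u zs + F' u zs)"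

lemma separated_mult:
  assumes "separated n F" "separated n F'"
  shows "separated n (\<lambda>u zs. F u zs * F' u zs)"
  using assms(1)
proof induction
  case 1: (prod c G)
  from assms(2) show ?case
  proof induction
    case (prod c' G')
    have "separated n (\<lambda>u zs. (c u * c' u) * (G zs * G' zs))"
      by (intro separated.prod even_elliptic_mult elliptic_alg.mult 1 prod)
    then show ?case by (simp add: mult_ac)
  qed (simp add: distrib_left separated.add)
qed (simp add: distrib_right separated.add)

lemma elliptic_alg_separated:
  assumes "F \<in> elliptic_alg (Suc n)"
  shows "\<exists>F'. separated n F' \<and> (\<forall>u zs. u \<notin> H \<longrightarrow> regular n zs \<longrightarrow> F (u # zs) = F' u zs)"
  using assms
proof induction
  case (const c)
  have "separated n (\<lambda>u zs. c * 1)"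
    by (rule separated.prod[OF even_elliptic_const elliptic_alg.const])
  then show ?case by auto
next
  case (var \<phi> i)
  show ?case
  proof (cases i)
    case 0
    have "separated n (\<lambda>u zs. \<phi> u * 1)" by (rule separated.prod[OF var(1) elliptic_alg.const])
    then show ?thesis using 0 by auto
  next
    case (Suc j)
    have "separated n (\<lambda>u zs. 1 * \<phi> (zs ! j))"
      by (rule separated.prod[OF even_elliptic_const elliptic_alg.var[OF var(1)]]) (use var(2) Suc in simp)
    then show ?thesis using Suc by auto
  qed
next
  case (add F G)
  then obtain F' G' where "separated n F'" "separated n G'"
    "\<forall>u zs. u \<notin> H \<longrightarrow> regular n zs \<longrightarrow> F (u # zs) = F' u zs"
    "\<forall>u zs. u \<notin> H \<longrightarrow> regular n zs \<longrightarrow> G (u # zs) = G' u zs" by blast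
  then show ?case by (intro exI[of _ "\<lambda>u zs. F' u zs + G' u zs"]) (simp add: separated.add)
next
  case (mult F G)
  then obtain F' G' where "separated n F'" "separated n G'"
    "\<forall>u zs. u \<notin> H \<longrightarrow> regular n zs \<longrightarrow> F (u # zs) = F' u zs"
    "\<forall>u zs. u \<notin> H \<longrightarrow> regular n zs \<longrightarrow> G (u # zs) = G' u zs" by blast
  then show ?case by (intro exI[of _ "\<lambda>u zs. F' u zs * G' u zs"]) (simp add: separated_mult)
next
  case (regular_cong F G)
  then obtain F' where "separated n F'"
    "\<forall>u zs. u \<notin> H \<longrightarrow> regular n zs \<longrightarrow> F (u # zs) = F' u zs" by blast
  then show ?case using regular_cong(2) by (intro exI[of _ F']) (simp add: regular_Cons)
qed

lemma separated_even_elliptic: "separated n F \<Longrightarrow> (\<lambda>u. F u zs) \<in> \<E>"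
  by (induction rule: separated.induct)
     (auto intro: even_elliptic_add even_elliptic_mult even_elliptic_const)

lemma even_elliptic_cong:
  assumes "f \<in> \<E>" "\<And>z. z \<notin> H \<Longrightarrow> g z = f z"
  shows "g \<in> \<E>"
proof -
  have "\<forall>\<^sub>F w in at z. f w = g w" for z
    using eventually_not_half_lattice by eventually_elim (simp add: assms(2))
  then have "g meromorphic_on UNIV"
    using even_elliptic_meromorphic[OF assms(1), of UNIV] meromorphic_on_cong[of UNIV f g UNIV] by simp
  moreover have "g holomorphic_on - H"
    by (rule holomorphic_transform[OF even_elliptic_holomorphic[OF assms(1)]]) (simp add: assms(2))
  moreover have "z + 1 \<notin> H" "z + \<tau> \<notin> H" if "z \<notin> H" for z
    using that lattice_imp_half_lattice[OF lattice_1] lattice_imp_half_lattice[OF lattice_tau] by simp_all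
  ultimately show ?thesis
    using assms(1) by (simp add: even_elliptic_def assms(2))
qed

lemma elliptic_alg_even_elliptic:
  assumes "F \<in> elliptic_alg (Suc n)" "regular n zs"
  shows "(\<lambda>u. F (u # zs)) \<in> \<E>"
proof -
  obtain F' where F': "separated n F'" "\<forall>u zs. u \<notin> H \<longrightarrow> regular n zs \<longrightarrow> F (u # zs) = F' u zs"
    using elliptic_alg_separated[OF assms(1)] by blast
  show ?thesis
    by (rule even_elliptic_cong[OF separated_even_elliptic[OF F'(1), of zs]]) (use F'(2) assms(2) in blast)
qed

text \<open>Both the recursion kernel and the factors \<open>W\<^sub>0\<^sub>,\<^sub>2\<close> of the integrand belong to this set.\<close>

definition kernels :: "complex \<Rightarrow> nat \<Rightarrow> (complex list \<Rightarrow> complex \<Rightarrow> complex) set" where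
  "kernels a n = {M. (\<forall>xs. regular n xs \<longrightarrow> M xs analytic_on {a}) \<and>
     (\<forall>j. (\<lambda>xs. (deriv ^^ j) (M xs) a) \<in> elliptic_alg n)}"

lemma kernels_elliptic_alg: "G \<in> elliptic_alg n \<Longrightarrow> (\<lambda>xs u. G xs) \<in> kernels a n"
  unfolding kernels_def mem_Collect_eq
proof (intro conjI allI impI)
  fix j assume "G \<in> elliptic_alg n"
  then show "(\<lambda>xs. (deriv ^^ j) (\<lambda>u. G xs) a) \<in> elliptic_alg n"
    by (cases "j = 0") (auto intro: elliptic_alg.const)
qed auto

lemma kernels_mult:
  assumes "M \<in> kernels a n" "M' \<in> kernels a n"
  shows "(\<lambda>xs u. M xs u * M' xs u) \<in> kernels a n"
  unfolding kernels_def mem_Collect_eq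
proof (intro conjI allI impI)
  have an: "M xs analytic_on {a}" "M' xs analytic_on {a}" if "regular n xs" for xs
    using assms that by (auto simp: kernels_def)
  show "(\<lambda>u. M xs u * M' xs u) analytic_on {a}" if "regular n xs" for xs
    using an[OF that] by (intro analytic_intros)
  fix j
  have "(\<lambda>xs. \<Sum>i=0..j. of_nat (j choose i) * (deriv ^^ i) (M xs) a * (deriv ^^ (j - i)) (M' xs) a)
      \<in> elliptic_alg n"
    by (intro elliptic_alg_sum elliptic_alg.mult elliptic_alg.const)
       (use assms in \<open>auto simp: kernels_def\<close>)
  then show "(\<lambda>xs. (deriv ^^ j) (\<lambda>u. M xs u * M' xs u) a) \<in> elliptic_alg n"
    by (rule elliptic_alg.regular_cong) (intro higher_deriv_mult_at an)
qed

text \<open>The pole order of \<open>c\<close> does not depend on \<open>xs\<close>, so the residue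
  is one fixed Leibniz sum: Taylor coefficients of \<open>M\<close>, which lie in the algebra, with
  constant coefficients taken from \<open>c\<close>.\<close>

lemma kernels_residue:
  assumes M: "M \<in> kernels a n" and c: "c \<in> \<E>"
  shows "(\<lambda>xs. residue (\<lambda>u. M xs u * c u) a) \<in> elliptic_alg n"
proof -
  obtain N g where g: "g analytic_on {a}" "\<forall>\<^sub>F u in at a. c u = g u / (u - a) ^ Suc N"
    by (rule meromorphic_at_factor[OF even_elliptic_meromorphic[OF c]])
  have an: "M xs analytic_on {a}" if "regular n xs" for xs
    using M that by (auto simp: kernels_def)
  have "(\<lambda>xs. (\<Sum>i=0..N. of_nat (N choose i) * (deriv ^^ i) (M xs) a * (deriv ^^ (N - i)) g a) * (1 / fact N))
      \<in> elliptic_alg n"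
    by (intro elliptic_alg_sum elliptic_alg.mult elliptic_alg.const)
       (use M in \<open>auto simp: kernels_def\<close>)
  then show ?thesis
  proof (rule elliptic_alg.regular_cong)
    fix xs assume xs: "regular n xs"
    have "\<forall>\<^sub>F u in at a. M xs u * c u = (M xs u * g u) / (u - a) ^ Suc N"
      using g(2) by eventually_elim simp
    then have "residue (\<lambda>u. M xs u * c u) a = residue (\<lambda>u. (M xs u * g u) / (u - a) ^ Suc N) a"
      by (rule residue_cong) simp
    also have "\<dots> = (deriv ^^ N) (\<lambda>u. M xs u * g u) a / fact N"
      by (intro residue_over_power_at analytic_intros an xs g)
    finally show "residue (\<lambda>u. M xs u * c u) a =
        (\<Sum>i=0..N. of_nat (N choose i) * (deriv ^^ i) (M xs) a * (deriv ^^ (N - i)) g a) * (1 / fact N)"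
      by (simp add: higher_deriv_mult_at[OF an[OF xs] g(1)])
  qed
qed

text \<open>Separating the first point of \<open>F\<close> reduces this to
  \<open>kernels_residue\<close>: the part without \<open>u\<close> is absorbed into the kernel, and
  the part in \<open>u\<close> plays the role of \<open>c\<close>.\<close>

lemma kernels_residue_elliptic_alg:
  assumes M: "M \<in> kernels a m" and F: "F \<in> elliptic_alg (Suc n)"
    and js: "length js = n" "set js \<subseteq> {..<m}"
  shows "(\<lambda>xs. residue (\<lambda>u. M xs u * F (u # map (nth xs) js)) a) \<in> elliptic_alg m"
proof -
  obtain F' where F': "separated n F'" "\<forall>u zs. u \<notin> H \<longrightarrow> regular n zs \<longrightarrow> F (u # zs) = F' u zs"
    using elliptic_alg_separated[OF F] by blast
  have an: "M xs analytic_on {a}" if "regular m xs" for xs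
    using M that by (auto simp: kernels_def)
  from F'(1) have "(\<lambda>xs. residue (\<lambda>u. M xs u * F' u (map (nth xs) js)) a) \<in> elliptic_alg m"
  proof induction
    case (prod c G)
    have "(\<lambda>xs. residue (\<lambda>u. (M xs u * G (map (nth xs) js)) * c u) a) \<in> elliptic_alg m"
      by (intro kernels_residue kernels_mult M kernels_elliptic_alg elliptic_alg_reindex[OF prod(2) js] prod)
    then show ?case by (simp add: mult_ac)
  next
    case (add F1 F2)
    show ?case
    proof (rule elliptic_alg.regular_cong[OF elliptic_alg.add[OF add(3,4)]])
      fix xs assume xs: "regular m xs"
      show "residue (\<lambda>u. M xs u * (F1 u (map (nth xs) js) + F2 u (map (nth xs) js))) a =
          residue (\<lambda>u. M xs u * F1 u (map (nth xs) js)) a + residue (\<lambda>u. M xs u * F2 u (map (nth xs) js)) a"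
        unfolding distrib_left
        by (intro residue_add_at meromorphic_intros analytic_on_imp_meromorphic_on[OF an[OF xs]]
            even_elliptic_meromorphic separated_even_elliptic[OF add(1)] separated_even_elliptic[OF add(2)])
    qed
  qed
  then show ?thesis
  proof (rule elliptic_alg.regular_cong)
    fix xs assume xs: "regular m xs"
    have "regular n (map (nth xs) js)" using regular_map_nth[OF xs js(2)] js(1) by simp
    then have "\<forall>\<^sub>F u in at a. M xs u * F (u # map (nth xs) js) = M xs u * F' u (map (nth xs) js)"
      by (intro eventually_mono[OF eventually_not_half_lattice]) (simp add: F'(2))
    then show "residue (\<lambda>u. M xs u * F (u # map (nth xs) js)) a =
        residue (\<lambda>u. M xs u * F' u (map (nth xs) js)) a"
      by (rule residue_cong) simp
  qed
qed

lemma half_lattice_not_lattice_shift: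
  assumes "x \<notin> H" "a \<in> H"
  shows "x - a \<notin> \<Lambda>" "x + a \<notin> \<Lambda>" "a - x \<notin> \<Lambda>"
  using assms lattice_imp_half_lattice[of "x - a"] lattice_imp_half_lattice[of "x + a"]
    lattice_imp_half_lattice[of "a - x"] by auto

section \<open>Taylor coefficients of the kernels at the half periods\<close>

lemma higher_deriv_affine:
  assumes "f analytic_on {u * z + c}"
  shows "(deriv ^^ n) (\<lambda>w. f (u * w + c)) z = u ^ n * (deriv ^^ n) f (u * z + c)"
proof -
  obtain T where T: "open T" "u * z + c \<in> T" "f holomorphic_on T"
    using assms by (auto simp: analytic_at)
  have "open ((\<lambda>w. u * w + c) -` T)" by (intro open_vimage T continuous_intros)
  then show ?thesis
    by (rule higher_deriv_compose_linear'[OF T(3) _ T(1)]) (use T in auto)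
qed

text \<open>In \<open>x\<close>, the difference is even because \<open>P1\<close> is odd, and it is
  elliptic because the constants gained by \<open>P1\<close> cancel between the two terms; Taylor
  coefficients in \<open>u\<close> inherit both. The explicit form \<open>f\<close> serves for
  holomorphy, the kernel itself for the symmetries.\<close>

lemma P1_kernel_higher_deriv_even_elliptic:
  assumes "a \<in> H"
  shows "(\<lambda>x. (deriv ^^ j) (\<lambda>u. P1 \<tau> (x - u) - P1 \<tau> (x + u)) a) \<in> \<E>"
proof -
  let ?D = "(deriv ^^ j) (P1 \<tau>)"
  let ?K = "\<lambda>x u. P1 \<tau> (x - u) - P1 \<tau> (x + u)"
  define f where "f x = (- 1) ^ j * ?D (x - a) - ?D (x + a)" for x
  have eq: "(deriv ^^ j) (?K x) a = f x" if x: "x \<notin> H" for x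
  proof -
    note n = half_lattice_not_lattice_shift[OF x assms]
    have 1: "P1 \<tau> analytic_on {- 1 * a + x}" "P1 \<tau> analytic_on {1 * a + x}"
      using n by (auto intro!: P1_analytic simp: add.commute)
    have 2: "(\<lambda>u. P1 \<tau> (- 1 * u + x)) analytic_on {a}" "(\<lambda>u. P1 \<tau> (1 * u + x)) analytic_on {a}"
      by (rule analytic_on_compose_gen[of "\<lambda>u. - 1 * u + x" "{a}" "P1 \<tau>" "{- 1 * a + x}", unfolded o_def]
          analytic_on_compose_gen[of "\<lambda>u. 1 * u + x" "{a}" "P1 \<tau>" "{1 * a + x}", unfolded o_def],
          intro analytic_intros, rule 1, simp)+
    show ?thesis
      using higher_deriv_diff_at[OF 2, of j] higher_deriv_affine[OF 1(1), of j] higher_deriv_affine[OF 1(2), of j]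
      by (simp add: f_def add.commute)
  qed
  have D_mero: "?D meromorphic_on UNIV" by (intro meromorphic_intros P1_meromorphic)
  have f_mero: "f meromorphic_on UNIV"
  proof -
    have "(\<lambda>x. ?D (x + b)) meromorphic_on UNIV" for b
      by (rule meromorphic_on_compose[OF D_mero, of "\<lambda>x. x + b"]) (auto intro!: analytic_intros)
    from this[of a] this[of "- a"] show ?thesis
      unfolding f_def by (intro meromorphic_intros) simp_all
  qed
  have f_holo: "f holomorphic_on - H"
  proof -
    have D: "?D holomorphic_on - \<Lambda>"
      by (intro holomorphic_higher_deriv P1_holomorphic open_Compl_lattice)
    have "(\<lambda>x. ?D (x - a)) holomorphic_on - H" "(\<lambda>x. ?D (x + a)) holomorphic_on - H"
      using half_lattice_not_lattice_shift[OF _ assms]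
      by (auto intro!: holomorphic_on_compose_gen[OF _ D, unfolded o_def] holomorphic_intros)
    then show ?thesis unfolding f_def by (intro holomorphic_intros)
  qed
  have "(\<lambda>x. (deriv ^^ j) (?K x) a) \<in> \<E> \<longleftrightarrow> f \<in> \<E>"
    using even_elliptic_cong[of f "\<lambda>x. (deriv ^^ j) (?K x) a"]
      even_elliptic_cong[of "\<lambda>x. (deriv ^^ j) (?K x) a" f] eq by auto
  moreover have "f \<in> \<E>"
    unfolding even_elliptic_def mem_Collect_eq
  proof (intro conjI allI impI f_mero f_holo)
    fix x assume x: "x \<notin> H"
    have x1: "- x \<notin> H" "x + 1 \<notin> H" "x + \<tau> \<notin> H"
      using x lattice_imp_half_lattice[OF lattice_1] lattice_imp_half_lattice[OF lattice_tau] by auto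
    have "?K (- x) u = ?K x u" for u
      using P1_minus[of "x + u"] P1_minus[of "x - u"] by simp
    then have "?K (- x) = ?K x" by blast
    then show "f (- x) = f x" using eq[OF x] eq[OF x1(1)] by metis
    have "?K (x + 1) u = ?K x u" for u
      using P1_plus_1[of "x - u"] P1_plus_1[of "x + u"] by (simp add: algebra_simps)
    then have "?K (x + 1) = ?K x" by blast
    then show "f (x + 1) = f x" using eq[OF x] eq[OF x1(2)] by metis
    \<comment> \<open>The translation rule for \<tau> holds off the lattice only, hence for
      \<open>u\<close> near \<open>a\<close>, which is enough for derivatives at
      \<open>a\<close>.\<close>
    have "open ((\<lambda>u. x - u) -` (- \<Lambda>) \<inter> (\<lambda>u. x + u) -` (- \<Lambda>))"
      by (intro open_Int open_vimage open_Compl_lattice continuous_intros)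
    then have "\<forall>\<^sub>F u in nhds a. u \<in> (\<lambda>u. x - u) -` (- \<Lambda>) \<inter> (\<lambda>u. x + u) -` (- \<Lambda>)"
      by (rule eventually_nhds_in_open) (use half_lattice_not_lattice_shift[OF x assms] in simp)
    then have "\<forall>\<^sub>F u in nhds a. ?K (x + \<tau>) u = ?K x u"
    proof eventually_elim
      case (elim u)
      have "x + \<tau> - u = (x - u) + \<tau>" "x + \<tau> + u = (x + u) + \<tau>" by simp_all
      then show ?case using elim by (simp only: P1_plus_tau vimage_eq Int_iff Compl_iff not_False_eq_True) simp
    qed
    then have "(deriv ^^ j) (?K (x + \<tau>)) a = (deriv ^^ j) (?K x) a" by (rule higher_deriv_cong_ev) simp
    then show "f (x + \<tau>) = f x" using eq[OF x] eq[OF x1(3)] by simp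
  qed
  ultimately show ?thesis by simp
qed

lemma analytic_on_reflect:
  assumes "f analytic_on {x - a}"
  shows "(\<lambda>u. f (x - u)) analytic_on {a}"
proof -
  have "(\<lambda>u. x - u) analytic_on {a}" by (intro analytic_intros)
  then show ?thesis
    using analytic_on_compose_gen[of "\<lambda>u. x - u" "{a}" f "{x - a}"] assms by (simp add: o_def)
qed

lemma analytic_on_translate:
  assumes "f analytic_on {x + a}"
  shows "(\<lambda>u. f (x + u)) analytic_on {a}"
  using analytic_on_shift[of f a x] assms by (simp add: add.commute)

lemma kernels_P1:
  assumes "a \<in> H" "i < n"
  shows "(\<lambda>xs u. P1 \<tau> (xs ! i - u) - P1 \<tau> (xs ! i + u)) \<in> kernels a n"
  unfolding kernels_def mem_Collect_eq
proof (intro conjI allI impI)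
  fix xs assume "regular n xs"
  then have "xs ! i \<notin> H" using assms(2) by (rule regular_nth)
  note n = half_lattice_not_lattice_shift[OF this assms(1)]
  show "(\<lambda>u. P1 \<tau> (xs ! i - u) - P1 \<tau> (xs ! i + u)) analytic_on {a}"
    by (intro analytic_on_diff analytic_on_reflect analytic_on_translate P1_analytic n)
qed (rule elliptic_alg.var[OF P1_kernel_higher_deriv_even_elliptic[OF assms(1)] assms(2)])

text \<open>This is minus the derivative in \<open>u\<close> of the kernel in the previous lemma.\<close>

lemma kernels_P2:
  assumes "a \<in> H" "i < n"
  shows "(\<lambda>xs u. P2 \<tau> (u - xs ! i) + P2 \<tau> (u + xs ! i)) \<in> kernels a n"
  unfolding kernels_def mem_Collect_eq
proof (intro conjI allI impI)
  have P2_eq: "P2 \<tau> (u - x) = P2 \<tau> (x - u)" for u x using P2_minus[of "x - u"] by simp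
  {
    fix xs assume "regular n xs"
    then have x: "xs ! i \<notin> H" using assms(2) by (rule regular_nth)
    note n = half_lattice_not_lattice_shift[OF x assms(1)]
    have "(\<lambda>u. P2 \<tau> (xs ! i - u) + P2 \<tau> (xs ! i + u)) analytic_on {a}"
      by (intro analytic_on_add analytic_on_reflect analytic_on_translate P2_analytic n)
    then show "(\<lambda>u. P2 \<tau> (u - xs ! i) + P2 \<tau> (u + xs ! i)) analytic_on {a}"
      by (simp add: P2_eq add.commute)
  }
  fix j
  have "(\<lambda>xs. - 1 * (deriv ^^ Suc j) (\<lambda>u. P1 \<tau> (xs ! i - u) - P1 \<tau> (xs ! i + u)) a) \<in> elliptic_alg n"
    by (intro elliptic_alg_cmult elliptic_alg.var[OF P1_kernel_higher_deriv_even_elliptic[OF assms(1)] assms(2)])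
  then show "(\<lambda>xs. (deriv ^^ j) (\<lambda>u. P2 \<tau> (u - xs ! i) + P2 \<tau> (u + xs ! i)) a) \<in> elliptic_alg n"
  proof (rule elliptic_alg.regular_cong)
    fix xs assume "regular n xs"
    then have x: "xs ! i \<notin> H" using assms(2) by (rule regular_nth)
    let ?x = "xs ! i"
    let ?K = "\<lambda>u. P1 \<tau> (?x - u) - P1 \<tau> (?x + u)"
    have "open ((\<lambda>u. ?x - u) -` (- \<Lambda>) \<inter> (\<lambda>u. ?x + u) -` (- \<Lambda>))"
      by (intro open_Int open_vimage open_Compl_lattice continuous_intros)
    then have "\<forall>\<^sub>F u in nhds a. u \<in> (\<lambda>u. ?x - u) -` (- \<Lambda>) \<inter> (\<lambda>u. ?x + u) -` (- \<Lambda>)"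
      by (rule eventually_nhds_in_open) (use half_lattice_not_lattice_shift[OF x assms(1)] in simp)
    then have "\<forall>\<^sub>F u in nhds a. P2 \<tau> (u - ?x) + P2 \<tau> (u + ?x) = - deriv ?K u"
    proof eventually_elim
      case (elim u)
      then have n: "?x - u \<notin> \<Lambda>" "?x + u \<notin> \<Lambda>" by auto
      have "(?K has_field_derivative P2 \<tau> (?x - u) * - 1 - P2 \<tau> (?x + u) * 1) (at u)"
        by (rule DERIV_diff; rule DERIV_chain2[OF P1_has_field_derivative];
            use n in \<open>auto intro!: derivative_eq_intros\<close>)
      then have "deriv ?K u = P2 \<tau> (?x - u) * - 1 - P2 \<tau> (?x + u) * 1" by (rule DERIV_imp_deriv)
      then show ?case by (simp add: P2_eq add.commute)
    qed
    then have "(deriv ^^ j) (\<lambda>u. P2 \<tau> (u - ?x) + P2 \<tau> (u + ?x)) a = (deriv ^^ j) (\<lambda>u. - deriv ?K u) a"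
      by (rule higher_deriv_cong_ev) simp
    also have "\<dots> = - (deriv ^^ j) (deriv ?K) a"
    proof (rule higher_deriv_uminus_at, rule analytic_deriv)
      note n = half_lattice_not_lattice_shift[OF x assms(1)]
      show "?K analytic_on {a}"
        by (intro analytic_on_diff analytic_on_reflect analytic_on_translate P1_analytic n)
    qed
    finally show "(deriv ^^ j) (\<lambda>u. P2 \<tau> (u - ?x) + P2 \<tau> (u + ?x)) a = - 1 * (deriv ^^ Suc j) ?K a"
      by (simp add: funpow_swap1)
  qed
qed

end

subsection \<open>Parity and ellipticity of the correlation functions\<close>

declare W.simps [simp del]

section \<open>Sublists and splittings of the points\<close>

lemma nths_singleton_nth: "i < length zs \<Longrightarrow> nths zs {i} = [zs ! i]"
proof (induction zs arbitrary: i)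
  case (Cons z zs)
  have "{j. Suc j \<in> {i}} = (if i = 0 then {} else {i - 1})" by auto
  then show ?case using Cons by (cases i) (auto simp: nths_Cons)
qed simp

lemma nths_remove_nth: "i < length zs \<Longrightarrow> nths zs ({..<length zs} - {i}) = remove_nth i zs"
proof (induction zs arbitrary: i)
  case (Cons z zs)
  show ?case
  proof (cases i)
    case 0
    have "{j. Suc j \<in> {..<length (z # zs)} - {0}} = {..<length zs}" by auto
    then show ?thesis using 0 by (simp add: nths_Cons remove_nth_def)
  next
    case (Suc k)
    have "{j. Suc j \<in> {..<length (z # zs)} - {Suc k}} = {..<length zs} - {k}" by auto
    then show ?thesis using Suc Cons by (simp add: nths_Cons remove_nth_def)
  qed
qed simp

lemma map_remove_nth: "map f (remove_nth i xs) = remove_nth i (map f xs)"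
  by (simp add: remove_nth_def take_map drop_map)

lemma length_remove_nth: "i < length xs \<Longrightarrow> length (remove_nth i xs) = length xs - 1"
  by (simp add: remove_nth_def)

lemma set_remove_nth: "set (remove_nth i xs) \<subseteq> set xs"
  by (auto simp: remove_nth_def dest: in_set_takeD in_set_dropD)

lemma finite_splittings: "finite (splittings g n)"
proof (rule finite_subset)
  show "splittings g n \<subseteq> {..g} \<times> Pow {..<n}" by (auto simp: splittings_def)
qed auto

text \<open>No factor is \<open>W\<^sub>0\<^sub>,\<^sub>2\<close> here; as \<open>splittings\<close>
  already excludes \<open>W\<^sub>0\<^sub>,\<^sub>1\<close>, both factors are stable.\<close>

definition stable_splittings :: "nat \<Rightarrow> nat \<Rightarrow> (nat \<times> nat set) set" where
  "stable_splittings g n = {(g1, I) \<in> splittings g n.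
     (g1, card I) \<noteq> (0, 1) \<and> (g - g1, card ({..<n} - I)) \<noteq> (0, 1)}"

text \<open>The unstable splittings attach a single point to \<open>u\<close> or to
  \<open>- u\<close>. These two families are disjoint except for \<open>(0, 2)\<close>, where the
  complement of a singleton is again a singleton.\<close>

lemma sum_splittings:
  fixes t :: "nat \<Rightarrow> nat set \<Rightarrow> complex"
  assumes "2 * g + n \<ge> 2" "(g, n) \<noteq> (0, 2)"
  shows "(\<Sum>(g1, I)\<in>splittings g n. t g1 I) = (\<Sum>(g1, I)\<in>stable_splittings g n. t g1 I) +
      (\<Sum>i<n. t 0 {i} + t g ({..<n} - {i}))"
proof -
  define A where "A = (\<lambda>i. (0 :: nat, {i})) ` {..<n}"
  define C where "C = (\<lambda>i. (g, {..<n} - {i})) ` {..<n}"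
  have card_diff: "card ({..<n} - {i}) = n - 1" if "i < n" for i using that by simp
  have not_sub: "\<not> {..<n} \<subseteq> {i}" if "2 \<le> n" for i
  proof
    assume "{..<n} \<subseteq> {i}"
    moreover have "0 \<in> {..<n}" "1 \<in> {..<n}" using that by auto
    ultimately have "0 = i" "1 = i" by blast+
    then show False by simp
  qed
  have AC: "A \<inter> C = {}"
  proof (rule ccontr)
    assume "A \<inter> C \<noteq> {}"
    then obtain i j where "i < n" "j < n" "g = 0" "{i} = {..<n} - {j}" by (auto simp: A_def C_def)
    then have "n - 1 = 1" "g = 0" using card_diff[of j] by (metis card_1_singleton_iff One_nat_def)+
    then show False using assms(2) by simp
  qed
  have sub: "A \<subseteq> splittings g n" "C \<subseteq> splittings g n"
  proof -
    show "A \<subseteq> splittings g n"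
      using assms by (auto simp: A_def splittings_def not_sub)
    show "C \<subseteq> splittings g n"
    proof
      fix p assume "p \<in> C"
      then obtain i where i: "i < n" "p = (g, {..<n} - {i})" by (auto simp: C_def)
      moreover have "{..<n} - ({..<n} - {i}) = {i}" using i by auto
      ultimately show "p \<in> splittings g n" using assms not_sub by (auto simp: splittings_def)
    qed
  qed
  have st: "stable_splittings g n = splittings g n - (A \<union> C)"
  proof
    show "stable_splittings g n \<subseteq> splittings g n - (A \<union> C)"
    proof
      fix p assume p: "p \<in> stable_splittings g n"
      moreover have "p \<notin> A" using p by (auto simp: A_def stable_splittings_def)
      moreover have "p \<notin> C"
      proof
        assume "p \<in> C"
        then obtain i where i: "i < n" "p = (g, {..<n} - {i})" by (auto simp: C_def)
        moreover have "{..<n} - ({..<n} - {i}) = {i}" using i by auto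
        ultimately show False using p by (auto simp: stable_splittings_def)
      qed
      ultimately show "p \<in> splittings g n - (A \<union> C)" by (auto simp: stable_splittings_def)
    qed
    show "splittings g n - (A \<union> C) \<subseteq> stable_splittings g n"
    proof
      fix p assume p: "p \<in> splittings g n - (A \<union> C)"
      obtain g1 I where gI: "p = (g1, I)" by (cases p)
      have I: "I \<subseteq> {..<n}" "g1 \<le> g" using p gI by (auto simp: splittings_def)
      have "(g1, card I) \<noteq> (0, 1)"
      proof
        assume "(g1, card I) = (0, 1)"
        then obtain i where "I = {i}" "g1 = 0" by (auto simp: card_1_singleton_iff)
        then show False using p gI I by (auto simp: A_def)
      qed
      moreover have "(g - g1, card ({..<n} - I)) \<noteq> (0, 1)"
      proof
        assume *: "(g - g1, card ({..<n} - I)) = (0, 1)"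
        then obtain i where i: "{..<n} - I = {i}" by (auto simp: card_1_singleton_iff)
        then have "I = {..<n} - {i}" "i < n" "g1 = g" using I * by auto
        then show False using p gI by (auto simp: C_def)
      qed
      ultimately show "p \<in> stable_splittings g n" using p gI by (simp add: stable_splittings_def)
    qed
  qed
  have "(\<Sum>p\<in>splittings g n. case_prod t p) =
      (\<Sum>p\<in>stable_splittings g n. case_prod t p) + (\<Sum>p\<in>A \<union> C. case_prod t p)"
    unfolding st using sub by (intro sum.subset_diff finite_splittings) auto
  also have "(\<Sum>p\<in>A \<union> C. case_prod t p) = (\<Sum>p\<in>A. case_prod t p) + (\<Sum>p\<in>C. case_prod t p)"
    by (rule sum.union_disjoint) (use AC in \<open>auto simp: A_def C_def\<close>)
  also have "(\<Sum>p\<in>A. case_prod t p) = (\<Sum>i<n. t 0 {i})"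
    unfolding A_def by (subst sum.reindex) (auto simp: inj_on_def)
  also have "(\<Sum>p\<in>C. case_prod t p) = (\<Sum>i<n. t g ({..<n} - {i}))"
    unfolding C_def by (subst sum.reindex) (auto simp: inj_on_def)
  finally show ?thesis by (simp add: sum.distrib)
qed

lemma W_pair: "W \<tau> \<alpha> 0 [x, y] = P2 \<tau> (x - y)"
  by (simp add: W.simps)

context upper_half
begin

lemma regular_remove_nth: "regular n zs \<Longrightarrow> i < n \<Longrightarrow> regular (n - 1) (remove_nth i zs)"
  using set_remove_nth[of i zs] by (auto simp: regular_def length_remove_nth)

lemma elliptic_alg_uminus_hd:
  assumes "F \<in> elliptic_alg (Suc n)" "regular (Suc n) (u # zs)"
  shows "F ((- u) # zs) = F (u # zs)"
proof (rule elliptic_alg_invariant[OF assms(1,2)])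
  show "regular (Suc n) ((- u) # zs)" using assms(2) by (simp add: regular_Cons)
  show "((- u) # zs) ! i - (u # zs) ! i \<in> \<Lambda> \<or> ((- u) # zs) ! i + (u # zs) ! i \<in> \<Lambda>" for i
    by (cases i) (simp_all add: lattice_0)
qed

text \<open>The terms of \<open>R2\<close> in which a point \<open>z\<^sub>i\<close> is paired with \<open>\<plusminus>u\<close> in \<open>W\<^sub>0\<^sub>,\<^sub>2\<close> are the only ones
  with poles outside \<open>H\<close>.\<close>

lemma R2_decomposition:
  assumes IH: "\<And>h m. 2 * h + m \<le> 2 * g + n \<Longrightarrow> 1 \<le> m \<Longrightarrow> 3 \<le> 2 * h + m \<Longrightarrow> W \<tau> \<alpha> h \<in> elliptic_alg m"
    and gn: "2 * g + n \<ge> 2" "(g, n) \<noteq> (0, 2)"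
  shows "\<exists>S\<in>elliptic_alg (Suc n). \<forall>u zs. u \<notin> H \<longrightarrow> regular n zs \<longrightarrow>
    R2 (W \<tau> \<alpha>) g u zs = S (u # zs) -
      (\<Sum>i<n. (P2 \<tau> (u - zs ! i) + P2 \<tau> (u + zs ! i)) * W \<tau> \<alpha> g (u # remove_nth i zs))"
proof -
  \<comment> \<open>In \<open>u # zs\<close>, position 0 holds \<open>u\<close> and position
    \<open>Suc i\<close> holds \<open>zs ! i\<close>.\<close>
  define js where "js I = 0 # map Suc (nths [0..<n] I)" for I
  \<comment> \<open>Evenness allows \<open>- u\<close> to be replaced by \<open>u\<close> in the
    second slot. For \<open>g = 1\<close> and \<open>n = 0\<close> the function is
    \<open>W\<^sub>0\<^sub>,\<^sub>2\<close>, where this replacement would hit the pole; that case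
    gives \<open>P2\<close> at \<open>2 * u\<close>.\<close>
  define S1 where "S1 xs = (if g = 0 then 0 else if g = 1 \<and> n = 0 then - 1 * P2 \<tau> (2 * xs ! 0)
      else - 1 * W \<tau> \<alpha> (g - 1) (map (nth xs) (0 # 0 # map Suc [0..<n])))" for xs
  define S2 where "S2 xs = (\<Sum>p\<in>stable_splittings g n.
      - 1 * (W \<tau> \<alpha> (fst p) (map (nth xs) (js (snd p))) *
        W \<tau> \<alpha> (g - fst p) (map (nth xs) (js ({..<n} - snd p)))))" for xs
  have S1: "S1 \<in> elliptic_alg (Suc n)"
  proof -
    consider "g = 0" | "g = 1 \<and> n = 0" | "g \<noteq> 0" "\<not> (g = 1 \<and> n = 0)" by blast
    then show ?thesis
    proof cases
      case 1
      then show ?thesis using elliptic_alg.const[of 0] by (simp add: S1_def[abs_def])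
    next
      case 2
      have "(\<lambda>xs. - 1 * P2 \<tau> (2 * xs ! 0)) \<in> elliptic_alg (Suc n)"
        by (intro elliptic_alg_cmult elliptic_alg.var[OF P2_double_even_elliptic]) simp
      then show ?thesis using 2 by (simp add: S1_def[abs_def])
    next
      case 3
      have "W \<tau> \<alpha> (g - 1) \<in> elliptic_alg (Suc (Suc n))" by (rule IH) (use 3 in auto)
      then have "(\<lambda>xs. - 1 * W \<tau> \<alpha> (g - 1) (map (nth xs) (0 # 0 # map Suc [0..<n]))) \<in> elliptic_alg (Suc n)"
        by (intro elliptic_alg_cmult elliptic_alg_reindex) auto
      then show ?thesis unfolding S1_def[abs_def] using 3 by (simp only: if_False)
    qed
  qed
  have js_set: "set (js I) \<subseteq> {..<Suc n}" for I
    using set_nths_subset[of "[0..<n]" I] by (auto simp: js_def)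
  have js_len: "length (js I) = Suc (card I)" if "I \<subseteq> {..<n}" for I
    using length_nths_subset[of I "[0..<n]"] that by (simp add: js_def)
  have js_map: "map (nth (u # zs)) (js I) = u # nths zs I" if "length zs = n" for u zs I
    using that by (simp add: js_def o_def nths_eq_map_nth[of zs I])
  have st_alg: "W \<tau> \<alpha> g1 \<in> elliptic_alg (Suc (card I))"
      "W \<tau> \<alpha> (g - g1) \<in> elliptic_alg (Suc (card ({..<n} - I)))" "I \<subseteq> {..<n}"
    if "(g1, I) \<in> stable_splittings g n" for g1 I
  proof -
    have p: "I \<subseteq> {..<n}" "g1 \<le> g" "g1 \<noteq> 0 \<or> (card I \<noteq> 0 \<and> card I \<noteq> 1)"
      "g - g1 \<noteq> 0 \<or> (card ({..<n} - I) \<noteq> 0 \<and> card ({..<n} - I) \<noteq> 1)"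
      using that by (auto simp: stable_splittings_def splittings_def)
    have c: "card I + card ({..<n} - I) = n"
      using card_Int_Diff[of "{..<n}" I] p(1) by (simp add: Int_absorb1)
    have "2 * g1 + Suc (card I) \<le> 2 * g + n" "3 \<le> 2 * g1 + Suc (card I)"
      "2 * (g - g1) + Suc (card ({..<n} - I)) \<le> 2 * g + n" "3 \<le> 2 * (g - g1) + Suc (card ({..<n} - I))"
      using p(2,3,4) c by linarith+
    then show "W \<tau> \<alpha> g1 \<in> elliptic_alg (Suc (card I))"
      "W \<tau> \<alpha> (g - g1) \<in> elliptic_alg (Suc (card ({..<n} - I)))" "I \<subseteq> {..<n}"
      by (simp_all only: IH[of g1 "Suc (card I)"] IH[of "g - g1" "Suc (card ({..<n} - I))"] p(1) Suc_le_mono le0 One_nat_def)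
  qed
  have S2: "S2 \<in> elliptic_alg (Suc n)"
    unfolding S2_def[abs_def]
  proof (intro elliptic_alg_sum)
    show "finite (stable_splittings g n)"
      by (rule finite_subset[OF _ finite_splittings[of g n]]) (auto simp: stable_splittings_def)
    fix p assume p: "p \<in> stable_splittings g n"
    obtain g1 I where gI: "p = (g1, I)" by (cases p)
    note st = st_alg[OF p[unfolded gI]]
    show "(\<lambda>xs. - 1 * (W \<tau> \<alpha> (fst p) (map (nth xs) (js (snd p))) *
        W \<tau> \<alpha> (g - fst p) (map (nth xs) (js ({..<n} - snd p))))) \<in> elliptic_alg (Suc n)"
      unfolding gI fst_conv snd_conv
      by (intro elliptic_alg_cmult elliptic_alg.mult elliptic_alg_reindex[OF st(1) js_len[OF st(3)] js_set]
          elliptic_alg_reindex[OF st(2) js_len js_set]) auto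
  qed
  show ?thesis
  proof (intro bexI[OF _ elliptic_alg.add[OF S1 S2]] allI impI)
    fix u zs assume u: "u \<notin> H" and zs: "regular n zs"
    have len: "length zs = n" using zs by (simp add: regular_def)
    define t where "t g1 I = - (W \<tau> \<alpha> g1 (u # nths zs I) * W \<tau> \<alpha> (g - g1) ((- u) # nths zs ({..<n} - I)))"
      for g1 I
    have reg: "regular (Suc (card I)) (u # nths zs I)" if "I \<subseteq> {..<n}" for I
      using regular_map_nth[OF _ js_set, of "u # zs" I] zs u js_len[OF that] js_map[OF len, of u I]
      by (simp add: regular_Cons)
    have first: "(if g = 0 then 0 else - W \<tau> \<alpha> (g - 1) (u # (- u) # zs)) = S1 (u # zs)"
    proof -
      consider "g = 0" | "g = 1 \<and> n = 0" | "g \<noteq> 0" "\<not> (g = 1 \<and> n = 0)" by blast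
      then show ?thesis
      proof cases
        case 1
        then show ?thesis by (simp add: S1_def)
      next
        case 2
        then have "zs = []" using len by simp
        moreover have "W \<tau> \<alpha> 0 [u, - u] = P2 \<tau> (2 * u)" by (simp add: W_pair)
        ultimately show ?thesis using 2 by (simp add: S1_def)
      next
        case 3
        have eq: "map (nth (u # zs)) (0 # 0 # map Suc [0..<n]) = u # u # zs"
          using map_nth[of zs] len by (simp add: o_def)
        have "W \<tau> \<alpha> (g - 1) (u # (- u) # zs) = W \<tau> \<alpha> (g - 1) (u # u # zs)"
        proof (rule elliptic_alg_invariant)
          show "W \<tau> \<alpha> (g - 1) \<in> elliptic_alg (Suc (Suc n))" by (rule IH) (use 3 in auto)
          show "(u # (- u) # zs) ! i - (u # u # zs) ! i \<in> \<Lambda> \<or> (u # (- u) # zs) ! i + (u # u # zs) ! i \<in> \<Lambda>" for i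
            by (cases i; cases "i - 1") (auto simp: lattice_0 nth_Cons')
        qed (use u zs in \<open>simp_all add: regular_Cons\<close>)
        then show ?thesis using 3 unfolding S1_def eq by (simp only: if_False) simp
      qed
    qed
    have second: "(\<Sum>(g1, I)\<in>stable_splittings g n. t g1 I) = S2 (u # zs)"
      unfolding S2_def
    proof (intro sum.cong refl)
      fix p assume p: "p \<in> stable_splittings g n"
      obtain g1 I where gI: "p = (g1, I)" by (cases p)
      note st = st_alg[OF p[unfolded gI]]
      have "W \<tau> \<alpha> (g - g1) ((- u) # nths zs ({..<n} - I)) = W \<tau> \<alpha> (g - g1) (u # nths zs ({..<n} - I))"
        by (rule elliptic_alg_uminus_hd[OF st(2) reg]) auto
      then show "(case p of (g1, I) \<Rightarrow> t g1 I) = - 1 * (W \<tau> \<alpha> (fst p) (map (nth (u # zs)) (js (snd p))) *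
        W \<tau> \<alpha> (g - fst p) (map (nth (u # zs)) (js ({..<n} - snd p))))"
        unfolding js_map[OF len] gI by (simp add: t_def)
    qed
    \<comment> \<open>The point paired with \<open>- u\<close> gives
      \<open>P2 \<tau> (- u - zs ! i)\<close>, which is \<open>P2 \<tau> (u + zs ! i)\<close>; the
      remaining factor is the same in both terms by evenness.\<close>
    have third: "t 0 {i} + t g ({..<n} - {i}) =
        - ((P2 \<tau> (u - zs ! i) + P2 \<tau> (u + zs ! i)) * W \<tau> \<alpha> g (u # remove_nth i zs))" if i: "i < n" for i
    proof -
      have n: "n = Suc (n - 1)" using i by simp
      have alg: "W \<tau> \<alpha> g \<in> elliptic_alg (Suc (n - 1))"
        using IH[of g n] gn i n by (cases g) auto
      have ev: "W \<tau> \<alpha> g ((- u) # remove_nth i zs) = W \<tau> \<alpha> g (u # remove_nth i zs)"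
        by (rule elliptic_alg_uminus_hd[OF alg]) (use u regular_remove_nth[OF zs i] in \<open>simp add: regular_Cons\<close>)
      have "{..<n} - ({..<n} - {i}) = {i}" using i by auto
      moreover have "- u - zs ! i = - (u + zs ! i)" by simp
      ultimately show ?thesis
        using i len nths_remove_nth[of i zs] nths_singleton_nth[of i zs] ev P2_minus[of "u + zs ! i"]
        by (simp add: t_def W_pair algebra_simps)
    qed
    have "R2 (W \<tau> \<alpha>) g u zs = (if g = 0 then 0 else - W \<tau> \<alpha> (g - 1) (u # (- u) # zs)) +
        (\<Sum>(g1, I)\<in>splittings g n. t g1 I)"
      by (simp only: R2_def len t_def)
    also have "\<dots> = S1 (u # zs) + (S2 (u # zs) + (\<Sum>i<n. t 0 {i} + t g ({..<n} - {i})))"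
      unfolding first sum_splittings[OF gn] second ..
    also have "(\<Sum>i<n. t 0 {i} + t g ({..<n} - {i})) =
        - (\<Sum>i<n. (P2 \<tau> (u - zs ! i) + P2 \<tau> (u + zs ! i)) * W \<tau> \<alpha> g (u # remove_nth i zs))"
      unfolding sum_negf[symmetric] by (intro sum.cong refl third) simp
    finally show "R2 (W \<tau> \<alpha>) g u zs = (S1 (u # zs) + S2 (u # zs)) -
      (\<Sum>i<n. (P2 \<tau> (u - zs ! i) + P2 \<tau> (u + zs ! i)) * W \<tau> \<alpha> g (u # remove_nth i zs))" by simp
  qed
qed

lemma splittings_0_2: "splittings 0 2 = {(0, {0}), (0, {1})}"
proof (intro equalityI subsetI)
  have two: "{..<2} = {0, 1 :: nat}" by auto
  fix p assume p: "p \<in> splittings 0 2"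
  obtain I where I: "p = (0, I)" using p by (cases p) (simp add: splittings_def)
  have sub: "I \<subseteq> {0, 1}" and ne: "card I \<noteq> 0" "card ({0, 1} - I) \<noteq> 0"
    using p unfolding I splittings_def two by simp_all
  have "I \<noteq> {}" "I \<noteq> {0, 1}" using ne by auto
  moreover have "I = {} \<or> I = {0} \<or> I = {1} \<or> I = {0, 1}" using sub by blast
  ultimately show "p \<in> {(0, {0}), (0, {1})}" using I by blast
next
  have two: "{..<2} - {0} = {1 :: nat}" "{..<2} - {1} = {0 :: nat}" by auto
  fix p :: "nat \<times> nat set" assume "p \<in> {(0, {0}), (0, {1})}"
  then consider "p = (0, {0})" | "p = (0, {1})" by blast
  then show "p \<in> splittings 0 2"
    by cases (simp_all only: splittings_def mem_Collect_eq prod.case two, simp_all)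
qed

text \<open>The case that the decomposition leaves out: in either splitting both factors are
  \<open>W\<^sub>0\<^sub>,\<^sub>2\<close>.\<close>

lemma R2_0_2:
  "R2 (W \<tau> \<alpha>) 0 u [x, y] = - (P2 \<tau> (u - x) * P2 \<tau> (u + y) + P2 \<tau> (u - y) * P2 \<tau> (u + x))"
proof -
  have spl: "splittings 0 (length [x, y]) = {(0, {0}), (0, {1})}"
    using splittings_0_2 by (simp add: numeral_2_eq_2)
  have compl: "{..<length [x, y]} - {0} = {1}" "{..<length [x, y]} - {1} = {0}" by auto
  have nths: "nths [x, y] {0} = [x]" "nths [x, y] {1} = [y]"
    using nths_singleton_nth[of 0 "[x, y]"] nths_singleton_nth[of 1 "[x, y]"] by auto
  have P2: "P2 \<tau> (- u - y) = P2 \<tau> (u + y)" "P2 \<tau> (- u - x) = P2 \<tau> (u + x)"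
    using P2_minus[of "u + y"] P2_minus[of "u + x"] by simp_all
  define t where "t = (\<lambda>(g1 :: nat, I). - (W \<tau> \<alpha> g1 (u # nths [x, y] I) *
      W \<tau> \<alpha> (0 - g1) ((- u) # nths [x, y] ({..<length [x, y]} - I))))"
  have "R2 (W \<tau> \<alpha>) 0 u [x, y] = sum t {(0, {0}), (0, {1})}"
    unfolding R2_def spl t_def by (simp only: simp_thms if_True add_0)
  also have "\<dots> = t (0, {0}) + t (0, {1})" by simp
  also have "t (0, {0}) = - (P2 \<tau> (u - x) * P2 \<tau> (u + y))"
    unfolding t_def prod.case compl nths diff_0_eq_0 W_pair P2 ..
  also have "t (0, {1}) = - (P2 \<tau> (u - y) * P2 \<tau> (u + x))"
    unfolding t_def prod.case compl nths diff_0_eq_0 W_pair P2 ..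
  finally show ?thesis by simp
qed

section \<open>Reflection of the integrand about the half periods\<close>

lemma even_elliptic_reflect:
  assumes "\<phi> \<in> \<E>" "a \<in> H" "u \<notin> H"
  shows "\<phi> (2 * a - u) = \<phi> u"
proof -
  have "2 * a \<in> \<Lambda>" using assms(2) by (simp add: half_lattice_def)
  moreover have "- u \<notin> H" using assms(3) by simp
  ultimately have "\<phi> (- u + 2 * a) = \<phi> (- u)" by (rule even_elliptic_plus[OF assms(1)])
  also have "\<phi> (- u) = \<phi> u" by (rule even_elliptic_minus[OF assms(1,3)])
  also have "- u + 2 * a = 2 * a - u" by simp
  finally show ?thesis .
qed

lemma P2_reflect:
  assumes "a \<in> H" "u - x \<notin> \<Lambda>" "u + x \<notin> \<Lambda>"
  shows "P2 \<tau> (2 * a - u - x) = P2 \<tau> (u + x)" "P2 \<tau> (2 * a - u + x) = P2 \<tau> (u - x)"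
proof -
  have a: "2 * a \<in> \<Lambda>" using assms(1) by (simp add: half_lattice_def)
  have *: "P2 \<tau> (- v + 2 * a) = P2 \<tau> v" if "v \<notin> \<Lambda>" for v
    using P2_plus_lattice[of "- v" "2 * a"] that a P2_minus[of v] by (simp only: lattice_uminus_iff not_False_eq_True)
  have "2 * a - u - x = - (u + x) + 2 * a" "2 * a - u + x = - (u - x) + 2 * a" by simp_all
  then show "P2 \<tau> (2 * a - u - x) = P2 \<tau> (u + x)" "P2 \<tau> (2 * a - u + x) = P2 \<tau> (u - x)"
    using *[OF assms(3)] *[OF assms(2)] by metis+
qed

lemma eventually_shift_notin_lattice: "\<forall>\<^sub>F u in at a. u - x \<notin> \<Lambda> \<and> u + x \<notin> \<Lambda>"
proof (rule eventually_conj)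
  show "\<forall>\<^sub>F u in at a. u - x \<notin> \<Lambda>" "\<forall>\<^sub>F u in at a. u + x \<notin> \<Lambda>"
    using eventually_not_lattice[of "a + - x", unfolded eventually_at_shift]
      eventually_not_lattice[of "a + x", unfolded eventually_at_shift] by simp_all
qed

text \<open>\<open>P1 \<tau> (x - u)\<close> is half of
  \<open>A u = P1 \<tau> (x - u) + P1 \<tau> (x + u)\<close> plus half of the corresponding
  difference. Under \<open>u \<mapsto> 2 * a - u\<close> the constants gained by the two terms of
  \<open>A\<close> cancel, so \<open>C - A u / 2\<close> times \<open>q\<close> is symmetric about
  \<open>a\<close> and has no residue. This removes the base point, which sits in
  \<open>C\<close>.\<close>

lemma residue_P1_reflect:
  assumes a: "a \<in> H" and q: "q meromorphic_on {a}" "\<forall>\<^sub>F u in at a. q (2 * a - u) = q u"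
  shows "residue (\<lambda>u. (C - P1 \<tau> (x - u)) * q u) a =
    - 1 / 2 * residue (\<lambda>u. (P1 \<tau> (x - u) - P1 \<tau> (x + u)) * q u) a"
proof -
  define A where "A u = P1 \<tau> (x - u) + P1 \<tau> (x + u)" for u
  obtain c where c: "\<And>z. z \<notin> \<Lambda> \<Longrightarrow> P1 \<tau> (z + 2 * a) = P1 \<tau> z + c"
    using a P1_plus_lattice[of "2 * a"] by (auto simp: half_lattice_def)
  have c': "P1 \<tau> (z - 2 * a) = P1 \<tau> z - c" if "z \<notin> \<Lambda>" for z
    using c[of "z - 2 * a"] that a lattice_add_iff[of "2 * a" \<tau> "z - 2 * a"] by (simp add: half_lattice_def)
  have mero: "(\<lambda>u. P1 \<tau> (x - u)) meromorphic_on {a}" "(\<lambda>u. P1 \<tau> (x + u)) meromorphic_on {a}"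
    by (rule meromorphic_on_compose[OF P1_meromorphic]; auto intro!: analytic_intros)+
  have "\<forall>\<^sub>F u in at a. A (2 * a - u) = A u"
    using eventually_shift_notin_lattice[where a = a and x = x]
  proof eventually_elim
    case (elim u)
    have 1: "x + u \<notin> \<Lambda>" "x - u \<notin> \<Lambda>"
      using elim lattice_uminus_iff[of "u - x" \<tau>] by (simp_all add: add.commute)
    have eq: "x - (2 * a - u) = (x + u) - 2 * a" "x + (2 * a - u) = (x - u) + 2 * a" by simp_all
    show ?case unfolding A_def eq using c'[OF 1(1)] c[OF 1(2)] by simp
  qed
  with q(2) have "\<forall>\<^sub>F u in at a. (C - 1 / 2 * A (2 * a - u)) * q (2 * a - u) = (C - 1 / 2 * A u) * q u"
    by eventually_elim simp
  moreover have m: "(\<lambda>u. (C - 1 / 2 * A u) * q u) meromorphic_on {a}"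
    unfolding A_def by (intro meromorphic_intros mero q)
  ultimately have z: "residue (\<lambda>u. (C - 1 / 2 * A u) * q u) a = 0"
    by (intro residue_reflection_symmetric)
  have mK: "(\<lambda>u. (P1 \<tau> (x - u) - P1 \<tau> (x + u)) * q u) meromorphic_on {a}"
    by (intro meromorphic_intros mero q)
  have eq: "(\<lambda>u. (C - P1 \<tau> (x - u)) * q u) =
      (\<lambda>u. (C - 1 / 2 * A u) * q u + (- 1 / 2) * ((P1 \<tau> (x - u) - P1 \<tau> (x + u)) * q u))"
    by (auto simp: A_def field_simps)
  show ?thesis
    unfolding eq residue_add_at[OF m meromorphic_on_mult[OF meromorphic_on_const mK]]
      z residue_cmult_at[OF mK] by simp
qed

abbreviation "c0 \<equiv> \<lambda>z. 1 / (2 * (wp' \<tau> z)\<^sup>2)"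

definition recursion_integrand :: "complex \<Rightarrow> nat \<Rightarrow> complex list \<Rightarrow> complex \<Rightarrow> complex" where
  "recursion_integrand \<alpha> g zs u = R2 (W \<tau> \<alpha>) g u zs / (2 * (wp' \<tau> u)\<^sup>2)"

lemma W_eq_residues:
  assumes "2 * g + length zs \<ge> 2"
  shows "W \<tau> \<alpha> g (z0 # zs) = (\<Sum>a\<in>ram_points \<tau>.
    residue (\<lambda>u. (P1 \<tau> (z0 - \<alpha>) - P1 \<tau> (z0 - u)) * recursion_integrand \<alpha> g zs u) a)"
proof -
  have ne: "\<not> (g = 0 \<and> length zs = 0)" "\<not> (g = 0 \<and> length zs = 1)" using assms by auto
  have "(P1 \<tau> (z0 - \<alpha>) - P1 \<tau> (z0 - u)) / (2 * (wp' \<tau> u)\<^sup>2) * R2 (W \<tau> \<alpha>) g u zs =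
      (P1 \<tau> (z0 - \<alpha>) - P1 \<tau> (z0 - u)) * recursion_integrand \<alpha> g zs u" for u
    by (simp add: recursion_integrand_def)
  then show ?thesis unfolding W.simps(2)[of \<tau> \<alpha> g z0 zs] using ne by (simp only: if_False)
qed

lemma P2_shift_meromorphic: "(\<lambda>u. P2 \<tau> (u - x)) meromorphic_on A" "(\<lambda>u. P2 \<tau> (u + x)) meromorphic_on A"
proof -
  have "(\<lambda>u. u + c) analytic_on A" for c by (intro analytic_intros)
  then have "(\<lambda>u. P2 \<tau> (u + c)) meromorphic_on A" for c
    by (rule meromorphic_on_compose[OF P2_meromorphic]) simp
  from this[of "- x"] this[of x] show "(\<lambda>u. P2 \<tau> (u - x)) meromorphic_on A"
    "(\<lambda>u. P2 \<tau> (u + x)) meromorphic_on A" by simp_all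
qed

lemma recursion_integrand_0_2:
  "recursion_integrand \<alpha> 0 [x, y] =
    (\<lambda>u. - (c0 u * (P2 \<tau> (u - x) * P2 \<tau> (u + y))) - c0 u * (P2 \<tau> (u - y) * P2 \<tau> (u + x)))"
proof (rule ext)
  fix u
  have "- (a * b + c * d) / w = - (1 / w * (a * b)) - 1 / w * (c * d)" for a b c d w :: complex
    by (simp add: diff_divide_distrib)
  then show "recursion_integrand \<alpha> 0 [x, y] u =
    - (c0 u * (P2 \<tau> (u - x) * P2 \<tau> (u + y))) - c0 u * (P2 \<tau> (u - y) * P2 \<tau> (u + x))"
    unfolding recursion_integrand_def R2_0_2 .
qed

lemma recursion_integrand_0_2_reflect:
  assumes "a \<in> H"
  shows "recursion_integrand \<alpha> 0 [x, y] meromorphic_on {a}"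
    and "\<forall>\<^sub>F u in at a. recursion_integrand \<alpha> 0 [x, y] (2 * a - u) = recursion_integrand \<alpha> 0 [x, y] u"
proof -
  show "recursion_integrand \<alpha> 0 [x, y] meromorphic_on {a}"
    unfolding recursion_integrand_0_2
    by (intro meromorphic_on_diff meromorphic_on_uminus meromorphic_on_mult P2_shift_meromorphic
        even_elliptic_meromorphic[OF inverse_wp'_square_even_elliptic])
  show "\<forall>\<^sub>F u in at a. recursion_integrand \<alpha> 0 [x, y] (2 * a - u) = recursion_integrand \<alpha> 0 [x, y] u"
    using eventually_not_half_lattice eventually_shift_notin_lattice[where a = a and x = x] eventually_shift_notin_lattice[where a = a and x = y]
    by eventually_elim
       (simp only: recursion_integrand_0_2 P2_reflect[OF assms]
         even_elliptic_reflect[OF inverse_wp'_square_even_elliptic assms] not_False_eq_True, simp add: mult_ac)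
qed

lemma recursion_integrand_decomposition:
  assumes IH: "\<And>h m. 2 * h + m \<le> 2 * g + n \<Longrightarrow> 1 \<le> m \<Longrightarrow> 3 \<le> 2 * h + m \<Longrightarrow> W \<tau> \<alpha> h \<in> elliptic_alg m"
    and gn: "2 * g + n \<ge> 2" "(g, n) \<noteq> (0, 2)"
  shows "\<exists>S\<in>elliptic_alg (Suc n). \<forall>u zs. u \<notin> H \<longrightarrow> regular n zs \<longrightarrow>
    recursion_integrand \<alpha> g zs u = c0 u * S (u # zs) -
      (\<Sum>i<n. (P2 \<tau> (u - zs ! i) + P2 \<tau> (u + zs ! i)) * (c0 u * W \<tau> \<alpha> g (u # remove_nth i zs)))"
proof -
  obtain S where S: "S \<in> elliptic_alg (Suc n)" "\<And>u zs. u \<notin> H \<Longrightarrow> regular n zs \<Longrightarrow>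
    R2 (W \<tau> \<alpha>) g u zs = S (u # zs) -
      (\<Sum>i<n. (P2 \<tau> (u - zs ! i) + P2 \<tau> (u + zs ! i)) * W \<tau> \<alpha> g (u # remove_nth i zs))"
    using R2_decomposition[OF IH gn] by blast
  show ?thesis
  proof (intro bexI[OF _ S(1)] allI impI)
    fix u zs assume uz: "u \<notin> H" "regular n zs"
    have "recursion_integrand \<alpha> g zs u = c0 u * R2 (W \<tau> \<alpha>) g u zs"
      by (simp add: recursion_integrand_def)
    then show "recursion_integrand \<alpha> g zs u = c0 u * S (u # zs) -
      (\<Sum>i<n. (P2 \<tau> (u - zs ! i) + P2 \<tau> (u + zs ! i)) * (c0 u * W \<tau> \<alpha> g (u # remove_nth i zs)))"
      unfolding S(2)[OF uz] right_diff_distrib sum_distrib_left by (simp add: mult_ac)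
  qed
qed

lemma c0_W_even_elliptic:
  assumes IH: "\<And>h m. 2 * h + m \<le> 2 * g + n \<Longrightarrow> 1 \<le> m \<Longrightarrow> 3 \<le> 2 * h + m \<Longrightarrow> W \<tau> \<alpha> h \<in> elliptic_alg m"
    and gn: "2 * g + n \<ge> 2" "(g, n) \<noteq> (0, 2)" and zs: "regular n zs" and i: "i < n"
  shows "(\<lambda>u. c0 u * W \<tau> \<alpha> g (u # remove_nth i zs)) \<in> \<E>"
proof -
  have "W \<tau> \<alpha> g \<in> elliptic_alg (Suc (n - 1))" using IH[of g n] gn i by (cases g) auto
  then show ?thesis
    by (intro even_elliptic_mult inverse_wp'_square_even_elliptic
        elliptic_alg_even_elliptic[OF _ regular_remove_nth[OF zs i]])
qed

text \<open>Evenness and periodicity combine to symmetry about every half period; the reflection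
  exchanges the two \<open>P2\<close> terms belonging to one point.\<close>

lemma recursion_integrand_reflect:
  assumes IH: "\<And>h m. 2 * h + m \<le> 2 * g + n \<Longrightarrow> 1 \<le> m \<Longrightarrow> 3 \<le> 2 * h + m \<Longrightarrow> W \<tau> \<alpha> h \<in> elliptic_alg m"
    and gn: "2 * g + n \<ge> 2" and zs: "regular n zs" and a: "a \<in> H"
  shows "recursion_integrand \<alpha> g zs meromorphic_on {a}"
    and "\<forall>\<^sub>F u in at a. recursion_integrand \<alpha> g zs (2 * a - u) = recursion_integrand \<alpha> g zs u"
proof -
  have "recursion_integrand \<alpha> g zs meromorphic_on {a} \<and>
    (\<forall>\<^sub>F u in at a. recursion_integrand \<alpha> g zs (2 * a - u) = recursion_integrand \<alpha> g zs u)"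
  proof (cases "(g, n) = (0, 2)")
    case True
    then obtain x y where "zs = [x, y]" using zs
      by (auto simp: regular_def numeral_2_eq_2 length_Suc_conv)
    then show ?thesis using True recursion_integrand_0_2_reflect[OF a] by simp
  next
    case False
    obtain S where S: "S \<in> elliptic_alg (Suc n)"
      "\<And>u zs. u \<notin> H \<Longrightarrow> regular n zs \<Longrightarrow> recursion_integrand \<alpha> g zs u = c0 u * S (u # zs) -
      (\<Sum>i<n. (P2 \<tau> (u - zs ! i) + P2 \<tau> (u + zs ! i)) * (c0 u * W \<tau> \<alpha> g (u # remove_nth i zs)))"
      using recursion_integrand_decomposition[OF IH gn False] by blast
    define V where "V i u = c0 u * W \<tau> \<alpha> g (u # remove_nth i zs)" for i u
    define q where "q u = c0 u * S (u # zs) - (\<Sum>i<n. (P2 \<tau> (u - zs ! i) + P2 \<tau> (u + zs ! i)) * V i u)" for u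
    have V: "V i \<in> \<E>" if "i < n" for i
      unfolding V_def[abs_def] using c0_W_even_elliptic[OF IH gn False zs that] by simp
    have S0: "(\<lambda>u. c0 u * S (u # zs)) \<in> \<E>"
      by (intro even_elliptic_mult inverse_wp'_square_even_elliptic elliptic_alg_even_elliptic[OF S(1) zs])
    have Sq: "recursion_integrand \<alpha> g zs u = q u" if "u \<notin> H" for u
      using S(2)[OF that zs] by (simp add: q_def V_def)
    have qm: "q meromorphic_on {a}"
      unfolding q_def
      by (intro meromorphic_on_diff[OF even_elliptic_meromorphic[OF S0]] meromorphic_on_sum meromorphic_on_mult
          meromorphic_on_add P2_shift_meromorphic) (use V in \<open>auto intro: even_elliptic_meromorphic\<close>)
    have ev: "\<forall>\<^sub>F u in at a. q u = recursion_integrand \<alpha> g zs u"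
      by (rule eventually_mono[OF eventually_not_half_lattice]) (simp add: Sq)
    have m: "recursion_integrand \<alpha> g zs meromorphic_on {a}"
      using meromorphic_on_cong[of "{a}" q "recursion_integrand \<alpha> g zs" "{a}"] ev qm by simp
    have "\<forall>\<^sub>F u in at a. \<forall>i\<in>{..<n}. u - zs ! i \<notin> \<Lambda> \<and> u + zs ! i \<notin> \<Lambda>"
      by (intro eventually_ball_finite ballI eventually_shift_notin_lattice) simp
    with eventually_not_half_lattice[of a]
    have "\<forall>\<^sub>F u in at a. recursion_integrand \<alpha> g zs (2 * a - u) = recursion_integrand \<alpha> g zs u"
    proof eventually_elim
      case (elim u)
      have u': "2 * a - u \<notin> H" using elim a half_lattice_add_iff[of a a] by simp
      have "q (2 * a - u) = q u"
        unfolding q_def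
      proof (intro arg_cong2[of _ _ _ _ "(-)"] sum.cong refl)
        show "c0 (2 * a - u) * S ((2 * a - u) # zs) = c0 u * S (u # zs)"
          using even_elliptic_reflect[OF S0 a elim(1)] .
        fix i assume "i \<in> {..<n}"
        then show "(P2 \<tau> (2 * a - u - zs ! i) + P2 \<tau> (2 * a - u + zs ! i)) * V i (2 * a - u) =
            (P2 \<tau> (u - zs ! i) + P2 \<tau> (u + zs ! i)) * V i u"
          using elim even_elliptic_reflect[OF V a elim(1), of i] P2_reflect[OF a, of u "zs ! i"]
          by (simp add: add.commute)
      qed
      then show ?case using Sq[OF elim(1)] Sq[OF u'] by simp
    qed
    with m show ?thesis by simp
  qed
  then show "recursion_integrand \<alpha> g zs meromorphic_on {a}"
    "\<forall>\<^sub>F u in at a. recursion_integrand \<alpha> g zs (2 * a - u) = recursion_integrand \<alpha> g zs u" by auto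
qed

text \<open>Writing \<open>S\<^sub>x = P2(u - x) + P2(u + x)\<close> and \<open>D\<^sub>x = P2(u - x) - P2(u + x)\<close>, the integrand of
  \<open>W\<^sub>0\<^sub>,\<^sub>3\<close> is a multiple of \<open>S\<^sub>x S\<^sub>y - D\<^sub>x D\<^sub>y\<close> over \<open>wp'\<^sup>2\<close>. As \<open>D\<^sub>x\<close> and \<open>D\<^sub>y\<close> vanish on \<open>H\<close>, the second
  part is regular there.\<close>

lemma residue_antisymmetric_part:
  assumes a: "a \<in> H" and x: "x \<notin> H" "y \<notin> H" and M: "M analytic_on {a}"
  shows "residue (\<lambda>u. M u * (c0 u * ((P2 \<tau> (u - x) - P2 \<tau> (u + x)) * (P2 \<tau> (u - y) - P2 \<tau> (u + y))))) a = 0"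
proof -
  have D: "\<exists>d. d analytic_on {a} \<and> (\<forall>\<^sub>F u in at a. P2 \<tau> (u - x) - P2 \<tau> (u + x) = (u - a) * d u)"
    if x: "x \<notin> H" for x
  proof -
    note n = half_lattice_not_lattice_shift[OF x a]
    have "(\<lambda>u. P2 \<tau> (u + x)) analytic_on {a}"
      using P2_shift_analytic[of a "- x"] n(2) by (simp add: add.commute)
    then have an: "(\<lambda>u. P2 \<tau> (u - x) - P2 \<tau> (u + x)) analytic_on {a}"
      by (intro analytic_on_diff P2_shift_analytic n)
    have "P2 \<tau> (a + x) = P2 \<tau> ((x - a) + 2 * a)" by (simp add: add.commute)
    also have "\<dots> = P2 \<tau> (x - a)" using n a by (intro P2_plus_lattice) (auto simp: half_lattice_def)
    also have "\<dots> = P2 \<tau> (a - x)" using P2_minus[of "a - x"] by simp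
    finally have "P2 \<tau> (a - x) - P2 \<tau> (a + x) = 0" by simp
    from analytic_factor[OF an this] obtain d where
      "d analytic_on {a}" "\<forall>\<^sub>F u in nhds a. P2 \<tau> (u - x) - P2 \<tau> (u + x) = (u - a) * d u" by metis
    then show ?thesis by (auto simp: eventually_nhds_conv_at)
  qed
  obtain d where d: "d analytic_on {a}" "\<forall>\<^sub>F u in at a. P2 \<tau> (u - x) - P2 \<tau> (u + x) = (u - a) * d u"
    using D[OF x(1)] by blast
  obtain e where e: "e analytic_on {a}" "\<forall>\<^sub>F u in at a. P2 \<tau> (u - y) - P2 \<tau> (u + y) = (u - a) * e u"
    using D[OF x(2)] by blast
  obtain k where k: "k analytic_on {a}" "\<forall>\<^sub>F u in at a. 1 / wp' \<tau> u = k u / (u - a)"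
    using inverse_wp'_simple_pole by blast
  \<comment> \<open>The pole of \<open>c0\<close> at \<open>a\<close> is at most double, so the two
    zeros cancel it.\<close>
  have "(\<lambda>u. M u * (1 / 2 * (k u)\<^sup>2 * (d u * e u))) analytic_on {a}"
    by (intro analytic_intros M d e k)
  moreover have "\<forall>\<^sub>F u in at a. M u * (c0 u * ((P2 \<tau> (u - x) - P2 \<tau> (u + x)) * (P2 \<tau> (u - y) - P2 \<tau> (u + y)))) =
      M u * (1 / 2 * (k u)\<^sup>2 * (d u * e u))"
    using d(2) e(2) k(2) eventually_neq_at_within[of a]
  proof eventually_elim
    case (elim u)
    have "c0 u = 1 / 2 * (1 / wp' \<tau> u)\<^sup>2" by (simp add: power_divide)
    then have c: "c0 u = 1 / 2 * (k u / (u - a))\<^sup>2" by (simp only: elim)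
    have "m * (1 / 2 * (k / v)\<^sup>2 * ((v * d) * (v * e))) = m * (1 / 2 * k\<^sup>2 * (d * e))"
      if "v \<noteq> 0" for m k v d e :: complex
      using that by (simp add: field_simps power2_eq_square)
    from this[of "u - a"] show ?case unfolding elim(1,2) c using elim(4) by simp
  qed
  ultimately show ?thesis by (rule residue_analytic_eq_0)
qed

text \<open>The induction hypothesis gives the reflection symmetry of the integrand, which replaces
  the recursion kernel by \<open>K\<close>, free of \<alpha>. What is left are residues of kernels
  times elements of the algebra.\<close>

theorem W_elliptic_alg:
  assumes "1 \<le> m" "3 \<le> 2 * g + m"
  shows "W \<tau> \<alpha> g \<in> elliptic_alg m"
  using assms
proof (induction "2 * g + m" arbitrary: g m rule: less_induct)
  case (less g m)
  obtain n where m: "m = Suc n" using less.prems by (cases m) auto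
  have gn: "2 * g + n \<ge> 2" using less.prems m by simp
  have IH: "W \<tau> \<alpha> h \<in> elliptic_alg k" if "2 * h + k \<le> 2 * g + n" "1 \<le> k" "3 \<le> 2 * h + k" for h k
    using less.hyps that m by simp
  define K where "K xs u = P1 \<tau> (xs ! 0 - u) - P1 \<tau> (xs ! 0 + u)" for xs u
  have K: "K \<in> kernels a m" if "a \<in> H" for a
    unfolding K_def[abs_def] using that m by (intro kernels_P1) auto
  have K_an: "K xs analytic_on {a}" if "a \<in> H" "regular m xs" for a xs
    using K[OF that(1)] that(2) by (auto simp: kernels_def)
  have W_eq: "W \<tau> \<alpha> g xs =
      (\<Sum>a\<in>ram_points \<tau>. - 1 / 2 * residue (\<lambda>u. K xs u * recursion_integrand \<alpha> g (tl xs) u) a)"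
    if xs: "regular m xs" for xs
  proof -
    obtain z0 zs where z: "xs = z0 # zs" using xs m by (cases xs) (auto simp: regular_def)
    have zs: "regular n zs" using xs m z by (simp add: regular_Cons)
    have "2 * g + length zs \<ge> 2" using zs gn by (simp add: regular_def)
    then have "W \<tau> \<alpha> g xs = (\<Sum>a\<in>ram_points \<tau>.
        residue (\<lambda>u. (P1 \<tau> (z0 - \<alpha>) - P1 \<tau> (z0 - u)) * recursion_integrand \<alpha> g zs u) a)"
      unfolding z by (rule W_eq_residues)
    also have "\<dots> = (\<Sum>a\<in>ram_points \<tau>. - 1 / 2 * residue (\<lambda>u. K xs u * recursion_integrand \<alpha> g (tl xs) u) a)"
      unfolding K_def z list.sel nth_Cons_0
      by (intro sum.cong refl residue_P1_reflect recursion_integrand_reflect[OF IH gn zs] ram_points_half_lattice)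
    finally show ?thesis .
  qed
  have "(\<lambda>xs. residue (\<lambda>u. K xs u * recursion_integrand \<alpha> g (tl xs) u) a) \<in> elliptic_alg m"
    if "a \<in> ram_points \<tau>" for a
  proof -
    have a: "a \<in> H" using that by (rule ram_points_half_lattice)
    show ?thesis
    proof (cases "(g, n) = (0, 2)")
      case True
      \<comment> \<open>With \<open>p\<close>, \<open>q\<close> the \<open>P2\<close> terms at
        \<open>u - x\<close>, \<open>u + x\<close> and \<open>r\<close>, \<open>s\<close> those at
        \<open>u - y\<close>, \<open>u + y\<close>, twice \<open>p * s + q * r\<close> is
        \<open>(p + q) * (r + s) - (p - q) * (r - s)\<close>. The first product is a kernel; the
        second one has no residue.\<close>
      let ?M = "\<lambda>xs u. K xs u * ((P2 \<tau> (u - xs ! 1) + P2 \<tau> (u + xs ! 1)) * (P2 \<tau> (u - xs ! 2) + P2 \<tau> (u + xs ! 2)))"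
      have M: "?M \<in> kernels a m"
        using a m True by (intro kernels_mult K kernels_P2) auto
      have "(\<lambda>xs. - 1 / 2 * residue (\<lambda>u. ?M xs u * c0 u) a) \<in> elliptic_alg m"
        by (intro elliptic_alg_cmult kernels_residue[OF M inverse_wp'_square_even_elliptic])
      then show ?thesis
      proof (rule elliptic_alg.regular_cong)
        fix xs assume xs: "regular m xs"
        have "length xs = 3" using xs m True by (simp add: regular_def)
        then obtain z0 x y where z: "xs = [z0, x, y]"
          by (auto simp: numeral_3_eq_3 length_Suc_conv)
        have xy: "x \<notin> H" "y \<notin> H" using xs z by (auto simp: regular_def)
        let ?D = "\<lambda>u. K xs u * (c0 u * ((P2 \<tau> (u - x) - P2 \<tau> (u + x)) * (P2 \<tau> (u - y) - P2 \<tau> (u + y))))"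
        have "K xs u * recursion_integrand \<alpha> g (tl xs) u =
            (- 1 / 2) * (?M xs u * c0 u) + (1 / 2) * ?D u" for u
        proof -
          have id: "k * (- (c * (p * s)) - c * (r * q)) =
              (- 1 / 2) * (k * ((p + q) * (r + s)) * c) + (1 / 2) * (k * (c * ((p - q) * (r - s))))"
            for k c p q r s :: complex by (simp add: field_simps)
          have "recursion_integrand \<alpha> g (tl xs) u =
              - (c0 u * (P2 \<tau> (u - x) * P2 \<tau> (u + y))) - c0 u * (P2 \<tau> (u - y) * P2 \<tau> (u + x))"
            using z True recursion_integrand_0_2[of \<alpha> x y] by simp
          moreover have "xs ! 1 = x" "xs ! 2 = y" using z by simp_all
          ultimately show ?thesis by (simp only: id)
        qed
        moreover have m1: "(\<lambda>u. ?M xs u * c0 u) meromorphic_on {a}" "?D meromorphic_on {a}"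
          by (intro meromorphic_on_mult meromorphic_on_add meromorphic_on_diff P2_shift_meromorphic
              analytic_on_imp_meromorphic_on[OF K_an[OF a xs]]
              even_elliptic_meromorphic[OF inverse_wp'_square_even_elliptic])+
        ultimately show "residue (\<lambda>u. K xs u * recursion_integrand \<alpha> g (tl xs) u) a =
            - 1 / 2 * residue (\<lambda>u. ?M xs u * c0 u) a"
          using residue_antisymmetric_part[OF a xy K_an[OF a xs]]
            residue_add_at[OF meromorphic_on_mult[OF meromorphic_on_const m1(1)]
              meromorphic_on_mult[OF meromorphic_on_const m1(2)], of "- 1 / 2" "1 / 2"]
            residue_cmult_at[OF m1(1), of "- 1 / 2"] residue_cmult_at[OF m1(2), of "1 / 2"]
          by simp
      qed
    next
      case False
      obtain S where S: "S \<in> elliptic_alg (Suc n)"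
        "\<And>u zs. u \<notin> H \<Longrightarrow> regular n zs \<Longrightarrow> recursion_integrand \<alpha> g zs u = c0 u * S (u # zs) -
        (\<Sum>i<n. (P2 \<tau> (u - zs ! i) + P2 \<tau> (u + zs ! i)) * (c0 u * W \<tau> \<alpha> g (u # remove_nth i zs)))"
        using recursion_integrand_decomposition[OF IH gn False] by blast
      \<comment> \<open>The positions of \<open>zs\<close> in \<open>z0 # zs\<close>; hence the
        \<open>Suc i\<close> in \<open>M\<close> below.\<close>
      define js where "js = [1..<Suc n]"
      \<comment> \<open>\<open>c0\<close> is put into the element of the algebra, so that only
        \<open>K\<close> and the pairs of \<open>P2\<close> are left for the kernel.\<close>
      define FS where "FS ys = c0 (ys ! 0) * S ys" for ys
      define FW where "FW ys = c0 (ys ! 0) * W \<tau> \<alpha> g ys" for ys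
      define M where "M i xs u = K xs u * (P2 \<tau> (u - xs ! Suc i) + P2 \<tau> (u + xs ! Suc i))" for i xs u
      have FS: "FS \<in> elliptic_alg (Suc n)"
        unfolding FS_def[abs_def]
        by (intro elliptic_alg.mult S elliptic_alg.var[OF inverse_wp'_square_even_elliptic]) simp
      have FW: "FW \<in> elliptic_alg (Suc (n - 1))" if "0 < n"
      proof -
        have "W \<tau> \<alpha> g \<in> elliptic_alg (Suc (n - 1))" using IH[of g n] gn False that by (cases g) auto
        then show ?thesis
          unfolding FW_def[abs_def]
          by (intro elliptic_alg.mult elliptic_alg.var[OF inverse_wp'_square_even_elliptic]) auto
      qed
      have M: "M i \<in> kernels a m" if "i < n" for i
        unfolding M_def[abs_def] using a m that by (intro kernels_mult K kernels_P2) auto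
      have js: "length js = n" "set js \<subseteq> {..<m}" by (auto simp: js_def m)
      have jsi: "length (remove_nth i js) = n - 1" "set (remove_nth i js) \<subseteq> {..<m}" if "i < n" for i
        using that js length_remove_nth[of i js] set_remove_nth[of i js] by auto
      have "(\<lambda>xs. residue (\<lambda>u. K xs u * FS (u # map (nth xs) js)) a -
          (\<Sum>i<n. residue (\<lambda>u. M i xs u * FW (u # map (nth xs) (remove_nth i js))) a)) \<in> elliptic_alg m"
      proof (intro elliptic_alg_diff elliptic_alg_sum)
        show "(\<lambda>xs. residue (\<lambda>u. K xs u * FS (u # map (nth xs) js)) a) \<in> elliptic_alg m"
          by (rule kernels_residue_elliptic_alg[OF K[OF a] FS js])
        show "(\<lambda>xs. residue (\<lambda>u. M i xs u * FW (u # map (nth xs) (remove_nth i js))) a) \<in> elliptic_alg m"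
          if "i \<in> {..<n}" for i
          using that by (intro kernels_residue_elliptic_alg[OF M FW jsi]) auto
      qed simp
      then show ?thesis
      proof (rule elliptic_alg.regular_cong)
        fix xs assume xs: "regular m xs"
        obtain z0 zs where z: "xs = z0 # zs" using xs m by (cases xs) (auto simp: regular_def)
        have zs: "regular n zs" using xs m z by (simp add: regular_Cons)
        have len: "length zs = n" using zs by (simp add: regular_def)
        have map_js: "map (nth xs) js = zs"
          using map_nth[of zs] len by (simp add: js_def z map_Suc_upt[symmetric] o_def del: upt_Suc map_Suc_upt)
        have mK: "K xs meromorphic_on {a}"
          by (rule analytic_on_imp_meromorphic_on[OF K_an[OF a xs]])
        have V: "(\<lambda>u. FW (u # remove_nth i zs)) \<in> \<E>" if "i < n" for i
          using c0_W_even_elliptic[OF IH gn False zs that] by (simp add: FW_def)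
        have S0: "(\<lambda>u. FS (u # zs)) \<in> \<E>" by (rule elliptic_alg_even_elliptic[OF FS zs])
        have m1: "(\<lambda>u. K xs u * FS (u # zs)) meromorphic_on {a}"
          by (intro meromorphic_on_mult mK even_elliptic_meromorphic[OF S0])
        have m2: "(\<lambda>u. M i xs u * FW (u # remove_nth i zs)) meromorphic_on {a}" if "i < n" for i
          unfolding M_def
          by (intro meromorphic_on_mult meromorphic_on_add mK P2_shift_meromorphic even_elliptic_meromorphic[OF V[OF that]])
        have "\<forall>\<^sub>F u in at a. K xs u * recursion_integrand \<alpha> g (tl xs) u =
            K xs u * FS (u # zs) - (\<Sum>i<n. M i xs u * FW (u # remove_nth i zs))"
        proof (rule eventually_mono[OF eventually_not_half_lattice])
          fix u assume "u \<notin> H"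
          from S(2)[OF this zs] show "K xs u * recursion_integrand \<alpha> g (tl xs) u =
            K xs u * FS (u # zs) - (\<Sum>i<n. M i xs u * FW (u # remove_nth i zs))"
            by (simp add: z FS_def FW_def M_def right_diff_distrib sum_distrib_left mult_ac)
        qed
        then have "residue (\<lambda>u. K xs u * recursion_integrand \<alpha> g (tl xs) u) a =
            residue (\<lambda>u. K xs u * FS (u # zs) - (\<Sum>i<n. M i xs u * FW (u # remove_nth i zs))) a"
          by (rule residue_cong) simp
        also have "\<dots> = residue (\<lambda>u. K xs u * FS (u # zs)) a -
            residue (\<lambda>u. \<Sum>i<n. M i xs u * FW (u # remove_nth i zs)) a"
          by (intro residue_diff_at m1 meromorphic_on_sum m2) simp
        also have "residue (\<lambda>u. \<Sum>i<n. M i xs u * FW (u # remove_nth i zs)) a =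
            (\<Sum>i<n. residue (\<lambda>u. M i xs u * FW (u # remove_nth i zs)) a)"
          by (intro residue_sum_at m2) auto
        finally show "residue (\<lambda>u. K xs u * recursion_integrand \<alpha> g (tl xs) u) a =
            residue (\<lambda>u. K xs u * FS (u # map (nth xs) js)) a -
            (\<Sum>i<n. residue (\<lambda>u. M i xs u * FW (u # map (nth xs) (remove_nth i js))) a)"
          by (simp only: map_js map_remove_nth)
      qed
    qed
  qed
  then have "(\<lambda>xs. \<Sum>a\<in>ram_points \<tau>. - 1 / 2 * residue (\<lambda>u. K xs u * recursion_integrand \<alpha> g (tl xs) u) a)
      \<in> elliptic_alg m"
    by (intro elliptic_alg_sum elliptic_alg_cmult) (simp_all add: ram_points_def)
  then show ?case by (rule elliptic_alg.regular_cong) (rule W_eq)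
qed

end

subsection \<open>Integrals over the A-cycle\<close>

text \<open>For \<open>h = f\<close> this says that an odd function has an even derivative. It
  serves to rewrite residues at the negatives of the points as derivatives at the points
  themselves.\<close>

lemma deriv_mirror:
  fixes f h :: "complex \<Rightarrow> complex"
  assumes "f analytic_on {- z}" and "\<forall>\<^sub>F u in nhds z. h u = - f (- u)"
  shows "deriv h z = deriv f (- z)"
proof -
  have "(f has_field_derivative deriv f (- z)) (at (- z))"
    using analytic_on_imp_differentiable_at[OF assms(1)] by (simp add: DERIV_deriv_iff_field_differentiable)
  then have "((\<lambda>u. - f (- u)) has_field_derivative - (deriv f (- z) * - 1)) (at z)"
    by (intro DERIV_minus DERIV_chain2[of f]) (auto intro!: derivative_eq_intros)
  then have "deriv (\<lambda>u. - f (- u)) z = deriv f (- z)" by (simp add: DERIV_imp_deriv)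
  moreover have "deriv h z = deriv (\<lambda>u. - f (- u)) z" by (rule deriv_cong_ev[OF assms(2)]) simp
  ultimately show ?thesis by simp
qed

context upper_half
begin

section \<open>The strip between the contour and its translate\<close>

definition singular_set :: "complex set \<Rightarrow> complex set" where
  "singular_set Q = H \<union> {z. \<exists>p\<in>Q. z - p \<in> \<Lambda>}"

lemma eventually_not_singular: "finite Q \<Longrightarrow> \<forall>\<^sub>F z in at a. z \<notin> singular_set Q"
proof -
  assume Q: "finite Q"
  have "\<forall>\<^sub>F z in at a. \<forall>p\<in>Q. z - p \<notin> \<Lambda>"
  proof (intro eventually_ball_finite Q ballI)
    fix p show "\<forall>\<^sub>F z in at a. z - p \<notin> \<Lambda>"
      using eventually_shift_notin_lattice[where a = a and x = p] by eventually_elim simp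
  qed
  with eventually_not_half_lattice show ?thesis by eventually_elim (simp add: singular_set_def)
qed

text \<open>Representatives of \<open>H\<close> modulo 1 in the strip that ends at the contour. As
  \<open>w2\<close> lies above the contour, its place is taken by \<open>- w2\<close>.\<close>

definition strip_reps :: "complex set" where "strip_reps = {w1, - w2, w3, 0}"

lemma strip_reps_properties:
  assumes "p \<in> strip_reps"
  shows "p \<in> H" "Im p = 0 \<or> Im p = - Im \<tau> / 2"
proof -
  show "p \<in> H"
    using assms w_half_lattice lattice_imp_half_lattice[OF lattice_0] by (auto simp: strip_reps_def)
  have "Im w1 = 0" "Im w2 = Im \<tau> / 2" "Im w3 = - Im \<tau> / 2" by (simp_all add: w1_def w2_def w3_def)
  then show "Im p = 0 \<or> Im p = - Im \<tau> / 2" using assms by (auto simp: strip_reps_def)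
qed

lemma strip_reps_inj:
  assumes "p \<in> strip_reps" "q \<in> strip_reps" "p - q \<in> \<Lambda>"
  shows "p = q"
proof -
  have "w1 + w2 = - w3" "- w2 - w1 = w3" "- w2 - w3 = w1" "w3 + w2 = - w1" "- w1 - w2 = w3"
    by (simp_all add: w1_def w2_def w3_def field_simps)
  then show ?thesis
    using assms w_notin_lattice w_diff_notin_lattice unfolding strip_reps_def
    by (auto simp: lattice_uminus_iff)
qed

text \<open>If \<epsilon> lies between \<open>m\<close> and \<open>Im \<tau> / 2\<close>, this open
  strip contains the contour at height \<epsilon> and its translate at height
  \<open>\<epsilon> - Im \<tau>\<close>, with room on either side for the residue theorem. It ends
  before the next translates of the singularities.\<close>

lemma singular_in_strip:
  assumes z: "z \<in> singular_set Q" "m - Im \<tau> < Im z" "Im z < Im \<tau> / 2"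
    and m: "0 \<le> m" "m < Im \<tau> / 2" and Q: "\<And>p. p \<in> Q \<Longrightarrow> \<bar>Im p\<bar> \<le> m"
  shows "\<exists>p\<in>strip_reps \<union> Q. \<exists>n. z = p + of_int n"
proof (cases "z \<in> H")
  case True
  then obtain a b where ab: "2 * z = of_int a + of_int b * \<tau>"
    by (auto simp: half_lattice_def elim: latticeE)
  have Im: "2 * Im z = of_int b * Im \<tau>" using arg_cong[OF ab, of Im] by simp
  have "of_int b * Im \<tau> < 1 * Im \<tau>" "(- 2) * Im \<tau> < of_int b * Im \<tau>" using Im z m by linarith+
  then have "of_int b < (1 :: real)" "(- 2 :: real) < of_int b"
    using Im_pos by (simp_all only: mult_less_cancel_right_pos)
  then have b: "b = 0 \<or> b = - 1" by linarith
  define k where "k = a div 2"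
  have "a = 2 * k \<or> a = 2 * k + 1" unfolding k_def by presburger
  with b consider "z = 0 + of_int k" | "z = w1 + of_int k" | "z = - w2 + of_int k" | "z = w3 + of_int (k + 1)"
    using ab by (auto simp: w1_def w2_def w3_def field_simps)
  moreover have "{0, w1, - w2, w3} \<subseteq> strip_reps" by (auto simp: strip_reps_def)
  ultimately show ?thesis by cases blast+
next
  case False
  then obtain p where p: "p \<in> Q" "z - p \<in> \<Lambda>" using z by (auto simp: singular_set_def)
  obtain a b where ab: "z - p = of_int a + of_int b * \<tau>" using p(2) by (rule latticeE)
  have Im: "Im z = Im p + of_int b * Im \<tau>" using arg_cong[OF ab, of Im] by simp
  have "\<bar>Im p\<bar> \<le> m" by (rule Q[OF p(1)])
  then have "of_int b * Im \<tau> < 1 * Im \<tau>" "(- 1) * Im \<tau> < of_int b * Im \<tau>" using Im z m by linarith+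
  then have "of_int b < (1 :: real)" "(- 1 :: real) < of_int b"
    using Im_pos by (simp_all only: mult_less_cancel_right_pos)
  then have "b = 0" by linarith
  then have "z = p + of_int a" using ab by (simp add: algebra_simps)
  then show ?thesis using p(1) by blast
qed

lemma contour_integral_unit_segment_plus_tau:
  assumes "continuous_on {z. Im z = y} G" "\<And>z. Im z = y \<Longrightarrow> G (z + 1) = G z"
  shows "contour_integral (linepath (\<i> * of_real y) (\<i> * of_real y + 1)) G =
    integral {0..1} (\<lambda>s. G (\<i> * of_real (y - Im \<tau>) + of_real s + \<tau>))"
proof -
  have eq: "\<i> * of_real y + of_real (Re \<tau>) = \<i> * of_real (y - Im \<tau>) + \<tau>"
    by (simp add: complex_eq_iff)
  have "contour_integral (linepath (\<i> * of_real y) (\<i> * of_real y + 1)) G =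
      contour_integral (linepath (\<i> * of_real y + of_real (Re \<tau>)) (\<i> * of_real y + of_real (Re \<tau>) + 1)) G"
    by (rule contour_integral_unit_segment_shift[symmetric]) (use assms in auto)
  also have "\<dots> = integral {0..1} (\<lambda>s. G (\<i> * of_real (y - Im \<tau>) + of_real s + \<tau>))"
    unfolding contour_integral_unit_segment eq by (simp add: algebra_simps)
  finally show ?thesis .
qed

text \<open>Going once around the torus in direction \<open>\<tau>\<close> changes \<open>P1 \<cdot> t\<close> by \<open>2\<pi>\<i> t\<close>.\<close>

lemma A_cycle_strip_residues:
  assumes eps: "0 < \<epsilon>" "\<epsilon> < Im \<tau> / 2" and fin: "finite Q"
    and Q: "\<And>p. p \<in> Q \<Longrightarrow> p \<notin> H \<and> \<bar>Im p\<bar> < \<epsilon>"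
    and inj: "\<And>p q. p \<in> Q \<Longrightarrow> q \<in> Q \<Longrightarrow> p - q \<in> \<Lambda> \<Longrightarrow> p = q"
    and holo: "t holomorphic_on - singular_set Q"
    and per: "\<And>z \<omega>. \<omega> \<in> \<Lambda> \<Longrightarrow> z \<notin> singular_set Q \<Longrightarrow> t (z + \<omega>) = t z"
  shows "t contour_integrable_on A_cycle \<epsilon>"
    and "contour_integral (A_cycle \<epsilon>) t = - (\<Sum>p\<in>strip_reps \<union> Q. residue (\<lambda>z. P1 \<tau> z * t z) p)"
proof -
  define F where "F z = P1 \<tau> z * t z" for z
  \<comment> \<open>As \<open>Q\<close> is finite, the heights of its points stay below \<epsilon>
    by a positive margin; 0 is inserted to cover the empty \<open>Q\<close>.\<close>
  define m where "m = Max (insert 0 ((\<lambda>p. \<bar>Im p\<bar>) ` Q))"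
  have m: "0 \<le> m" "m < \<epsilon>" "\<And>p. p \<in> Q \<Longrightarrow> \<bar>Im p\<bar> \<le> m"
    unfolding m_def using fin Q eps by auto
  let ?P = "strip_reps \<union> Q"
  let ?S = "{p + of_int n | p n. p \<in> ?P}"
  have sing: "z \<in> ?S" if "z \<in> singular_set Q" "m - Im \<tau> < Im z" "Im z < Im \<tau> / 2" for z
    using singular_in_strip[OF that m(1) _ m(3)] m(2) eps by auto
  have P_Im: "\<epsilon> - Im \<tau> < Im p \<and> Im p < \<epsilon>" if "p \<in> ?P" for p
    using that
  proof
    assume "p \<in> strip_reps"
    from strip_reps_properties(2)[OF this] show ?thesis using eps by auto
  next
    assume "p \<in> Q"
    with Q[of p] eps show ?thesis by auto
  qed
  have lattice_singular: "z \<notin> \<Lambda>" if "z \<notin> singular_set Q" for z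
    using that lattice_imp_half_lattice by (auto simp: singular_set_def)
  have F_holo: "F holomorphic_on - singular_set Q"
    unfolding F_def
    by (intro holomorphic_on_mult holo holomorphic_on_subset[OF P1_holomorphic]) (use lattice_singular in auto)
  have F_per: "F (z + 1) = F z" if "z \<notin> singular_set Q" for z
    using per[OF lattice_1 that] by (simp add: F_def P1_plus_1)
  have line: "z \<notin> singular_set Q" if "Im z = \<epsilon> \<or> Im z = \<epsilon> - Im \<tau>" for z
  proof
    assume z: "z \<in> singular_set Q"
    have "m - Im \<tau> < Im z" "Im z < Im \<tau> / 2" using that m eps Im_pos by auto
    from sing[OF z this] obtain p n where "p \<in> ?P" "z = p + of_int n" by blast
    then show False using that P_Im[of p] by auto
  qed
  let ?J = "\<lambda>y. contour_integral (linepath (\<i> * of_real y) (\<i> * of_real y + 1))"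
  have strip: "?J (\<epsilon> - Im \<tau>) F - ?J \<epsilon> F = 2 * of_real pi * \<i> * (\<Sum>p\<in>?P. residue F p)"
  proof (rule strip_residues)
    show "finite ?P" using fin by (simp add: strip_reps_def)
    show "F holomorphic_on {z. m - Im \<tau> < Im z \<and> Im z < Im \<tau> / 2} - ?S"
      by (rule holomorphic_on_subset[OF F_holo]) (use sing in blast)
    show "F (z + 1) = F z" if "m - Im \<tau> < Im z" "Im z < Im \<tau> / 2" "z \<notin> ?S" for z
      using F_per[of z] sing[of z] that by blast
    show "m - Im \<tau> < \<epsilon> - Im \<tau>" "\<epsilon> - Im \<tau> < \<epsilon>" "\<epsilon> < Im \<tau> / 2" using m eps Im_pos by auto
    show "p = q" if pq: "p \<in> ?P" "q \<in> ?P" "p - q = of_int n" for p q n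
    proof -
      have L: "p - q \<in> \<Lambda>" unfolding pq(3) by (rule lattice_of_int)
      then have L2: "q - p \<in> \<Lambda>" using lattice_uminus[of "p - q" \<tau>] by simp
      have mixed: False if "p' \<in> Q" "q' \<in> strip_reps" "p' - q' \<in> \<Lambda>" for p' q'
        using Q[OF that(1)] strip_reps_properties(1)[OF that(2)] lattice_imp_half_lattice[OF that(3)] by simp
      from pq(1,2) show ?thesis
        using strip_reps_inj[OF _ _ L] inj[OF _ _ L] mixed[OF _ _ L] mixed[OF _ _ L2] by blast
    qed
  qed (rule P_Im)
  have cont: "continuous_on {z. Im z = y} G" if "G holomorphic_on - singular_set Q" "y = \<epsilon> \<or> y = \<epsilon> - Im \<tau>" for G y
    by (rule holomorphic_on_imp_continuous_on[OF holomorphic_on_subset[OF that(1)]]) (use line that(2) in auto)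
  let ?w = "\<lambda>s. \<i> * of_real (\<epsilon> - Im \<tau>) + of_real s"
  have w: "?w s \<notin> singular_set Q" for s :: real by (rule line) simp
  have int: "(\<lambda>s. G (?w s)) integrable_on {0..1}" if "G holomorphic_on - singular_set Q" for G
    by (intro integrable_continuous_real continuous_on_compose2[OF cont[OF that, of "\<epsilon> - Im \<tau>"]] continuous_intros) auto
  have J: "?J \<epsilon> G = integral {0..1} (\<lambda>s. G (?w s + \<tau>))"
    if "G holomorphic_on - singular_set Q" "\<And>z. z \<notin> singular_set Q \<Longrightarrow> G (z + 1) = G z" for G
    by (rule contour_integral_unit_segment_plus_tau[OF cont[OF that(1)]]) (use that(2) line in auto)
  have Jt: "?J \<epsilon> t = integral {0..1} (\<lambda>s. t (?w s))"
  proof -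
    have "?J \<epsilon> t = integral {0..1} (\<lambda>s. t (?w s + \<tau>))" by (rule J[OF holo per[OF lattice_1]])
    also have "\<dots> = integral {0..1} (\<lambda>s. t (?w s))" by (simp only: per[OF lattice_tau w])
    finally show ?thesis .
  qed
  have "?J \<epsilon> F = integral {0..1} (\<lambda>s. F (?w s + \<tau>))" by (rule J[OF F_holo F_per])
  also have "\<dots> = integral {0..1} (\<lambda>s. F (?w s) + 2 * of_real pi * \<i> * t (?w s))"
    unfolding F_def per[OF lattice_tau w] P1_plus_tau[OF lattice_singular[OF w]] by (simp add: algebra_simps)
  also have "\<dots> = integral {0..1} (\<lambda>s. F (?w s)) + integral {0..1} (\<lambda>s. 2 * of_real pi * \<i> * t (?w s))"
    by (rule Henstock_Kurzweil_Integration.integral_add[OF int[OF F_holo] integrable_on_mult_right[OF int[OF holo]]])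
  also have "integral {0..1} (\<lambda>s. F (?w s)) = ?J (\<epsilon> - Im \<tau>) F" by (simp add: contour_integral_unit_segment)
  also have "integral {0..1} (\<lambda>s. 2 * of_real pi * \<i> * t (?w s)) = 2 * of_real pi * \<i> * ?J \<epsilon> t"
    unfolding Jt by simp
  finally have shift: "?J \<epsilon> F = ?J (\<epsilon> - Im \<tau>) F + 2 * of_real pi * \<i> * ?J \<epsilon> t" .
  have cancel: "j = - r" if "a - b = c * r" "b = a + c * j" "c \<noteq> 0" for a b c j r :: complex
  proof -
    have "c * r = c * - j" using that(1,2) by simp
    then show ?thesis using that(3) by (metis add.inverse_inverse mult_left_cancel)
  qed
  have Jres: "?J \<epsilon> t = - (\<Sum>p\<in>?P. residue F p)" by (rule cancel[OF strip shift]) simp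
  have A: "A_cycle \<epsilon> = linepath (\<i> * of_real \<epsilon>) (\<i> * of_real \<epsilon> + 1)" by (simp add: A_cycle_def add.commute)
  show "contour_integral (A_cycle \<epsilon>) t = - (\<Sum>p\<in>?P. residue (\<lambda>z. P1 \<tau> z * t z) p)"
    unfolding A Jres by (simp add: F_def[abs_def])
  have "closed_segment (\<i> * of_real \<epsilon>) (\<i> * of_real \<epsilon> + 1) \<subseteq> {z. Im z = \<epsilon>}"
    by (auto simp: closed_segment_def algebra_simps)
  then show "t contour_integrable_on A_cycle \<epsilon>"
    unfolding A by (intro contour_integrable_continuous_linepath continuous_on_subset[OF cont[OF holo, of \<epsilon>]]) auto
qed

text \<open>The second term moves the representative \<open>- \<tau> / 2\<close> of the strip to \<open>\<tau> / 2\<close>.\<close>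

definition ram_residues :: "(complex \<Rightarrow> complex) \<Rightarrow> complex" where
  "ram_residues t = (\<Sum>a\<in>ram_points \<tau>. residue (\<lambda>z. P1 \<tau> z * t z) a) -
     2 * of_real pi * \<i> * residue t (- w2)"

lemma A_cycle_residues:
  assumes eps: "0 < \<epsilon>" "\<epsilon> < Im \<tau> / 2" and fin: "finite Q"
    and Q: "\<And>p. p \<in> Q \<Longrightarrow> p \<notin> H \<and> \<bar>Im p\<bar> < \<epsilon>"
    and inj: "\<And>p q. p \<in> Q \<Longrightarrow> q \<in> Q \<Longrightarrow> p - q \<in> \<Lambda> \<Longrightarrow> p = q"
    and holo: "t holomorphic_on - singular_set Q"
    and per: "\<And>z \<omega>. \<omega> \<in> \<Lambda> \<Longrightarrow> z \<notin> singular_set Q \<Longrightarrow> t (z + \<omega>) = t z"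
    and mero: "t meromorphic_on UNIV"
  shows "(t has_contour_integral - ram_residues t - (\<Sum>p\<in>Q. residue (\<lambda>z. P1 \<tau> z * t z) p)) (A_cycle \<epsilon>)"
proof -
  let ?r = "\<lambda>p. residue (\<lambda>z. P1 \<tau> z * t z) p"
  have "residue (\<lambda>z. P1 \<tau> z * t z) w2 = residue (\<lambda>z. P1 \<tau> (z + \<tau>) * t (z + \<tau>)) (- w2)"
  proof -
    have "- w2 + x + \<tau> = w2 + x" for x by (simp add: w2_def field_simps)
    then show ?thesis
      by (simp only: residue_shift_0[of _ w2] residue_shift_0[of _ "- w2"])
  qed
  also have "\<dots> = residue (\<lambda>z. P1 \<tau> z * t z + 2 * of_real pi * \<i> * t z) (- w2)"
  proof (rule residue_cong)
    show "\<forall>\<^sub>F z in at (- w2). P1 \<tau> (z + \<tau>) * t (z + \<tau>) = P1 \<tau> z * t z + 2 * of_real pi * \<i> * t z"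
      using eventually_not_singular[OF fin] eventually_not_lattice
      by eventually_elim (simp add: per[OF lattice_tau] P1_plus_tau algebra_simps)
  qed simp
  also have "\<dots> = ?r (- w2) + residue (\<lambda>z. 2 * of_real pi * \<i> * t z) (- w2)"
    by (intro residue_add_at meromorphic_on_mult meromorphic_on_const meromorphic_on_UNIV_subset[OF mero]
        meromorphic_on_UNIV_subset[OF P1_meromorphic])
  also have "residue (\<lambda>z. 2 * of_real pi * \<i> * t z) (- w2) = 2 * of_real pi * \<i> * residue t (- w2)"
    by (rule residue_cmult_at[OF meromorphic_on_UNIV_subset[OF mero]])
  finally have w2: "?r w2 = ?r (- w2) + 2 * of_real pi * \<i> * residue t (- w2)" .
  have ne: "w1 \<noteq> w2" "w1 \<noteq> w3" "w2 \<noteq> w3" "w1 \<noteq> 0" "w2 \<noteq> 0" "w3 \<noteq> 0"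
    using w_diff_notin_lattice w_notin_lattice lattice_0[of \<tau>] by auto
  have ne': "w1 \<noteq> - w2" "- w2 \<noteq> w3"
  proof -
    have "w1 + w2 = - w3" "w2 + w3 = - w1" by (simp_all add: w1_def w2_def w3_def field_simps)
    then have "w1 + w2 \<noteq> 0" "w2 + w3 \<noteq> 0" using ne by simp_all
    then show "w1 \<noteq> - w2" "- w2 \<noteq> w3"
      using eq_neg_iff_add_eq_0[of w1 w2] neg_eq_iff_add_eq_0[of w2 w3] by blast+
  qed
  have "(\<Sum>p\<in>strip_reps. ?r p) = (\<Sum>a\<in>ram_points \<tau>. ?r a) - 2 * of_real pi * \<i> * residue t (- w2)"
    unfolding strip_reps_def ram_points_eq using ne ne' w2 by simp
  moreover have "strip_reps \<inter> Q = {}" using strip_reps_properties Q by blast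
  then have "(\<Sum>p\<in>strip_reps \<union> Q. ?r p) = (\<Sum>p\<in>strip_reps. ?r p) + (\<Sum>p\<in>Q. ?r p)"
    using fin by (intro sum.union_disjoint) (auto simp: strip_reps_def)
  ultimately have "contour_integral (A_cycle \<epsilon>) t = - ram_residues t - (\<Sum>p\<in>Q. ?r p)"
    using A_cycle_strip_residues(2)[OF eps fin Q inj holo per] by (simp add: ram_residues_def)
  then show ?thesis
    using has_contour_integral_integral[OF A_cycle_strip_residues(1)[OF eps fin Q inj holo per]] by metis
qed

text \<open>Linearity lets the contributions of the pieces of the integrand be recombined; it is the
  contribution of the whole integrand that is identified with \<open>W\<close> at 0.\<close>

lemma ram_residues_diff:
  assumes "f meromorphic_on UNIV" "g meromorphic_on UNIV"
  shows "ram_residues (\<lambda>u. f u - g u) = ram_residues f - ram_residues g"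
proof -
  have "residue (\<lambda>z. P1 \<tau> z * (f z - g z)) a = residue (\<lambda>z. P1 \<tau> z * f z) a - residue (\<lambda>z. P1 \<tau> z * g z) a" for a
    unfolding right_diff_distrib
    by (intro residue_diff_at meromorphic_on_mult meromorphic_on_UNIV_subset[OF P1_meromorphic]
        meromorphic_on_UNIV_subset[OF assms(1)] meromorphic_on_UNIV_subset[OF assms(2)])
  moreover have "residue (\<lambda>z. f z - g z) (- w2) = residue f (- w2) - residue g (- w2)"
    by (intro residue_diff_at meromorphic_on_UNIV_subset[OF assms(1)] meromorphic_on_UNIV_subset[OF assms(2)])
  ultimately show ?thesis
    unfolding ram_residues_def by (simp only:) (simp add: sum_subtractf right_diff_distrib)
qed

lemma ram_residues_0: "ram_residues (\<lambda>_. 0) = 0"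
  by (simp add: ram_residues_def residue_const)

lemma ram_residues_sum:
  assumes "finite I" "\<And>i. i \<in> I \<Longrightarrow> f i meromorphic_on UNIV"
  shows "ram_residues (\<lambda>u. \<Sum>i\<in>I. f i u) = (\<Sum>i\<in>I. ram_residues (f i))"
  using assms
proof (induction I rule: finite_induct)
  case (insert i I)
  have m: "(\<lambda>u. \<Sum>i\<in>I. f i u) meromorphic_on UNIV" using insert by (intro meromorphic_on_sum) auto
  have m': "(\<lambda>u. 0 - (\<Sum>i\<in>I. f i u)) meromorphic_on UNIV" by (intro meromorphic_intros m)
  have "ram_residues (\<lambda>u. f i u - (0 - (\<Sum>i\<in>I. f i u))) = ram_residues (f i) + ram_residues (\<lambda>u. \<Sum>i\<in>I. f i u)"
    using ram_residues_diff[of "f i" "\<lambda>u. 0 - (\<Sum>i\<in>I. f i u)"] ram_residues_diff[of "\<lambda>_. 0", OF _ m] m' insert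
    by (simp add: ram_residues_0 meromorphic_on_const)
  then show ?case using insert by simp
qed (simp add: ram_residues_0)

text \<open>At \<open>z0 = 0\<close> the kernel is a constant plus \<open>P1 \<tau> u\<close>, as
  \<open>P1\<close> is odd. By the symmetry about each half period the constant contributes nothing,
  and the same symmetry kills the residue at \<open>- w2\<close> in \<open>ram_residues\<close>. The
  function \<open>q\<close> stands for the decomposed form of the integrand.\<close>

lemma W_at_0:
  assumes gn: "2 * g + n \<ge> 2" and zs: "regular n zs"
    and q: "q meromorphic_on UNIV" "\<And>u. u \<notin> H \<Longrightarrow> recursion_integrand \<alpha> g zs u = q u"
  shows "W \<tau> \<alpha> g (0 # zs) = ram_residues q"
proof -
  let ?f = "recursion_integrand \<alpha> g zs"
  have sym: "?f meromorphic_on {a}" "residue ?f a = 0" if "a \<in> H" for a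
    using recursion_integrand_reflect[OF W_elliptic_alg gn zs that] residue_reflection_symmetric by blast+
  have ev: "\<forall>\<^sub>F u in at a. ?f u = q u" for a
    by (rule eventually_mono[OF eventually_not_half_lattice q(2)])
  have "residue ?f (- w2) = residue q (- w2)" by (rule residue_cong[OF ev]) simp
  then have r0: "residue q (- w2) = 0" using sym(2)[of "- w2"] w_half_lattice by simp
  have "2 * g + length zs \<ge> 2" using gn zs by (simp add: regular_def)
  then have "W \<tau> \<alpha> g (0 # zs) =
      (\<Sum>a\<in>ram_points \<tau>. residue (\<lambda>u. (P1 \<tau> (0 - \<alpha>) - P1 \<tau> (0 - u)) * ?f u) a)"
    by (rule W_eq_residues)
  also have "\<dots> = (\<Sum>a\<in>ram_points \<tau>. residue (\<lambda>z. P1 \<tau> z * q z) a)"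
  proof (intro sum.cong refl)
    fix a assume "a \<in> ram_points \<tau>"
    then have a: "a \<in> H" by (rule ram_points_half_lattice)
    have "(\<lambda>u. (P1 \<tau> (0 - \<alpha>) - P1 \<tau> (0 - u)) * ?f u) = (\<lambda>u. P1 \<tau> (0 - \<alpha>) * ?f u + P1 \<tau> u * ?f u)"
      using P1_minus by (simp add: algebra_simps)
    then have "residue (\<lambda>u. (P1 \<tau> (0 - \<alpha>) - P1 \<tau> (0 - u)) * ?f u) a =
        residue (\<lambda>u. P1 \<tau> (0 - \<alpha>) * ?f u + P1 \<tau> u * ?f u) a" by (rule arg_cong)
    also have "\<dots> = residue (\<lambda>u. P1 \<tau> (0 - \<alpha>) * ?f u) a + residue (\<lambda>u. P1 \<tau> u * ?f u) a"
      by (intro residue_add_at meromorphic_on_mult meromorphic_on_const sym a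
          meromorphic_on_UNIV_subset[OF P1_meromorphic])
    also have "residue (\<lambda>u. P1 \<tau> (0 - \<alpha>) * ?f u) a = 0"
      using residue_cmult_at[OF sym(1)[OF a]] sym(2)[OF a] by simp
    also have "residue (\<lambda>u. P1 \<tau> u * ?f u) a = residue (\<lambda>z. P1 \<tau> z * q z) a"
    proof (rule residue_cong)
      show "\<forall>\<^sub>F z in at a. P1 \<tau> z * ?f z = P1 \<tau> z * q z" using ev by eventually_elim simp
    qed simp
    finally show "residue (\<lambda>u. (P1 \<tau> (0 - \<alpha>) - P1 \<tau> (0 - u)) * ?f u) a = residue (\<lambda>z. P1 \<tau> z * q z) a" by simp
  qed
  finally show ?thesis by (simp add: ram_residues_def r0)
qed

text \<open>This is the origin of the derivatives in the final formula: the double pole of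
  \<open>P2\<close> has no residue of its own and picks out the linear Taylor coefficient of the
  other factor.\<close>

lemma residue_P2_times:
  assumes "k analytic_on {p}"
  shows "residue (\<lambda>u. P2 \<tau> (u - p) * k u) p = deriv k p"
proof -
  obtain h where h: "h analytic_on {0}" "\<forall>\<^sub>F z in at 0. P2 \<tau> z = 1 / (z - 0)\<^sup>2 + h z"
    using P2_polar lattice_0 by metis
  have "\<forall>\<^sub>F u in at p. P2 \<tau> (u - p) = 1 / (u - p)\<^sup>2 + h (u - p)"
    using h(2) eventually_at_shift[of "\<lambda>z. P2 \<tau> z = 1 / (z - 0)\<^sup>2 + h z" p "- p"] by simp
  then have "\<forall>\<^sub>F u in at p. P2 \<tau> (u - p) * k u = k u / (u - p) ^ Suc 1 + h (u - p) * k u"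
    by eventually_elim (simp add: distrib_right power2_eq_square)
  then have "residue (\<lambda>u. P2 \<tau> (u - p) * k u) p = residue (\<lambda>u. k u / (u - p) ^ Suc 1 + h (u - p) * k u) p"
    by (rule residue_cong) simp
  also have "\<dots> = residue (\<lambda>u. k u / (u - p) ^ Suc 1) p + residue (\<lambda>u. h (u - p) * k u) p"
  proof (rule residue_add_at)
    have k: "k meromorphic_on {p}" by (rule analytic_on_imp_meromorphic_on[OF assms])
    show "(\<lambda>u. k u / (u - p) ^ Suc 1) meromorphic_on {p}" by (intro meromorphic_intros k)
    have "(\<lambda>u. h (u + - p)) analytic_on {p}" by (rule analytic_on_shift) (use h in simp)
    then show "(\<lambda>u. h (u - p) * k u) meromorphic_on {p}"
      by (intro meromorphic_on_mult k analytic_on_imp_meromorphic_on) simp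
  qed
  also have "residue (\<lambda>u. k u / (u - p) ^ Suc 1) p = deriv k p"
    using residue_over_power_at[OF assms, of 1] by simp
  also have "residue (\<lambda>u. h (u - p) * k u) p = 0"
  proof (rule residue_analytic_eq_0)
    have "(\<lambda>u. h (u + - p)) analytic_on {p}" by (rule analytic_on_shift) (use h in simp)
    then show "(\<lambda>u. h (u - p) * k u) analytic_on {p}" by (intro analytic_on_mult assms) simp
  qed simp
  finally show ?thesis by simp
qed

section \<open>Contour integrals of the individual summands\<close>

lemma eventually_nhds_not_half_lattice: "x \<notin> H \<Longrightarrow> \<forall>\<^sub>F u in nhds x. u \<notin> H"
  using eventually_nhds_in_open[OF open_Compl_half_lattice, of x] by simp

lemma analytic_at_even_elliptic: "\<phi> \<in> \<E> \<Longrightarrow> x \<notin> H \<Longrightarrow> \<phi> analytic_on {x}"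
  by (rule holomorphic_on_imp_analytic_at[OF even_elliptic_holomorphic open_Compl_half_lattice]) auto

lemma P1_analytic_regular: "x \<notin> H \<Longrightarrow> P1 \<tau> analytic_on {x}"
  using P1_analytic lattice_imp_half_lattice by blast

lemma double_notin_lattice: "x \<notin> H \<Longrightarrow> x - - x \<notin> \<Lambda>" "x \<notin> H \<Longrightarrow> - x - x \<notin> \<Lambda>"
  using lattice_uminus_iff[of "2 * x" \<tau>] by (simp_all add: half_lattice_def)

lemma P2_shift_holomorphic:
  assumes "p \<in> Q" shows "(\<lambda>u. P2 \<tau> (u - p)) holomorphic_on - singular_set Q"
  by (rule holomorphic_on_compose_gen[OF _ P2_holomorphic, unfolded o_def])
     (use assms in \<open>auto intro!: holomorphic_intros simp: singular_set_def\<close>)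

lemma P2_shift_plus:
  assumes "p \<in> Q" "z \<notin> singular_set Q" "\<omega> \<in> \<Lambda>"
  shows "P2 \<tau> (z + \<omega> - p) = P2 \<tau> (z - p)"
  using P2_plus_lattice[of "z - p" \<omega>] assms by (auto simp: singular_set_def algebra_simps)

text \<open>The product form serves for \<open>(0, 2)\<close>, with poles at one point and at the
  negative of the other; the sum form serves for all other cases, with poles at
  \<open>zs ! i\<close> and its negative.\<close>

lemma A_cycle_two_poles:
  assumes eps: "0 < \<epsilon>" "\<epsilon> < Im \<tau> / 2"
    and p: "p \<notin> H" "\<bar>Im p\<bar> < \<epsilon>" and q: "q \<notin> H" "\<bar>Im q\<bar> < \<epsilon>" and pq: "p - q \<notin> \<Lambda>"
    and V: "V \<in> \<E>"
  shows "((\<lambda>u. P2 \<tau> (u - p) * P2 \<tau> (u - q) * V u) has_contour_integral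
      - ram_residues (\<lambda>u. P2 \<tau> (u - p) * P2 \<tau> (u - q) * V u)
      - deriv (\<lambda>u. P1 \<tau> u * (P2 \<tau> (u - q) * V u)) p - deriv (\<lambda>u. P1 \<tau> u * (P2 \<tau> (u - p) * V u)) q)
      (A_cycle \<epsilon>)" (is ?prod)
    and "((\<lambda>u. (P2 \<tau> (u - p) + P2 \<tau> (u - q)) * V u) has_contour_integral
      - ram_residues (\<lambda>u. (P2 \<tau> (u - p) + P2 \<tau> (u - q)) * V u)
      - deriv (\<lambda>u. P1 \<tau> u * V u) p - deriv (\<lambda>u. P1 \<tau> u * V u) q) (A_cycle \<epsilon>)" (is ?sum)
proof -
  let ?Q = "{p, q}"
  have qp: "q - p \<notin> \<Lambda>" using pq lattice_uminus_iff[of "p - q" \<tau>] by simp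
  have ne: "p \<noteq> q" using pq lattice_0 by auto
  have Q: "r \<notin> H \<and> \<bar>Im r\<bar> < \<epsilon>" if "r \<in> ?Q" for r using that p q by auto
  have inj: "r = s" if "r \<in> ?Q" "s \<in> ?Q" "r - s \<in> \<Lambda>" for r s using that pq qp by auto
  have V_holo: "V holomorphic_on - singular_set ?Q"
    by (rule holomorphic_on_subset[OF even_elliptic_holomorphic[OF V]]) (auto simp: singular_set_def)
  have V_per: "V (z + \<omega>) = V z" if "\<omega> \<in> \<Lambda>" "z \<notin> singular_set ?Q" for z \<omega>
    using even_elliptic_plus[OF V that(1), of z] that(2) by (auto simp: singular_set_def)
  have V_mero: "V meromorphic_on A" for A by (rule even_elliptic_meromorphic[OF V])
  have an: "P1 \<tau> analytic_on {p}" "P1 \<tau> analytic_on {q}" "V analytic_on {p}" "V analytic_on {q}"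
    using p(1) q(1) V by (auto intro: P1_analytic_regular analytic_at_even_elliptic)
  note sh = P2_shift_analytic[OF pq] P2_shift_analytic[OF qp]
  note holo = P2_shift_holomorphic[of p ?Q] P2_shift_holomorphic[of q ?Q]
  show ?prod
  proof -
    let ?t = "\<lambda>u. P2 \<tau> (u - p) * P2 \<tau> (u - q) * V u"
    have "(?t has_contour_integral - ram_residues ?t - (\<Sum>r\<in>?Q. residue (\<lambda>z. P1 \<tau> z * ?t z) r)) (A_cycle \<epsilon>)"
    proof (rule A_cycle_residues[OF eps _ Q inj])
      show "?t holomorphic_on - singular_set ?Q" by (intro holomorphic_on_mult holo V_holo) auto
      show "?t (z + \<omega>) = ?t z" if "\<omega> \<in> \<Lambda>" "z \<notin> singular_set ?Q" for z \<omega>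
        using P2_shift_plus[of p ?Q z \<omega>] P2_shift_plus[of q ?Q z \<omega>] V_per that by simp
      show "?t meromorphic_on UNIV" by (intro meromorphic_on_mult P2_shift_meromorphic V_mero)
    qed auto
    moreover have "(\<lambda>z. P1 \<tau> z * ?t z) = (\<lambda>u. P2 \<tau> (u - p) * (P1 \<tau> u * (P2 \<tau> (u - q) * V u)))"
      by (simp add: mult_ac)
    moreover have "(\<lambda>z. P1 \<tau> z * ?t z) = (\<lambda>u. P2 \<tau> (u - q) * (P1 \<tau> u * (P2 \<tau> (u - p) * V u)))"
      by (simp add: mult_ac)
    moreover have "residue (\<lambda>u. P2 \<tau> (u - p) * (P1 \<tau> u * (P2 \<tau> (u - q) * V u))) p =
        deriv (\<lambda>u. P1 \<tau> u * (P2 \<tau> (u - q) * V u)) p"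
      by (intro residue_P2_times analytic_on_mult an sh)
    moreover have "residue (\<lambda>u. P2 \<tau> (u - q) * (P1 \<tau> u * (P2 \<tau> (u - p) * V u))) q =
        deriv (\<lambda>u. P1 \<tau> u * (P2 \<tau> (u - p) * V u)) q"
      by (intro residue_P2_times analytic_on_mult an sh)
    ultimately show ?thesis using ne by (simp only: sum.insert finite.intros empty_iff insert_iff
        sum.empty add_0_right simp_thms diff_diff_eq not_False_eq_True)
  qed
  show ?sum
  proof -
    let ?t = "\<lambda>u. (P2 \<tau> (u - p) + P2 \<tau> (u - q)) * V u"
    let ?k = "\<lambda>u. P1 \<tau> u * V u"
    have "(?t has_contour_integral - ram_residues ?t - (\<Sum>r\<in>?Q. residue (\<lambda>z. P1 \<tau> z * ?t z) r)) (A_cycle \<epsilon>)"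
    proof (rule A_cycle_residues[OF eps _ Q inj])
      show "?t holomorphic_on - singular_set ?Q" by (intro holomorphic_on_mult holomorphic_on_add holo V_holo) auto
      show "?t (z + \<omega>) = ?t z" if "\<omega> \<in> \<Lambda>" "z \<notin> singular_set ?Q" for z \<omega>
        using P2_shift_plus[of p ?Q z \<omega>] P2_shift_plus[of q ?Q z \<omega>] V_per that by simp
      show "?t meromorphic_on UNIV"
        by (intro meromorphic_on_mult meromorphic_on_add P2_shift_meromorphic V_mero)
    qed auto
    moreover have "residue (\<lambda>z. P1 \<tau> z * ?t z) r = deriv ?k r" if r: "r \<in> ?Q" for r
    proof -
      obtain s where s: "r - s \<notin> \<Lambda>" "(\<lambda>u. P2 \<tau> (u - p) + P2 \<tau> (u - q)) = (\<lambda>u. P2 \<tau> (u - r) + P2 \<tau> (u - s))"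
      proof (cases "r = p")
        case True
        then show ?thesis using that[of q] pq by simp
      next
        case False
        then have "r = q" using r by simp
        then show ?thesis using that[of p] qp by (simp add: add.commute)
      qed
      have kr: "?k analytic_on {r}" using r by (auto intro: analytic_on_mult an)
      have "(\<lambda>z. P1 \<tau> z * ?t z) = (\<lambda>u. P2 \<tau> (u - r) * ?k u + P2 \<tau> (u - s) * ?k u)"
        by (simp only: fun_cong[OF s(2)]) (simp add: algebra_simps)
      then have "residue (\<lambda>z. P1 \<tau> z * ?t z) r =
          residue (\<lambda>u. P2 \<tau> (u - r) * ?k u) r + residue (\<lambda>u. P2 \<tau> (u - s) * ?k u) r"
        by (simp only:) (intro residue_add_at meromorphic_on_mult P2_shift_meromorphic V_mero
            meromorphic_on_UNIV_subset[OF P1_meromorphic])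
      also have "residue (\<lambda>u. P2 \<tau> (u - s) * ?k u) r = 0"
        by (rule residue_analytic_eq_0[OF analytic_on_mult[OF P2_shift_analytic[OF s(1)] kr]]) simp
      finally show ?thesis using residue_P2_times[OF kr] by simp
    qed
    ultimately show ?thesis using ne by (simp add: diff_diff_eq)
  qed
qed

text \<open>The factor 2 undoes the 1/2 in \<open>c0\<close>; it is matched by two equal
  contributions to the contour integral.\<close>

lemma deriv_integrand_eq:
  assumes x: "x \<notin> H" and V: "V analytic_on {x}" "\<forall>\<^sub>F u in nhds x. w u = V u"
  shows "deriv (\<lambda>u. P1 \<tau> u / wp' \<tau> u * (w u / wp' \<tau> u)) x = 2 * deriv (\<lambda>u. P1 \<tau> u * (c0 u * V u)) x"
proof -
  have "\<forall>\<^sub>F u in nhds x. P1 \<tau> u / wp' \<tau> u * (w u / wp' \<tau> u) = 2 * (P1 \<tau> u * (c0 u * V u))"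
    using V(2) by eventually_elim (simp add: power2_eq_square)
  then have "deriv (\<lambda>u. P1 \<tau> u / wp' \<tau> u * (w u / wp' \<tau> u)) x = deriv (\<lambda>u. 2 * (P1 \<tau> u * (c0 u * V u))) x"
    by (rule deriv_cong_ev) simp
  also have "(\<lambda>u. P1 \<tau> u * (c0 u * V u)) analytic_on {x}"
    by (intro analytic_on_mult P1_analytic_regular[OF x] analytic_at_even_elliptic[OF inverse_wp'_square_even_elliptic x] V)
  then have "deriv (\<lambda>u. 2 * (P1 \<tau> u * (c0 u * V u))) x = 2 * deriv (\<lambda>u. P1 \<tau> u * (c0 u * V u)) x"
    by (intro deriv_cmult analytic_on_imp_differentiable_at) auto
  finally show ?thesis .
qed

lemma path_image_A_cycle_regular:
  assumes "0 < \<epsilon>" "\<epsilon> < Im \<tau> / 2" "u \<in> path_image (A_cycle \<epsilon>)"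
  shows "u \<notin> H"
proof
  have Im: "Im u = \<epsilon>" using assms(3) 
    by (auto simp: A_cycle_def path_image_linepath closed_segment_def algebra_simps)
  assume "u \<in> H"
  then have "u \<in> singular_set {}" by (simp add: singular_set_def)
  from singular_in_strip[OF this, of 0] obtain p n where p: "p \<in> strip_reps" "u = p + of_int n"
    using Im assms(1,2) by auto
  then show False using strip_reps_properties(2)[OF p(1)] Im assms by auto
qed

text \<open>The contour avoids \<open>H\<close>, so the integrand may be replaced by its decomposed
  form.\<close>

lemma B_eq:
  assumes eps: "0 < \<epsilon>" "\<epsilon> < Im \<tau> / 2" and q: "(q has_contour_integral c) (A_cycle \<epsilon>)"
    and eq: "\<And>u. u \<notin> H \<Longrightarrow> recursion_integrand \<alpha> g zs u = q u"
  shows "B \<tau> \<alpha> \<epsilon> g zs = c"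
proof -
  have "B \<tau> \<alpha> \<epsilon> g zs = contour_integral (A_cycle \<epsilon>) (recursion_integrand \<alpha> g zs)"
    unfolding B_def recursion_integrand_def[abs_def] ..
  also have "\<dots> = contour_integral (A_cycle \<epsilon>) q"
    by (rule contour_integral_eq) (use path_image_A_cycle_regular[OF eps] eq in blast)
  finally show ?thesis using contour_integral_unique[OF q] by simp
qed

text \<open>The integrand is split into a summand with poles on \<open>H\<close> only and one
  summand for each point, so that each contour integral meets at most two further poles modulo the
  lattice. In this way the points may coincide with each other.\<close>

lemma B_formula_general:
  assumes eps: "0 < \<epsilon>" "\<epsilon> < Im \<tau> / 2" and zs: "regular n zs"
    and Im: "\<And>i. i < n \<Longrightarrow> \<bar>Im (zs ! i)\<bar> < \<epsilon>"
    and gn: "2 * g + n \<ge> 2" "(g, n) \<noteq> (0, 2)"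
  shows "B \<tau> \<alpha> \<epsilon> g zs = - W \<tau> \<alpha> g (0 # zs) +
    (\<Sum>i<n. deriv (\<lambda>u. P1 \<tau> u / wp' \<tau> u * (W \<tau> \<alpha> g ((- u) # remove_nth i zs) / wp' \<tau> u)) (zs ! i))"
proof -
  obtain S where S: "S \<in> elliptic_alg (Suc n)"
    "\<And>u zs. u \<notin> H \<Longrightarrow> regular n zs \<Longrightarrow> recursion_integrand \<alpha> g zs u = c0 u * S (u # zs) -
      (\<Sum>i<n. (P2 \<tau> (u - zs ! i) + P2 \<tau> (u + zs ! i)) * (c0 u * W \<tau> \<alpha> g (u # remove_nth i zs)))"
    using recursion_integrand_decomposition[OF W_elliptic_alg gn] by blast
  define S0 where "S0 u = c0 u * S (u # zs)" for u
  define V where "V i u = c0 u * W \<tau> \<alpha> g (u # remove_nth i zs)" for i u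
  define T where "T i u = (P2 \<tau> (u - zs ! i) + P2 \<tau> (u - - (zs ! i))) * V i u" for i u
  define k where "k i u = P1 \<tau> u * V i u" for i u
  have S0: "S0 \<in> \<E>"
    unfolding S0_def[abs_def]
    by (intro even_elliptic_mult inverse_wp'_square_even_elliptic elliptic_alg_even_elliptic[OF S(1) zs])
  have V: "V i \<in> \<E>" if "i < n" for i
    unfolding V_def[abs_def] using c0_W_even_elliptic[OF W_elliptic_alg gn zs that] by simp
  note x = regular_nth[OF zs]
  have Sq: "recursion_integrand \<alpha> g zs u = S0 u - (\<Sum>i<n. T i u)" if "u \<notin> H" for u
    using S(2)[OF that zs] by (simp add: S0_def T_def V_def)
  have S0_int: "(S0 has_contour_integral - ram_residues S0) (A_cycle \<epsilon>)"
    using A_cycle_residues[OF eps, of "{}" S0] even_elliptic_holomorphic[OF S0]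
      even_elliptic_plus[OF S0] even_elliptic_meromorphic[OF S0] by (simp add: singular_set_def)
  have T_mero: "T i meromorphic_on UNIV" if "i < n" for i
    unfolding T_def
    by (intro meromorphic_on_mult meromorphic_on_add P2_shift_meromorphic even_elliptic_meromorphic[OF V[OF that]])
  \<comment> \<open>\<open>P1\<close> is odd and \<open>V i\<close> is even, so the poles at
    \<open>zs ! i\<close> and at its negative contribute equally.\<close>
  have k_mirror: "deriv (k i) (zs ! i) = deriv (k i) (- (zs ! i))" if i: "i < n" for i
  proof (rule deriv_mirror)
    show "k i analytic_on {- (zs ! i)}"
      unfolding k_def using x[OF i]
      by (intro analytic_on_mult P1_analytic_regular analytic_at_even_elliptic[OF V[OF i]]) auto
    show "\<forall>\<^sub>F u in nhds (zs ! i). k i u = - k i (- u)"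
      using eventually_nhds_not_half_lattice[OF x[OF i]]
      by eventually_elim (simp add: k_def P1_minus even_elliptic_minus[OF V[OF i]])
  qed
  have T_int: "(T i has_contour_integral - ram_residues (T i) - 2 * deriv (k i) (zs ! i)) (A_cycle \<epsilon>)" if i: "i < n" for i
    using A_cycle_two_poles(2)[OF eps x[OF i] Im[OF i] _ _ double_notin_lattice(1)[OF x[OF i]] V[OF i]]
      x[OF i] Im[OF i] k_mirror[OF i] unfolding T_def[abs_def] k_def[abs_def] by (simp add: algebra_simps)
  let ?q = "\<lambda>u. S0 u - (\<Sum>i<n. T i u)"
  have "(?q has_contour_integral - ram_residues S0 - (\<Sum>i<n. - ram_residues (T i) - 2 * deriv (k i) (zs ! i))) (A_cycle \<epsilon>)"
    by (intro has_contour_integral_diff has_contour_integral_sum S0_int T_int) auto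
  from B_eq[OF eps this Sq]
  have B: "B \<tau> \<alpha> \<epsilon> g zs = - (ram_residues S0 - (\<Sum>i<n. ram_residues (T i))) + (\<Sum>i<n. 2 * deriv (k i) (zs ! i))"
    by (simp add: sum_subtractf sum_negf)
  have "W \<tau> \<alpha> g (0 # zs) = ram_residues ?q"
    by (rule W_at_0[OF gn(1) zs _ Sq])
       (intro meromorphic_on_diff meromorphic_on_sum even_elliptic_meromorphic[OF S0] T_mero, simp)
  also have "\<dots> = ram_residues S0 - ram_residues (\<lambda>u. \<Sum>i<n. T i u)"
    by (intro ram_residues_diff meromorphic_on_sum even_elliptic_meromorphic[OF S0] T_mero) simp
  also have "ram_residues (\<lambda>u. \<Sum>i<n. T i u) = (\<Sum>i<n. ram_residues (T i))"
    by (intro ram_residues_sum T_mero) auto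
  finally have W: "W \<tau> \<alpha> g (0 # zs) = ram_residues S0 - (\<Sum>i<n. ram_residues (T i))" .
  have "deriv (\<lambda>u. P1 \<tau> u / wp' \<tau> u * (W \<tau> \<alpha> g ((- u) # remove_nth i zs) / wp' \<tau> u)) (zs ! i) =
      2 * deriv (k i) (zs ! i)" if i: "i < n" for i
  proof -
    have alg: "W \<tau> \<alpha> g \<in> elliptic_alg (Suc (n - 1))" using W_elliptic_alg[of n g] gn i by (cases g) auto
    note r = regular_remove_nth[OF zs i]
    have "\<forall>\<^sub>F u in nhds (zs ! i). W \<tau> \<alpha> g ((- u) # remove_nth i zs) = W \<tau> \<alpha> g (u # remove_nth i zs)"
      using eventually_nhds_not_half_lattice[OF x[OF i]]
      by eventually_elim (rule elliptic_alg_uminus_hd[OF alg], use r in \<open>simp add: regular_Cons\<close>)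
    with deriv_integrand_eq[OF x[OF i] analytic_at_even_elliptic[OF elliptic_alg_even_elliptic[OF alg r] x[OF i]]]
    show ?thesis by (simp add: k_def[abs_def] V_def[abs_def])
  qed
  then show ?thesis unfolding B W by simp
qed

text \<open>Off \<open>H\<close>, each of the two products has its poles, modulo the lattice, at one
  point and at the negative of the other; these are distinct as \<open>x + y\<close> is no lattice
  point. By parity both products contribute the same two derivatives, which produces the factor
  2.\<close>

lemma B_formula_0_2:
  assumes eps: "0 < \<epsilon>" "\<epsilon> < Im \<tau> / 2" and xy: "x \<notin> H" "y \<notin> H" "x + y \<notin> \<Lambda>"
    and Im: "\<bar>Im x\<bar> < \<epsilon>" "\<bar>Im y\<bar> < \<epsilon>"
  shows "B \<tau> \<alpha> \<epsilon> 0 [x, y] = - W \<tau> \<alpha> 0 [0, x, y] +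
    (deriv (\<lambda>u. P1 \<tau> u / wp' \<tau> u * (W \<tau> \<alpha> 0 [- u, y] / wp' \<tau> u)) x +
     deriv (\<lambda>u. P1 \<tau> u / wp' \<tau> u * (W \<tau> \<alpha> 0 [- u, x] / wp' \<tau> u)) y)"
proof -
  note c0 = inverse_wp'_square_even_elliptic
  define t where "t x y = (\<lambda>u. P2 \<tau> (u - x) * P2 \<tau> (u - - y) * c0 u)" for x y
  define k where "k y = (\<lambda>u. P1 \<tau> u * (P2 \<tau> (u - - y) * c0 u))" for y
  have t_int: "(t x y has_contour_integral - ram_residues (t x y) - deriv (k y) x - deriv (k x) y) (A_cycle \<epsilon>)"
    if xy: "x \<notin> H" "y \<notin> H" "x + y \<notin> \<Lambda>" and Im: "\<bar>Im x\<bar> < \<epsilon>" "\<bar>Im y\<bar> < \<epsilon>" for x y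
  proof -
    have "- y - x = - (x + y)" by simp
    then have n: "x - - y \<notin> \<Lambda>" "- y - x \<notin> \<Lambda>" "- y \<notin> H"
      using xy by (simp_all only: lattice_uminus_iff half_lattice_minus_iff diff_minus_eq_add not_False_eq_True)
    have "deriv (k x) y = deriv (\<lambda>u. P1 \<tau> u * (P2 \<tau> (u - x) * c0 u)) (- y)"
    proof (rule deriv_mirror)
      show "(\<lambda>u. P1 \<tau> u * (P2 \<tau> (u - x) * c0 u)) analytic_on {- y}"
        by (intro analytic_on_mult P1_analytic_regular analytic_at_even_elliptic[OF c0] P2_shift_analytic n)
      show "\<forall>\<^sub>F u in nhds y. k x u = - (P1 \<tau> (- u) * (P2 \<tau> (- u - x) * c0 (- u)))"
        using eventually_nhds_not_half_lattice[OF xy(2)]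
      proof eventually_elim
        case (elim u)
        have "P2 \<tau> (- u - x) = P2 \<tau> (u - - x)" using P2_minus[of "u + x"] by simp
        then show ?case unfolding k_def P1_minus even_elliptic_minus[OF c0 elim] by simp
      qed
    qed
    then show ?thesis
      using A_cycle_two_poles(1)[OF eps xy(1) Im(1) n(3) _ n(1) c0] Im(2) unfolding t_def k_def by simp
  qed
  have t_mero: "t x y meromorphic_on UNIV" for x y
    unfolding t_def by (intro meromorphic_on_mult P2_shift_meromorphic even_elliptic_meromorphic[OF c0])
  let ?q = "\<lambda>u. (0 - t x y u) - t y x u"
  have q: "recursion_integrand \<alpha> 0 [x, y] u = ?q u" for u
    by (simp add: recursion_integrand_0_2 t_def mult_ac)
  have "(?q has_contour_integral (0 - (- ram_residues (t x y) - deriv (k y) x - deriv (k x) y)) -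
      (- ram_residues (t y x) - deriv (k x) y - deriv (k y) x)) (A_cycle \<epsilon>)"
    by (intro has_contour_integral_diff has_contour_integral_0 t_int xy Im) (use xy in \<open>simp add: add.commute\<close>)
  from B_eq[OF eps this q]
  have B: "B \<tau> \<alpha> \<epsilon> 0 [x, y] = ram_residues (t x y) + ram_residues (t y x) + (2 * deriv (k y) x + 2 * deriv (k x) y)"
    by (simp add: algebra_simps)
  have zs: "regular 2 [x, y]" using xy by (simp add: regular_def)
  have m: "(\<lambda>u. 0 - t x y u) meromorphic_on UNIV" by (intro meromorphic_on_diff meromorphic_on_const t_mero)
  have "W \<tau> \<alpha> 0 (0 # [x, y]) = ram_residues ?q"
    by (rule W_at_0[OF _ zs meromorphic_on_diff[OF m t_mero] q]) simp
  also have "\<dots> = - ram_residues (t x y) - ram_residues (t y x)"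
    unfolding ram_residues_diff[OF m t_mero] ram_residues_diff[OF meromorphic_on_const t_mero] ram_residues_0 by simp
  finally have W: "W \<tau> \<alpha> 0 [0, x, y] = - ram_residues (t x y) - ram_residues (t y x)" .
  have d: "deriv (\<lambda>u. P1 \<tau> u / wp' \<tau> u * (W \<tau> \<alpha> 0 [- u, y] / wp' \<tau> u)) x = 2 * deriv (k y) x"
    if xy: "x \<notin> H" "x + y \<notin> \<Lambda>" for x y
  proof -
    have "(\<lambda>u. P2 \<tau> (u - - y)) analytic_on {x}" by (rule P2_shift_analytic) (use xy in simp)
    moreover have "W \<tau> \<alpha> 0 [- u, y] = P2 \<tau> (u - - y)" for u
      using P2_minus[of "u + y"] by (simp add: W_pair)
    ultimately show ?thesis
      using deriv_integrand_eq[OF xy(1), of "\<lambda>u. P2 \<tau> (u - - y)" "\<lambda>u. P2 \<tau> (u - - y)"]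
      by (simp add: k_def mult_ac)
  qed
  show ?thesis
    using B W d[of x y] d[of y x] xy by (simp add: add.commute)
qed

end

theorem corollary4p1:
  fixes \<tau> \<alpha> :: complex and \<epsilon> :: real and g :: nat and zs :: "complex list"
  assumes "Im \<tau> > 0"
    and "2 * g + length zs \<ge> 2"
    and "admissible_points \<tau> zs"
    and "admissible_shift \<tau> zs \<epsilon>"
    and "generic_base_point \<tau> zs \<epsilon> \<alpha>"
  shows "B \<tau> \<alpha> \<epsilon> g zs =
    - W \<tau> \<alpha> g ((- 0) # zs) +
    (\<Sum>i<length zs.
       deriv (\<lambda>u. P1 \<tau> u / wp' \<tau> u * (W \<tau> \<alpha> g ((- u) # remove_nth i zs) / wp' \<tau> u)) (zs ! i))"
proof -
  interpret upper_half \<tau> by unfold_locales (rule assms(1))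
  have eps: "0 < \<epsilon>" "\<epsilon> < Im \<tau> / 2" and Im: "\<And>i. i < length zs \<Longrightarrow> \<bar>Im (zs ! i)\<bar> < \<epsilon>"
    using assms(4) by (auto simp: admissible_shift_def)
  have "z \<notin> half_lattice" if z: "z \<in> set zs" for z
  proof
    assume "z \<in> half_lattice"
    then obtain a \<omega> where "a \<in> ram_points \<tau>" "\<omega> \<in> lattice \<tau>" "z = a + \<omega>" by (rule half_lattice_cases)
    then show False using assms(3) z unfolding admissible_points_def by (metis add_diff_cancel_left')
  qed
  then have zs: "regular (length zs) zs" by (auto simp: regular_def)
  show ?thesis
  \<comment> \<open>For \<open>(0, 2)\<close> the function \<open>W\<close> in the derivative term
    is \<open>W\<^sub>0\<^sub>,\<^sub>2\<close>, with a pole outside \<open>H\<close> at the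
    negative of the other point. Here the condition on sums of points enters.\<close>
  proof (cases "(g, length zs) = (0, 2)")
    case False
    then show ?thesis using B_formula_general[OF eps zs Im assms(2) False] by simp
  next
    case True
    then obtain x y where xy: "zs = [x, y]" by (auto simp: numeral_2_eq_2 length_Suc_conv)
    have sum2: "(\<Sum>i<length [x, y]. f i) = f 0 + f 1" for f :: "nat \<Rightarrow> complex"
      by (simp add: lessThan_Suc numeral_2_eq_2 add.commute)
    have n: "x \<notin> half_lattice" "y \<notin> half_lattice" using zs xy by (auto simp: regular_def)
    have "\<forall>i<length zs. \<forall>j<length zs. i \<noteq> j \<longrightarrow> zs ! i + zs ! j \<notin> lattice \<tau>"
      using assms(3) unfolding admissible_points_def by blast
    from this[rule_format, of 0 1] have "x + y \<notin> lattice \<tau>" using xy by simp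
    from B_formula_0_2[OF eps n this, of \<alpha>] show ?thesis
      using Im[of 0] Im[of 1] True unfolding xy sum2 by (simp add: remove_nth_def)
  qed
qed

end
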